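(* Let $k$ be a field, let $A$ be an artinian $k$-algebra, and let $E$ be a finite set of pairwise orthogonal primitive idempotents of $A$ with $1_A=\sum_{e\in E}e$. Let $\mathcal{C}_A$ be the $k$-linear category with object set $E$, with morphism spaces $\mathrm{Hom}_{\mathcal{C}_A}(e,f)=fAe$ for $e,f\in E$, and with composition given by the multiplication of $A$. Let $\mathrm{Hom}_k(\mathcal{C}_A,k\text{-}\mathbf{Mod})$ be the category of $k$-linear functors from $\mathcal{C}_A$ to the category of $k$-vector spaces, with natural transformations as morphisms. Then the category $\mathrm{Hom}_k(\mathcal{C}_A,k\text{-}\mathbf{Mod})$ is isomorphic to the category $A\text{-}\mathbf{Mod}$ of left $A$-modules.
   Context: Algebras are unital and associative over $k$, not necessarily commutative or finite dimensional. Artinian means satisfying the descending chain condition on both left and right ideals. Idempotents are not assumed to be central. A nonzero idempotent $e\in A$ is primitive if whenever $e=e_1+e_2$ with $e_1,e_2$ orthogonal idempotents of $A$, then $e_1=0$ or $e_2=0$.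
   Formalization: The algebra A is assumed nonzero: for A = 0 and E empty there is exactly one functor but many zero modules, so the categories are only equivalent; vector spaces and modules are those with underlying set inside an arbitrary fixed infinite universe. *)

theory Defs
  imports "HOL-Algebra.Module" "HOL-Algebra.Ideal"
begin

section \<open>Categories and linear categories\<close>

text \<open>
  The sets \<open>Mor C X Y\<close> for different pairs of objects are not required to be disjoint, so
  composition carries its three objects: \<open>Cmp C X Y Z g f\<close> is the composite of
  \<open>f : X \<rightarrow> Y\<close> and \<open>g : Y \<rightarrow> Z\<close>.
\<close>

record ('o, 'h) category =
  Obj :: "'o set"
  Mor :: "'o \<Rightarrow> 'o \<Rightarrow> 'h set"
  Ide :: "'o \<Rightarrow> 'h"
  Cmp :: "'o \<Rightarrow> 'o \<Rightarrow> 'o \<Rightarrow> 'h \<Rightarrow> 'h \<Rightarrow> 'h"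

locale category =
  fixes C :: "('o, 'h, 'z) category_scheme"
  assumes ide_closed: "X \<in> Obj C \<Longrightarrow> Ide C X \<in> Mor C X X"
    and cmp_closed: "\<lbrakk>X \<in> Obj C; Y \<in> Obj C; Z \<in> Obj C; f \<in> Mor C X Y; g \<in> Mor C Y Z\<rbrakk>
      \<Longrightarrow> Cmp C X Y Z g f \<in> Mor C X Z"
    and cmp_ide_right: "\<lbrakk>X \<in> Obj C; Y \<in> Obj C; f \<in> Mor C X Y\<rbrakk> \<Longrightarrow> Cmp C X X Y f (Ide C X) = f"
    and cmp_ide_left: "\<lbrakk>X \<in> Obj C; Y \<in> Obj C; f \<in> Mor C X Y\<rbrakk> \<Longrightarrow> Cmp C X Y Y (Ide C Y) f = f"
    and cmp_assoc: "\<lbrakk>W \<in> Obj C; X \<in> Obj C; Y \<in> Obj C; Z \<in> Obj C;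
        f \<in> Mor C W X; g \<in> Mor C X Y; h \<in> Mor C Y Z\<rbrakk>
      \<Longrightarrow> Cmp C W X Z (Cmp C X Y Z h g) f = Cmp C W Y Z h (Cmp C W X Y g f)"

record ('k, 'o, 'h) linear_category = "('o, 'h) category" +
  MorSpace :: "'o \<Rightarrow> 'o \<Rightarrow> ('k, 'h) module"

locale linear_category = field K + category C
  for K :: "('k, 'x) ring_scheme" (structure)
    and C :: "('k, 'o, 'h, 'z) linear_category_scheme" +
  assumes carrier_MorSpace:
      "\<lbrakk>X \<in> Obj C; Y \<in> Obj C\<rbrakk> \<Longrightarrow> carrier (MorSpace C X Y) = Mor C X Y"
    and module_MorSpace: "\<lbrakk>X \<in> Obj C; Y \<in> Obj C\<rbrakk> \<Longrightarrow> module K (MorSpace C X Y)"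
    and cmp_add_left: "\<lbrakk>X \<in> Obj C; Y \<in> Obj C; Z \<in> Obj C;
        f \<in> Mor C X Y; g \<in> Mor C Y Z; g' \<in> Mor C Y Z\<rbrakk>
      \<Longrightarrow> Cmp C X Y Z (g \<oplus>\<^bsub>MorSpace C Y Z\<^esub> g') f
          = Cmp C X Y Z g f \<oplus>\<^bsub>MorSpace C X Z\<^esub> Cmp C X Y Z g' f"
    and cmp_add_right: "\<lbrakk>X \<in> Obj C; Y \<in> Obj C; Z \<in> Obj C;
        f \<in> Mor C X Y; f' \<in> Mor C X Y; g \<in> Mor C Y Z\<rbrakk>
      \<Longrightarrow> Cmp C X Y Z g (f \<oplus>\<^bsub>MorSpace C X Y\<^esub> f')
          = Cmp C X Y Z g f \<oplus>\<^bsub>MorSpace C X Z\<^esub> Cmp C X Y Z g f'"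
    and cmp_smult_left: "\<lbrakk>X \<in> Obj C; Y \<in> Obj C; Z \<in> Obj C;
        c \<in> carrier K; f \<in> Mor C X Y; g \<in> Mor C Y Z\<rbrakk>
      \<Longrightarrow> Cmp C X Y Z (c \<odot>\<^bsub>MorSpace C Y Z\<^esub> g) f = c \<odot>\<^bsub>MorSpace C X Z\<^esub> Cmp C X Y Z g f"
    and cmp_smult_right: "\<lbrakk>X \<in> Obj C; Y \<in> Obj C; Z \<in> Obj C;
        c \<in> carrier K; f \<in> Mor C X Y; g \<in> Mor C Y Z\<rbrakk>
      \<Longrightarrow> Cmp C X Y Z g (c \<odot>\<^bsub>MorSpace C X Y\<^esub> f) = c \<odot>\<^bsub>MorSpace C X Z\<^esub> Cmp C X Y Z g f"


section \<open>Functors, natural transformations, isomorphism of categories\<close>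

record ('o, 'h, 'p, 'i) cat_functor =
  Fob :: "'o \<Rightarrow> 'p"
  Fmor :: "'o \<Rightarrow> 'o \<Rightarrow> 'h \<Rightarrow> 'i"

locale cat_functor = C: category C + D: category D
  for C :: "('o, 'h, 'y) category_scheme" and D :: "('p, 'i, 'z) category_scheme"
    and F :: "('o, 'h, 'p, 'i) cat_functor" +
  assumes Fob_closed: "X \<in> Obj C \<Longrightarrow> Fob F X \<in> Obj D"
    and Fmor_closed: "\<lbrakk>X \<in> Obj C; Y \<in> Obj C; f \<in> Mor C X Y\<rbrakk>
      \<Longrightarrow> Fmor F X Y f \<in> Mor D (Fob F X) (Fob F Y)"
    and Fmor_ide: "X \<in> Obj C \<Longrightarrow> Fmor F X X (Ide C X) = Ide D (Fob F X)"
    and Fmor_cmp: "\<lbrakk>X \<in> Obj C; Y \<in> Obj C; Z \<in> Obj C; f \<in> Mor C X Y; g \<in> Mor C Y Z\<rbrakk>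
      \<Longrightarrow> Fmor F X Z (Cmp C X Y Z g f)
          = Cmp D (Fob F X) (Fob F Y) (Fob F Z) (Fmor F Y Z g) (Fmor F X Y f)"

text \<open>Isomorphism, not merely equivalence: the two composites are the identity functors.\<close>

definition isomorphic_categories ::
    "('o, 'h, 'y) category_scheme \<Rightarrow> ('p, 'i, 'z) category_scheme \<Rightarrow> bool" where
  "isomorphic_categories C D \<longleftrightarrow> (\<exists>F G. cat_functor C D F \<and> cat_functor D C G \<and>
     (\<forall>X\<in>Obj C. Fob G (Fob F X) = X) \<and>
     (\<forall>X\<in>Obj C. \<forall>Y\<in>Obj C. \<forall>f\<in>Mor C X Y. Fmor G (Fob F X) (Fob F Y) (Fmor F X Y f) = f) \<and>
     (\<forall>X\<in>Obj D. Fob F (Fob G X) = X) \<and>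
     (\<forall>X\<in>Obj D. \<forall>Y\<in>Obj D. \<forall>f\<in>Mor D X Y. Fmor F (Fob G X) (Fob G Y) (Fmor G X Y f) = f))"

definition linear_maps ::
    "('r, 'x) ring_scheme \<Rightarrow> ('r, 'v, 'y) module_scheme \<Rightarrow> ('r, 'w, 'z) module_scheme \<Rightarrow> ('v \<Rightarrow> 'w) set"
  where
  "linear_maps R V W = {f \<in> carrier V \<rightarrow>\<^sub>E carrier W.
     (\<forall>x\<in>carrier V. \<forall>y\<in>carrier V. f (x \<oplus>\<^bsub>V\<^esub> y) = f x \<oplus>\<^bsub>W\<^esub> f y) \<and>
     (\<forall>r\<in>carrier R. \<forall>x\<in>carrier V. f (r \<odot>\<^bsub>V\<^esub> x) = r \<odot>\<^bsub>W\<^esub> f x)}"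

locale linear_functor = cat_functor C D F + C: linear_category K C + D: linear_category K D
  for K :: "('k, 'x) ring_scheme" (structure)
    and C :: "('k, 'o, 'h, 'y) linear_category_scheme"
    and D :: "('k, 'p, 'i, 'z) linear_category_scheme"
    and F :: "('o, 'h, 'p, 'i) cat_functor" +
  assumes Fmor_linear: "\<lbrakk>X \<in> Obj C; Y \<in> Obj C\<rbrakk>
      \<Longrightarrow> Fmor F X Y \<in> linear_maps K (MorSpace C X Y) (MorSpace D (Fob F X) (Fob F Y))"

text \<open>
  HOL functions are total, so a functor would otherwise have many representatives that differ only
  off the category. The functor category is formed from those that are \<open>undefined\<close> there.
  (On \<open>Mor C X Y\<close> itself, \<^const>\<open>linear_maps\<close> already imposes this.)
\<close>

definition functor_extensional ::
    "('o, 'h, 'y) category_scheme \<Rightarrow> ('o, 'h, 'p, 'i) cat_functor \<Rightarrow> bool" where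
  "functor_extensional C F \<longleftrightarrow> Fob F \<in> extensional (Obj C) \<and>
     (\<forall>X Y f. \<not> (X \<in> Obj C \<and> Y \<in> Obj C \<and> f \<in> Mor C X Y) \<longrightarrow> Fmor F X Y f = undefined)"

definition natural_transformations ::
    "('o, 'h, 'y) category_scheme \<Rightarrow> ('p, 'i, 'z) category_scheme \<Rightarrow>
     ('o, 'h, 'p, 'i) cat_functor \<Rightarrow> ('o, 'h, 'p, 'i) cat_functor \<Rightarrow> ('o \<Rightarrow> 'i) set" where
  "natural_transformations C D F G = {\<eta> \<in> (\<Pi>\<^sub>E X\<in>Obj C. Mor D (Fob F X) (Fob G X)).
     \<forall>X\<in>Obj C. \<forall>Y\<in>Obj C. \<forall>f\<in>Mor C X Y.
       Cmp D (Fob F X) (Fob F Y) (Fob G Y) (\<eta> Y) (Fmor F X Y f)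
       = Cmp D (Fob F X) (Fob G X) (Fob G Y) (Fmor G X Y f) (\<eta> X)}"

definition linear_functor_category ::
    "('k, 'x) ring_scheme \<Rightarrow> ('k, 'o, 'h, 'y) linear_category_scheme \<Rightarrow>
     ('k, 'p, 'i, 'z) linear_category_scheme \<Rightarrow>
     (('o, 'h, 'p, 'i) cat_functor, 'o \<Rightarrow> 'i) category" where
  "linear_functor_category K C D =
    \<lparr>Obj = {F. linear_functor K C D F \<and> functor_extensional C F},
     Mor = natural_transformations C D,
     Ide = (\<lambda>F. \<lambda>X\<in>Obj C. Ide D (Fob F X)),
     Cmp = (\<lambda>F G H \<theta> \<eta>. \<lambda>X\<in>Obj C. Cmp D (Fob F X) (Fob G X) (Fob H X) (\<theta> X) (\<eta> X))\<rparr>"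


section \<open>Modules\<close>

text \<open>
  The library locale \<open>module\<close> requires a commutative ring of scalars; this one does not.
\<close>

locale left_module = R?: ring R + M?: abelian_group M
  for R :: "('r, 'x) ring_scheme" (structure) and M :: "('r, 'm, 'z) module_scheme" (structure) +
  assumes smult_closed: "\<lbrakk>a \<in> carrier R; x \<in> carrier M\<rbrakk> \<Longrightarrow> a \<odot>\<^bsub>M\<^esub> x \<in> carrier M"
    and smult_l_distr: "\<lbrakk>a \<in> carrier R; b \<in> carrier R; x \<in> carrier M\<rbrakk>
      \<Longrightarrow> (a \<oplus>\<^bsub>R\<^esub> b) \<odot>\<^bsub>M\<^esub> x = a \<odot>\<^bsub>M\<^esub> x \<oplus>\<^bsub>M\<^esub> b \<odot>\<^bsub>M\<^esub> x"
    and smult_r_distr: "\<lbrakk>a \<in> carrier R; x \<in> carrier M; y \<in> carrier M\<rbrakk>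
      \<Longrightarrow> a \<odot>\<^bsub>M\<^esub> (x \<oplus>\<^bsub>M\<^esub> y) = a \<odot>\<^bsub>M\<^esub> x \<oplus>\<^bsub>M\<^esub> a \<odot>\<^bsub>M\<^esub> y"
    and smult_assoc1: "\<lbrakk>a \<in> carrier R; b \<in> carrier R; x \<in> carrier M\<rbrakk>
      \<Longrightarrow> (a \<otimes>\<^bsub>R\<^esub> b) \<odot>\<^bsub>M\<^esub> x = a \<odot>\<^bsub>M\<^esub> (b \<odot>\<^bsub>M\<^esub> x)"
    and smult_one: "x \<in> carrier M \<Longrightarrow> \<one>\<^bsub>R\<^esub> \<odot>\<^bsub>M\<^esub> x = x"

text \<open>
  The record type \<open>module\<close> extends \<open>ring\<close>, so it has fields \<open>mult\<close> and \<open>one\<close> that mean nothing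
  for a module, and its operations are total functions. In order that equality of records is
  equality of modules, the objects of the module categories have these junk values fixed to
  \<open>undefined\<close>.
\<close>

definition module_extensional ::
    "('r, 'x) ring_scheme \<Rightarrow> ('r, 'm) module \<Rightarrow> bool" where
  "module_extensional R M \<longleftrightarrow> mult M = undefined \<and> one M = undefined \<and>
     (\<forall>x y. \<not> (x \<in> carrier M \<and> y \<in> carrier M) \<longrightarrow> x \<oplus>\<^bsub>M\<^esub> y = undefined) \<and>
     (\<forall>r x. \<not> (r \<in> carrier R \<and> x \<in> carrier M) \<longrightarrow> r \<odot>\<^bsub>M\<^esub> x = undefined)"

text \<open>
  The categories of all \<open>K\<close>-vector spaces and of all left \<open>R\<close>-modules whose underlying set is a
  subset of the type \<open>'m\<close>. The type \<open>'m\<close> plays the role of the universe of small sets.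
\<close>

definition Vect :: "('k, 'x) ring_scheme \<Rightarrow> ('k, ('k, 'm) module, 'm \<Rightarrow> 'm) linear_category" where
  "Vect K =
    \<lparr>Obj = {V. module K V \<and> module_extensional K V},
     Mor = linear_maps K,
     Ide = (\<lambda>V. \<lambda>x\<in>carrier V. x),
     Cmp = (\<lambda>U V W g f. compose (carrier U) g f),
     MorSpace = (\<lambda>V W.
       \<lparr>carrier = linear_maps K V W, mult = undefined, one = undefined,
        zero = (\<lambda>x\<in>carrier V. \<zero>\<^bsub>W\<^esub>),
        add = (\<lambda>f g. \<lambda>x\<in>carrier V. f x \<oplus>\<^bsub>W\<^esub> g x),
        smult = (\<lambda>c f. \<lambda>x\<in>carrier V. c \<odot>\<^bsub>W\<^esub> f x)\<rparr>)\<rparr>"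

definition LMod :: "('r, 'x) ring_scheme \<Rightarrow> (('r, 'm) module, 'm \<Rightarrow> 'm) category" where
  "LMod R =
    \<lparr>Obj = {M. left_module R M \<and> module_extensional R M},
     Mor = linear_maps R,
     Ide = (\<lambda>M. \<lambda>x\<in>carrier M. x),
     Cmp = (\<lambda>L M N g f. compose (carrier L) g f)\<rparr>"


section \<open>Algebras and idempotents\<close>

text \<open>
  The library locale \<open>algebra\<close> requires the algebra to be commutative; this one does not.
\<close>

locale assoc_algebra = K: field K + A: ring A + module K A
  for K :: "('k, 'x) ring_scheme" and A :: "('k, 'a, 'z) module_scheme" +
  assumes smult_mult_left: "\<lbrakk>c \<in> carrier K; x \<in> carrier A; y \<in> carrier A\<rbrakk>
      \<Longrightarrow> (c \<odot>\<^bsub>A\<^esub> x) \<otimes>\<^bsub>A\<^esub> y = c \<odot>\<^bsub>A\<^esub> (x \<otimes>\<^bsub>A\<^esub> y)"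
    and smult_mult_right: "\<lbrakk>c \<in> carrier K; x \<in> carrier A; y \<in> carrier A\<rbrakk>
      \<Longrightarrow> x \<otimes>\<^bsub>A\<^esub> (c \<odot>\<^bsub>A\<^esub> y) = c \<odot>\<^bsub>A\<^esub> (x \<otimes>\<^bsub>A\<^esub> y)"

definition left_ideal :: "'a set \<Rightarrow> ('a, 'z) ring_scheme \<Rightarrow> bool" where
  "left_ideal I R \<longleftrightarrow> additive_subgroup I R \<and> (\<forall>a\<in>carrier R. \<forall>x\<in>I. a \<otimes>\<^bsub>R\<^esub> x \<in> I)"

definition right_ideal :: "'a set \<Rightarrow> ('a, 'z) ring_scheme \<Rightarrow> bool" where
  "right_ideal I R \<longleftrightarrow> additive_subgroup I R \<and> (\<forall>a\<in>carrier R. \<forall>x\<in>I. x \<otimes>\<^bsub>R\<^esub> a \<in> I)"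

definition artinian :: "('a, 'z) ring_scheme \<Rightarrow> bool" where
  "artinian R \<longleftrightarrow>
     (\<forall>I :: nat \<Rightarrow> 'a set. (\<forall>n. left_ideal (I n) R) \<and> antimono I \<longrightarrow> (\<exists>n. \<forall>m\<ge>n. I m = I n)) \<and>
     (\<forall>I :: nat \<Rightarrow> 'a set. (\<forall>n. right_ideal (I n) R) \<and> antimono I \<longrightarrow> (\<exists>n. \<forall>m\<ge>n. I m = I n))"

definition idempotent_elem :: "('a, 'z) ring_scheme \<Rightarrow> 'a \<Rightarrow> bool" where
  "idempotent_elem R e \<longleftrightarrow> e \<in> carrier R \<and> e \<otimes>\<^bsub>R\<^esub> e = e"

definition orthogonal_elems :: "('a, 'z) ring_scheme \<Rightarrow> 'a \<Rightarrow> 'a \<Rightarrow> bool" where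
  "orthogonal_elems R e f \<longleftrightarrow> e \<otimes>\<^bsub>R\<^esub> f = \<zero>\<^bsub>R\<^esub> \<and> f \<otimes>\<^bsub>R\<^esub> e = \<zero>\<^bsub>R\<^esub>"

definition primitive_idempotent :: "('a, 'z) ring_scheme \<Rightarrow> 'a \<Rightarrow> bool" where
  "primitive_idempotent R e \<longleftrightarrow> idempotent_elem R e \<and> e \<noteq> \<zero>\<^bsub>R\<^esub> \<and>
     (\<forall>e1 e2. idempotent_elem R e1 \<and> idempotent_elem R e2 \<and> orthogonal_elems R e1 e2 \<and>
        e = e1 \<oplus>\<^bsub>R\<^esub> e2 \<longrightarrow> e1 = \<zero>\<^bsub>R\<^esub> \<or> e2 = \<zero>\<^bsub>R\<^esub>)"

text \<open>
  The category with object set \<open>E\<close> and \<open>Hom(e, f) = fAe\<close>. The linear structure on \<open>fAe\<close> is the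
  restriction of the one on \<open>A\<close>.
\<close>

definition corner :: "('a, 'z) ring_scheme \<Rightarrow> 'a \<Rightarrow> 'a \<Rightarrow> 'a set" where
  "corner R e f = {f \<otimes>\<^bsub>R\<^esub> a \<otimes>\<^bsub>R\<^esub> e |a. a \<in> carrier R}"

definition idempotent_category ::
    "('k, 'a) module \<Rightarrow> 'a set \<Rightarrow> ('k, 'a, 'a) linear_category" where
  "idempotent_category A E =
    \<lparr>Obj = E,
     Mor = corner A,
     Ide = (\<lambda>e. e),
     Cmp = (\<lambda>e f g y x. y \<otimes>\<^bsub>A\<^esub> x),
     MorSpace = (\<lambda>e f. A\<lparr>carrier := corner A e f\<rparr>)\<rparr>"


section \<open>The constructions above are categories\<close>

lemma linear_mapsD:
  assumes "f \<in> linear_maps R V W"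
  shows "x \<in> carrier V \<Longrightarrow> f x \<in> carrier W"
    and "x \<notin> carrier V \<Longrightarrow> f x = undefined"
    and "\<lbrakk>x \<in> carrier V; y \<in> carrier V\<rbrakk> \<Longrightarrow> f (x \<oplus>\<^bsub>V\<^esub> y) = f x \<oplus>\<^bsub>W\<^esub> f y"
    and "\<lbrakk>r \<in> carrier R; x \<in> carrier V\<rbrakk> \<Longrightarrow> f (r \<odot>\<^bsub>V\<^esub> x) = r \<odot>\<^bsub>W\<^esub> f x"
  using assms by (auto simp: linear_maps_def)

lemma linear_mapsI:
  assumes "\<And>x. x \<in> carrier V \<Longrightarrow> f x \<in> carrier W"
    and "\<And>x. x \<notin> carrier V \<Longrightarrow> f x = undefined"
    and "\<And>x y. \<lbrakk>x \<in> carrier V; y \<in> carrier V\<rbrakk> \<Longrightarrow> f (x \<oplus>\<^bsub>V\<^esub> y) = f x \<oplus>\<^bsub>W\<^esub> f y"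
    and "\<And>r x. \<lbrakk>r \<in> carrier R; x \<in> carrier V\<rbrakk> \<Longrightarrow> f (r \<odot>\<^bsub>V\<^esub> x) = r \<odot>\<^bsub>W\<^esub> f x"
  shows "f \<in> linear_maps R V W"
  using assms by (auto simp: linear_maps_def)

lemma linear_maps_id:
  assumes "\<And>x y. \<lbrakk>x \<in> carrier V; y \<in> carrier V\<rbrakk> \<Longrightarrow> x \<oplus>\<^bsub>V\<^esub> y \<in> carrier V"
    and "\<And>r x. \<lbrakk>r \<in> carrier R; x \<in> carrier V\<rbrakk> \<Longrightarrow> r \<odot>\<^bsub>V\<^esub> x \<in> carrier V"
  shows "(\<lambda>x\<in>carrier V. x) \<in> linear_maps R V V"
  using assms by (auto simp: linear_maps_def)

lemma linear_maps_compose: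
  assumes "f \<in> linear_maps R U V" "g \<in> linear_maps R V W"
    and "\<And>x y. \<lbrakk>x \<in> carrier U; y \<in> carrier U\<rbrakk> \<Longrightarrow> x \<oplus>\<^bsub>U\<^esub> y \<in> carrier U"
    and "\<And>r x. \<lbrakk>r \<in> carrier R; x \<in> carrier U\<rbrakk> \<Longrightarrow> r \<odot>\<^bsub>U\<^esub> x \<in> carrier U"
  shows "compose (carrier U) g f \<in> linear_maps R U W"
  by (rule linear_mapsI)
    (simp_all add: compose_def assms(3,4) linear_mapsD[OF assms(1)] linear_mapsD[OF assms(2)])

lemma linear_maps_PiE: "f \<in> linear_maps R V W \<Longrightarrow> f \<in> carrier V \<rightarrow>\<^sub>E carrier W"
  by (simp add: linear_maps_def)

lemma category_linear_maps:
  assumes "\<And>V x y. \<lbrakk>V \<in> S; x \<in> carrier V; y \<in> carrier V\<rbrakk> \<Longrightarrow> x \<oplus>\<^bsub>V\<^esub> y \<in> carrier V"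
    and "\<And>V r x. \<lbrakk>V \<in> S; r \<in> carrier R; x \<in> carrier V\<rbrakk> \<Longrightarrow> r \<odot>\<^bsub>V\<^esub> x \<in> carrier V"
    and "Obj C = S" "Mor C = linear_maps R" "Ide C = (\<lambda>V. \<lambda>x\<in>carrier V. x)"
    and "Cmp C = (\<lambda>U V W g f. compose (carrier U) g f)"
  shows "category C"
proof (unfold_locales, unfold assms(3-))
  fix W X Y Z f g h
  assume S: "W \<in> S" "X \<in> S" "Y \<in> S" "Z \<in> S"
    and f: "f \<in> linear_maps R W X" and g: "g \<in> linear_maps R X Y" and h: "h \<in> linear_maps R Y Z"
  show "compose (carrier W) (compose (carrier X) h g) f
      = compose (carrier W) h (compose (carrier W) g f)"
    using linear_mapsD(1)[OF f] by (auto simp: compose_def fun_eq_iff)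
next
  fix X Y f assume "X \<in> S" "Y \<in> S" and f: "f \<in> linear_maps R X Y"
  show "compose (carrier X) f (\<lambda>x\<in>carrier X. x) = f"
    using linear_mapsD(2)[OF f] by (auto simp: compose_def fun_eq_iff)
  show "compose (carrier X) (\<lambda>x\<in>carrier Y. x) f = f"
    using linear_mapsD(1,2)[OF f] by (auto simp: compose_def fun_eq_iff)
next
  fix X assume "X \<in> S"
  then show "(\<lambda>x\<in>carrier X. x) \<in> linear_maps R X X"
    by (intro linear_maps_id assms(1,2))
next
  fix X Y Z f g
  assume "X \<in> S" "f \<in> linear_maps R X Y" "g \<in> linear_maps R Y Z"
  then show "compose (carrier X) g f \<in> linear_maps R X Z"
    by (intro linear_maps_compose assms(1,2))
qed

theorem category_LMod:
  fixes R :: "('r, 'x) ring_scheme"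
  shows "category (LMod R :: (('r, 'm) module, 'm \<Rightarrow> 'm) category)"
proof (rule category_linear_maps[where S = "Obj (LMod R)" and R = R])
  fix V :: "('r, 'm) module" and x y assume "V \<in> Obj (LMod R)"
  then interpret left_module R V by (simp add: LMod_def)
  show "x \<in> carrier V \<Longrightarrow> y \<in> carrier V \<Longrightarrow> x \<oplus>\<^bsub>V\<^esub> y \<in> carrier V" by simp
next
  fix V :: "('r, 'm) module" and r x assume "V \<in> Obj (LMod R)"
  then interpret left_module R V by (simp add: LMod_def)
  show "r \<in> carrier R \<Longrightarrow> x \<in> carrier V \<Longrightarrow> r \<odot>\<^bsub>V\<^esub> x \<in> carrier V" by (rule smult_closed)
qed (simp_all add: LMod_def)

lemma category_Vect:
  fixes K :: "('r, 'x) ring_scheme"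
  shows "category (Vect K :: ('r, ('r, 'm) module, 'm \<Rightarrow> 'm) linear_category)"
proof (rule category_linear_maps[where S = "Obj (Vect K)" and R = K])
  fix V :: "('r, 'm) module" and x y assume "V \<in> Obj (Vect K)"
  then interpret module K V by (simp add: Vect_def)
  show "x \<in> carrier V \<Longrightarrow> y \<in> carrier V \<Longrightarrow> x \<oplus>\<^bsub>V\<^esub> y \<in> carrier V" by simp
next
  fix V :: "('r, 'm) module" and r x assume "V \<in> Obj (Vect K)"
  then interpret module K V by (simp add: Vect_def)
  show "r \<in> carrier K \<Longrightarrow> x \<in> carrier V \<Longrightarrow> r \<odot>\<^bsub>V\<^esub> x \<in> carrier V" by (rule smult_closed)
qed (simp_all add: Vect_def)

lemma module_linear_maps:
  assumes "module K V" "module K W"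
  shows "module K (MorSpace (Vect K) V W)"
proof -
  interpret V: module K V by fact
  interpret W: module K W by fact
  note D = linear_mapsD[of _ K V W]
  have add: "(\<lambda>x\<in>carrier V. f x \<oplus>\<^bsub>W\<^esub> g x) \<in> linear_maps K V W"
    if "f \<in> linear_maps K V W" "g \<in> linear_maps K V W" for f g
    by (rule linear_mapsI) (use that in \<open>auto simp: D W.smult_r_distr W.M.add.m_ac\<close>)
  have zero: "(\<lambda>x\<in>carrier V. \<zero>\<^bsub>W\<^esub>) \<in> linear_maps K V W"
    by (rule linear_mapsI) auto
  have smult: "(\<lambda>x\<in>carrier V. c \<odot>\<^bsub>W\<^esub> f x) \<in> linear_maps K V W"
    if "f \<in> linear_maps K V W" "c \<in> carrier K" for f c
    by (rule linear_mapsI)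
      (use that in \<open>auto simp: D W.smult_r_distr W.smult_assoc1[symmetric] V.R.m_comm\<close>)
  have grp: "abelian_group (MorSpace (Vect K) V W)"
  proof (rule abelian_groupI)
    fix f assume f: "f \<in> carrier (MorSpace (Vect K) V W)"
    have "(\<lambda>x\<in>carrier V. (\<ominus>\<^bsub>K\<^esub> \<one>\<^bsub>K\<^esub>) \<odot>\<^bsub>W\<^esub> f x) \<in> linear_maps K V W"
      using f by (intro smult) (auto simp: Vect_def)
    moreover have "(\<ominus>\<^bsub>K\<^esub> \<one>\<^bsub>K\<^esub>) \<odot>\<^bsub>W\<^esub> f x \<oplus>\<^bsub>W\<^esub> f x = \<zero>\<^bsub>W\<^esub>" if "x \<in> carrier V" for x
      using that f by (auto simp: Vect_def D W.smult_l_minus W.M.l_neg)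
    ultimately show "\<exists>g\<in>carrier (MorSpace (Vect K) V W). g \<oplus>\<^bsub>MorSpace (Vect K) V W\<^esub> f = \<zero>\<^bsub>MorSpace (Vect K) V W\<^esub>"
      by (intro bexI[of _ "\<lambda>x\<in>carrier V. (\<ominus>\<^bsub>K\<^esub> \<one>\<^bsub>K\<^esub>) \<odot>\<^bsub>W\<^esub> f x"])
        (auto simp: Vect_def fun_eq_iff)
  qed (auto simp: Vect_def add zero D fun_eq_iff W.M.add.m_ac)
  show ?thesis
    by (rule moduleI[OF V.is_cring grp])
      (auto simp: Vect_def smult D fun_eq_iff W.smult_l_distr W.smult_r_distr W.smult_assoc1)
qed

theorem linear_category_Vect:
  fixes K :: "('r, 'x) ring_scheme"
  assumes "field K"
  shows "linear_category K (Vect K :: ('r, ('r, 'm) module, 'm \<Rightarrow> 'm) linear_category)"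
proof -
  have [simp]: "Obj (Vect K) = {V. module K V \<and> module_extensional K V}"
    "Mor (Vect K) = linear_maps K" for K :: "('r, 'x) ring_scheme" by (simp_all add: Vect_def)
  show ?thesis
  proof (rule linear_category.intro[OF assms category_Vect linear_category_axioms.intro], goal_cases)
    case (1 X Y)
    then show ?case by (simp add: Vect_def)
  next
    case (2 X Y)
    then show ?case by (simp add: module_linear_maps)
  next
    case (3 X Y Z f g g')
    then have f: "f \<in> linear_maps K X Y" by simp
    show ?case
      using linear_mapsD(1)[OF f] by (auto simp: Vect_def compose_def fun_eq_iff)
  next
    case (4 X Y Z f f' g)
    then have f: "f \<in> linear_maps K X Y" and f': "f' \<in> linear_maps K X Y"
      and g: "g \<in> linear_maps K Y Z" by simp_all
    show ?case
      using linear_mapsD(1)[OF f] linear_mapsD(1)[OF f'] linear_mapsD(3)[OF g]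
      by (auto simp: Vect_def compose_def fun_eq_iff)
  next
    case (5 X Y Z c f g)
    then have f: "f \<in> linear_maps K X Y" by simp
    show ?case
      using linear_mapsD(1)[OF f] by (auto simp: Vect_def compose_def fun_eq_iff)
  next
    case (6 X Y Z c f g)
    then have f: "f \<in> linear_maps K X Y" and g: "g \<in> linear_maps K Y Z" by simp_all
    show ?case
      using linear_mapsD(1)[OF f] linear_mapsD(4)[OF g \<open>c \<in> carrier K\<close>]
      by (auto simp: Vect_def compose_def fun_eq_iff)
  qed
qed

lemma (in ring) cornerI: "a \<in> carrier R \<Longrightarrow> f \<otimes> a \<otimes> e \<in> corner R e f"
  by (auto simp: corner_def)

lemma (in ring) mem_corner_iff:
  assumes "idempotent_elem R e" "idempotent_elem R f"
  shows "x \<in> corner R e f \<longleftrightarrow> x \<in> carrier R \<and> f \<otimes> x = x \<and> x \<otimes> e = x"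
proof -
  have e: "e \<in> carrier R" "e \<otimes> e = e" and f: "f \<in> carrier R" "f \<otimes> f = f"
    using assms by (auto simp: idempotent_elem_def)
  show ?thesis
  proof
    assume "x \<in> corner R e f"
    then obtain a where a: "a \<in> carrier R" "x = f \<otimes> a \<otimes> e" by (auto simp: corner_def)
    have "f \<otimes> x = x"
      using a e f by (metis m_assoc m_closed)
    moreover have "x \<otimes> e = x" using a e f by (simp add: m_assoc)
    ultimately show "x \<in> carrier R \<and> f \<otimes> x = x \<and> x \<otimes> e = x" using a e f by simp
  next
    assume "x \<in> carrier R \<and> f \<otimes> x = x \<and> x \<otimes> e = x"
    then show "x \<in> corner R e f" by (metis cornerI)
  qed
qed

theorem linear_category_idempotent_category:
  fixes K :: "('k, 'x) ring_scheme" and A :: "('k, 'a) module"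
  assumes "assoc_algebra K A" and E: "\<forall>e\<in>E. idempotent_elem A e"
  shows "linear_category K (idempotent_category A E)"
proof -
  interpret assoc_algebra K A by fact
  have K: "field K" by (rule assoc_algebra.axioms(1)) fact
  let ?C = "idempotent_category A E"
  have [simp]: "Obj ?C = E" "Mor ?C = corner A" "Ide ?C = (\<lambda>e. e)"
    "Cmp ?C = (\<lambda>e f g y x. y \<otimes>\<^bsub>A\<^esub> x)" "MorSpace ?C = (\<lambda>e f. A\<lparr>carrier := corner A e f\<rparr>)"
    by (simp_all add: idempotent_category_def)
  note mem = A.mem_corner_iff[OF E[rule_format] E[rule_format]]
  have Ec: "e \<in> carrier A" "e \<otimes>\<^bsub>A\<^esub> e = e" if "e \<in> E" for e
    using E that by (auto simp: idempotent_elem_def)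
  have grp: "abelian_group (A\<lparr>carrier := corner A e f\<rparr>)" if ef: "e \<in> E" "f \<in> E" for e f
  proof (rule abelian_groupI)
    fix x assume x: "x \<in> carrier (A\<lparr>carrier := corner A e f\<rparr>)"
    show "\<exists>y\<in>carrier (A\<lparr>carrier := corner A e f\<rparr>). y \<oplus>\<^bsub>A\<lparr>carrier := corner A e f\<rparr>\<^esub> x = \<zero>\<^bsub>A\<lparr>carrier := corner A e f\<rparr>\<^esub>"
      using x ef by (intro bexI[of _ "\<ominus>\<^bsub>A\<^esub> x"]) (auto simp: mem Ec A.l_neg A.r_minus A.l_minus)
  qed (use ef in \<open>auto simp: mem Ec A.a_ac A.r_distr A.l_distr\<close>)
  have module: "module K (A\<lparr>carrier := corner A e f\<rparr>)" if ef: "e \<in> E" "f \<in> E" for e f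
    by (rule moduleI[OF K.is_cring grp])
      (use ef in \<open>auto simp: mem Ec smult_mult_left smult_mult_right
         smult_l_distr smult_r_distr smult_assoc1\<close>)
  have cat: "category ?C"
    by (rule category.intro) (auto simp: mem Ec A.m_assoc, metis A.m_assoc Ec(1))
  show ?thesis
    by (rule linear_category.intro[OF K cat linear_category_axioms.intro])
      (auto simp: mem module A.l_distr A.r_distr smult_mult_left smult_mult_right)
qed

theorem category_linear_functor_category:
  fixes C :: "('k, 'o, 'h, 'y) linear_category_scheme"
    and D :: "('k, 'p, 'i, 'z) linear_category_scheme"
  assumes "category C" "category D"
  shows "category (linear_functor_category K C D)"
proof -
  interpret C: category C by fact
  interpret D: category D by fact
  let ?F = "linear_functor_category K C D"
  have ob: "cat_functor C D F" if "F \<in> Obj ?F" for F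
    using that by (auto simp: linear_functor_category_def linear_functor_def)
  note Fo = cat_functor.Fob_closed[OF ob]
  note Fm = cat_functor.Fmor_closed[OF ob]
  have [simp]: "Mor ?F = natural_transformations C D"
    "Ide ?F = (\<lambda>F. \<lambda>X\<in>Obj C. Ide D (Fob F X))"
    "Cmp ?F = (\<lambda>F G H \<theta> \<eta>. \<lambda>X\<in>Obj C. Cmp D (Fob F X) (Fob G X) (Fob H X) (\<theta> X) (\<eta> X))"
    by (simp_all add: linear_functor_category_def)
  have nt: "\<eta> X \<in> Mor D (Fob F X) (Fob G X)"
    if "\<eta> \<in> natural_transformations C D F G" "X \<in> Obj C" for \<eta> F G X
    using that by (auto simp: natural_transformations_def)
  have ex: "\<eta> X = undefined"
    if "\<eta> \<in> natural_transformations C D F G" "X \<notin> Obj C" for \<eta> F G X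
    using that by (auto simp: natural_transformations_def)
  show ?thesis
  proof (unfold_locales, goal_cases)
    case (1 F)
    then show ?case
      using Fo Fm by (auto simp: natural_transformations_def D.ide_closed D.cmp_ide_left D.cmp_ide_right)
  next
    case (2 F G H \<eta> \<theta>)
    have cl: "Cmp D (Fob F X) (Fob G X) (Fob H X) (\<theta> X) (\<eta> X) \<in> Mor D (Fob F X) (Fob H X)"
      if "X \<in> Obj C" for X
      using 2 that by (intro D.cmp_closed Fo) (auto intro: nt)
    have "Cmp D (Fob F X) (Fob F Y) (Fob H Y)
            (Cmp D (Fob F Y) (Fob G Y) (Fob H Y) (\<theta> Y) (\<eta> Y)) (Fmor F X Y f)
        = Cmp D (Fob F X) (Fob H X) (Fob H Y) (Fmor H X Y f)
            (Cmp D (Fob F X) (Fob G X) (Fob H X) (\<theta> X) (\<eta> X))"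
      (is "?l = ?r") if X: "X \<in> Obj C" and Y: "Y \<in> Obj C" and f: "f \<in> Mor C X Y" for X Y f
    proof -
      note o = Fo[OF 2(1) X] Fo[OF 2(2) X] Fo[OF 2(3) X] Fo[OF 2(1) Y] Fo[OF 2(2) Y] Fo[OF 2(3) Y]
      note m = Fm[OF 2(1) X Y f] Fm[OF 2(2) X Y f] Fm[OF 2(3) X Y f]
      have n: "\<eta> X \<in> Mor D (Fob F X) (Fob G X)" "\<eta> Y \<in> Mor D (Fob F Y) (Fob G Y)"
        "\<theta> X \<in> Mor D (Fob G X) (Fob H X)" "\<theta> Y \<in> Mor D (Fob G Y) (Fob H Y)"
        using 2 X Y by (auto intro: nt)
      have e: "Cmp D (Fob F X) (Fob F Y) (Fob G Y) (\<eta> Y) (Fmor F X Y f)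
         = Cmp D (Fob F X) (Fob G X) (Fob G Y) (Fmor G X Y f) (\<eta> X)"
        "Cmp D (Fob G X) (Fob G Y) (Fob H Y) (\<theta> Y) (Fmor G X Y f)
         = Cmp D (Fob G X) (Fob H X) (Fob H Y) (Fmor H X Y f) (\<theta> X)"
        using 2 X Y f by (auto simp: natural_transformations_def)
      have "?l = Cmp D (Fob F X) (Fob G Y) (Fob H Y) (\<theta> Y)
          (Cmp D (Fob F X) (Fob F Y) (Fob G Y) (\<eta> Y) (Fmor F X Y f))"
        by (rule D.cmp_assoc; fact)
      also have "\<dots> = Cmp D (Fob F X) (Fob G X) (Fob H Y)
          (Cmp D (Fob G X) (Fob G Y) (Fob H Y) (\<theta> Y) (Fmor G X Y f)) (\<eta> X)"
        unfolding e(1) by (rule D.cmp_assoc[symmetric]; fact)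
      also have "\<dots> = ?r"
        unfolding e(2) by (rule D.cmp_assoc; fact)
      finally show ?thesis .
    qed
    with cl show ?case by (simp add: natural_transformations_def)
  next
    case (3 F G \<eta>)
    then show ?case
      using Fo nt[of \<eta> F G] ex[of \<eta> F G] by (auto simp: fun_eq_iff intro!: D.cmp_ide_right)
  next
    case (4 F G \<eta>)
    then show ?case
      using Fo nt[of \<eta> F G] ex[of \<eta> F G] by (auto simp: fun_eq_iff intro!: D.cmp_ide_left)
  next
    case (5 F G H I \<eta> \<theta> \<iota>)
    then show ?case
      using Fo by (auto simp: fun_eq_iff intro!: D.cmp_assoc nt)
  qed
qed

text \<open>
  The zero algebra satisfies \<open>1 = \<Sum>e\<in>E. e\<close> only for \<open>E = {}\<close>, since a primitive idempotent is nonzero.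
  There is then exactly one functor on the empty category, but there are many zero modules, so the
  two categories are equivalent without being isomorphic. An isomorphism can be expected for
  nonzero algebras only.
\<close>

lemma not_isomorphic_no_idempotents:
  fixes K :: "('k, 'x) ring_scheme" and A :: "('k, 'a) module" and z z' :: 'm
  assumes A: "ring A" and z: "z \<noteq> z'"
  shows "\<not> isomorphic_categories
    (linear_functor_category K (idempotent_category A {})
      (Vect K :: ('k, ('k, 'm) module, 'm \<Rightarrow> 'm) linear_category))
    (LMod A :: (('a, 'm) module, 'm \<Rightarrow> 'm) category)"
    (is "\<not> isomorphic_categories ?C ?D")
proof
  assume "isomorphic_categories ?C ?D"
  then obtain F :: "(('a, 'a, ('k, 'm) module, 'm \<Rightarrow> 'm) cat_functor, 'a \<Rightarrow> 'm \<Rightarrow> 'm,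
        ('a, 'm) module, 'm \<Rightarrow> 'm) cat_functor" and G where G: "cat_functor ?D ?C G" and FG: "\<And>M. M \<in> Obj ?D \<Longrightarrow> Fob F (Fob G M) = M"
    unfolding isomorphic_categories_def by blast
  have uniq: "P = Q" if "P \<in> Obj ?C" "Q \<in> Obj ?C" for P Q
    using that by (cases P; cases Q)
      (auto simp: linear_functor_category_def idempotent_category_def functor_extensional_def fun_eq_iff)
  define Z :: "'m \<Rightarrow> ('a, 'm) module" where "Z w =
    \<lparr>carrier = {w}, mult = undefined, one = undefined, zero = w,
     add = (\<lambda>x y. if x = w \<and> y = w then w else undefined),
     smult = (\<lambda>r x. if r \<in> carrier A \<and> x = w then w else undefined)\<rparr>" for w
  have Z: "Z w \<in> Obj ?D" for w
  proof -
    have "abelian_group (Z w)" by (rule abelian_groupI) (auto simp: Z_def)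
    then have "left_module A (Z w)"
      by (intro left_module.intro left_module_axioms.intro A)
        (auto simp: Z_def ring.ring_simprules[OF A])
    then show ?thesis by (auto simp: LMod_def module_extensional_def Z_def)
  qed
  have "Fob G (Z z) = Fob G (Z z')"
    by (intro uniq cat_functor.Fob_closed[OF G] Z)
  then have "Z z = Z z'" using FG Z by metis
  with z show False by (simp add: Z_def)
qed

end

theory Submission
  imports Defs
begin

text \<open>
  Sending a module \<open>M\<close> to the functor \<open>e \<mapsto> eM\<close>, on which \<open>a \<in> fAe\<close> acts as the map
  \<open>eM \<rightarrow> fM\<close>, \<open>x \<mapsto> ax\<close>, is the classical equivalence of the two categories: since
  \<open>x = \<Sum>e\<in>E. ex\<close>, a module is recovered from its Peirce components, and linear maps correspond to
  natural families of maps between components. The quasi-inverse sends \<open>F\<close> to the product of the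
  spaces \<open>F e\<close>, on which \<open>a\<close> acts by the matrix with entries \<open>F (f a e)\<close>.

  An equivalence is an isomorphism of categories once objects can be matched bijectively within each
  isomorphism class. This is where the universe enters: a functor consists of a tuple of subsets
  of the type \<open>'m\<close>, a module of a single subset, and there is no canonical bijection between the
  two kinds of data. Instead of counting the members of each isomorphism class, the proof gives
  an injection in each direction that stays in the isomorphism class, and combines
  them by the Schroeder-Bernstein construction, whose bijection agrees at each point with one of the
  two injections or its inverse and so stays in the class as well
  (\<open>isomorphic_categories_Schroeder_Bernstein\<close>).

  From functors to modules: transport the module structure of the product of the \<open>F e\<close> along an
  injective coding of \<open>E\<close>-tuples by elements of \<open>'m\<close>. The spaces \<open>F e\<close> are nonempty and
  the coding is injective, so \<open>F\<close> can be read off from the result.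

  From modules to functors: the functor \<open>e \<mapsto> eM\<close> determines \<open>M\<close> up to the bijection
  \<open>(x\<^sub>e)\<^sub>e \<mapsto> \<Sum>e\<in>E. x\<^sub>e\<close> from the product of the \<open>eM\<close> onto the set \<open>M\<close>. To make this assignment
  injective, each \<open>x \<in> eM\<close> is renamed to a code of \<open>x\<close> together with a finite list of values of that
  bijection. The arguments of these values are prescribed by the functor alone, and every element of
  the product is among them for some \<open>e\<close> and \<open>x\<close> (\<open>ex_lists_cover_PiE\<close>). Finite lists make the same
  argument work for finite and for infinite modules. The cover needs \<open>E \<noteq> {}\<close>, that is \<open>1 \<noteq> 0\<close>
  in \<open>A\<close>, and the codes need \<open>'m\<close> to be infinite.
\<close>

section \<open>Isomorphisms of categories from injections that preserve isomorphism classes\<close>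

definition isomorphic_objects :: "('o, 'h, 'z) category_scheme \<Rightarrow> 'o \<Rightarrow> 'o \<Rightarrow> bool" where
  "isomorphic_objects C X Y \<longleftrightarrow> (\<exists>u\<in>Mor C X Y. \<exists>v\<in>Mor C Y X.
     Cmp C X Y X v u = Ide C X \<and> Cmp C Y X Y u v = Ide C Y)"

lemma isomorphic_objects_sym: "isomorphic_objects C X Y \<Longrightarrow> isomorphic_objects C Y X"
  unfolding isomorphic_objects_def by blast

lemma isomorphic_categories_if_bij_functor:
  assumes H: "cat_functor D C H"
    and ob: "bij_betw (Fob H) (Obj D) (Obj C)"
    and mor: "\<And>X Y. \<lbrakk>X \<in> Obj D; Y \<in> Obj D\<rbrakk>
      \<Longrightarrow> bij_betw (Fmor H X Y) (Mor D X Y) (Mor C (Fob H X) (Fob H Y))"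
  shows "isomorphic_categories C D"
proof -
  interpret H: cat_functor D C H by fact
  define k where "k = inv_into (Obj D) (Fob H)"
  have k: "k X \<in> Obj D" "Fob H (k X) = X" if "X \<in> Obj C" for X
    using that ob by (auto simp: k_def bij_betw_def inv_into_into f_inv_into_f)
  have kH: "k (Fob H X) = X" if "X \<in> Obj D" for X
    using that ob by (auto simp: k_def bij_betw_def inv_into_f_f)
  define m where "m X Y = inv_into (Mor D (k X) (k Y)) (Fmor H (k X) (k Y))" for X Y
  have m: "m X Y f \<in> Mor D (k X) (k Y)" "Fmor H (k X) (k Y) (m X Y f) = f"
    if "X \<in> Obj C" "Y \<in> Obj C" "f \<in> Mor C X Y" for X Y f
    using that mor[of "k X" "k Y"]
    by (auto simp: m_def bij_betw_def inv_into_into f_inv_into_f k)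
  have mH: "m X Y (Fmor H (k X) (k Y) g) = g"
    if "X \<in> Obj C" "Y \<in> Obj C" "g \<in> Mor D (k X) (k Y)" for X Y g
    using that mor[of "k X" "k Y"] by (auto simp: m_def bij_betw_def inv_into_f_f k)
  define J where "J = \<lparr>Fob = k, Fmor = m\<rparr>"
  have [simp]: "Fob J = k" "Fmor J = m" by (simp_all add: J_def)
  have "cat_functor C D J"
  proof (unfold_locales, goal_cases)
    case (3 X)
    have "m X X (Fmor H (k X) (k X) (Ide D (k X))) = Ide D (k X)"
      using 3 k by (intro mH H.C.ide_closed) auto
    then show ?case using 3 k by (simp add: H.Fmor_ide)
  next
    case (4 X Y Z f g)
    let ?c = "Cmp D (k X) (k Y) (k Z) (m Y Z g) (m X Y f)"
    have "m X Z (Fmor H (k X) (k Z) ?c) = ?c"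
      using 4 by (intro mH H.C.cmp_closed) (auto simp: k m)
    then show ?case using 4 by (simp add: H.Fmor_cmp k m)
  qed (simp_all add: k m)
  moreover have "m (Fob H X) (Fob H Y) (Fmor H X Y f) = f"
    if "X \<in> Obj D" "Y \<in> Obj D" "f \<in> Mor D X Y" for X Y f
    using mH[of "Fob H X" "Fob H Y" f] that by (simp add: kH H.Fob_closed)
  ultimately show ?thesis
    unfolding isomorphic_categories_def using H k kH m
    by (intro exI[of _ J] exI[of _ H]) simp
qed

text \<open>
  The values of \<open>G\<close> on objects are replaced by the isomorphic objects \<open>k X\<close>: conjugation with the
  chosen isomorphisms turns \<open>G\<close> into a functor that is still bijective on morphisms and now also
  bijective on objects.
\<close>

lemma isomorphic_categories_if_fully_faithful:
  assumes "cat_functor D C G"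
    and ff: "\<And>X Y. \<lbrakk>X \<in> Obj D; Y \<in> Obj D\<rbrakk>
      \<Longrightarrow> bij_betw (Fmor G X Y) (Mor D X Y) (Mor C (Fob G X) (Fob G Y))"
    and k: "bij_betw k (Obj D) (Obj C)"
    and iso: "\<And>X. X \<in> Obj D \<Longrightarrow> isomorphic_objects C (k X) (Fob G X)"
  shows "isomorphic_categories C D"
proof -
  interpret G: cat_functor D C G by fact
  have kc [simp]: "k X \<in> Obj C" if "X \<in> Obj D" for X
    using k that by (auto simp: bij_betw_def)
  note [simp] = G.Fob_closed
  obtain u v where u: "\<And>X. X \<in> Obj D \<Longrightarrow> u X \<in> Mor C (k X) (Fob G X)"
    and v: "\<And>X. X \<in> Obj D \<Longrightarrow> v X \<in> Mor C (Fob G X) (k X)"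
    and vu: "\<And>X. X \<in> Obj D \<Longrightarrow> Cmp C (k X) (Fob G X) (k X) (v X) (u X) = Ide C (k X)"
    and uv: "\<And>X. X \<in> Obj D \<Longrightarrow> Cmp C (Fob G X) (k X) (Fob G X) (u X) (v X) = Ide C (Fob G X)"
    using iso unfolding isomorphic_objects_def by metis
  (* conj and unconj are mutually inverse by the identities vu and uv. *)
  define conj where "conj X Y g =
    Cmp C (k X) (Fob G Y) (k Y) (v Y) (Cmp C (k X) (Fob G X) (Fob G Y) g (u X))" for X Y g
  define unconj where "unconj X Y f =
    Cmp C (Fob G X) (k X) (Fob G Y) (Cmp C (k X) (k Y) (Fob G Y) (u Y) f) (v X)" for X Y f
  have conj_closed: "conj X Y g \<in> Mor C (k X) (k Y)"
    if "X \<in> Obj D" "Y \<in> Obj D" "g \<in> Mor C (Fob G X) (Fob G Y)" for X Y g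
    using that by (auto simp: conj_def intro!: G.D.cmp_closed u v)
  have unconj_closed: "unconj X Y f \<in> Mor C (Fob G X) (Fob G Y)"
    if "X \<in> Obj D" "Y \<in> Obj D" "f \<in> Mor C (k X) (k Y)" for X Y f
    using that by (auto simp: unconj_def intro!: G.D.cmp_closed u v)
  have unconj_conj: "unconj X Y (conj X Y g) = g"
    if [simp]: "X \<in> Obj D" "Y \<in> Obj D" and g: "g \<in> Mor C (Fob G X) (Fob G Y)" for X Y g
  proof -
    let ?gu = "Cmp C (k X) (Fob G X) (Fob G Y) g (u X)"
    have gu: "?gu \<in> Mor C (k X) (Fob G Y)" using g by (auto intro!: G.D.cmp_closed u)
    have "Cmp C (k X) (k Y) (Fob G Y) (u Y) (conj X Y g) = ?gu"
      using G.D.cmp_assoc[of "k X" "Fob G Y" "k Y" "Fob G Y" ?gu "v Y" "u Y"] gu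
      by (simp add: conj_def u v uv G.D.cmp_ide_left)
    then show ?thesis
      using G.D.cmp_assoc[of "Fob G X" "k X" "Fob G X" "Fob G Y" "v X" "u X" g] g
      by (simp add: unconj_def u v uv G.D.cmp_ide_right)
  qed
  have conj_unconj: "conj X Y (unconj X Y f) = f"
    if [simp]: "X \<in> Obj D" "Y \<in> Obj D" and f: "f \<in> Mor C (k X) (k Y)" for X Y f
  proof -
    let ?uf = "Cmp C (k X) (k Y) (Fob G Y) (u Y) f"
    have uf: "?uf \<in> Mor C (k X) (Fob G Y)" using f by (auto intro!: G.D.cmp_closed u)
    have "Cmp C (k X) (Fob G X) (Fob G Y) (unconj X Y f) (u X) = ?uf"
      using G.D.cmp_assoc[of "k X" "Fob G X" "k X" "Fob G Y" "u X" "v X" ?uf] uf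
      by (simp add: unconj_def u v vu G.D.cmp_ide_right)
    then show ?thesis
      using G.D.cmp_assoc[of "k X" "k Y" "Fob G Y" "k Y" f "u Y" "v Y"] f
      by (simp add: conj_def u v vu G.D.cmp_ide_left)
  qed
  define H where "H = \<lparr>Fob = k, Fmor = (\<lambda>X Y f. conj X Y (Fmor G X Y f))\<rparr>"
  have [simp]: "Fob H = k" "Fmor H = (\<lambda>X Y f. conj X Y (Fmor G X Y f))" by (simp_all add: H_def)
  have "cat_functor D C H"
  proof (unfold_locales, goal_cases)
    case (1 X)
    then show ?case by simp
  next
    case (2 X Y f)
    then show ?case by (simp add: conj_closed G.Fmor_closed)
  next
    case (3 X)
    then show ?case by (simp add: G.Fmor_ide conj_def G.D.cmp_ide_left u vu)
  next
    case (4 X Y Z f g)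
    let ?f = "Fmor G X Y f" and ?g = "Fmor G Y Z g"
    have f: "?f \<in> Mor C (Fob G X) (Fob G Y)" and g: "?g \<in> Mor C (Fob G Y) (Fob G Z)"
      using 4 by (simp_all add: G.Fmor_closed)
    have [simp]: "X \<in> Obj D" "Y \<in> Obj D" "Z \<in> Obj D" using 4 by auto
    let ?fu = "Cmp C (k X) (Fob G X) (Fob G Y) ?f (u X)"
    let ?gu = "Cmp C (k Y) (Fob G Y) (Fob G Z) ?g (u Y)"
    have fu: "?fu \<in> Mor C (k X) (Fob G Y)" and gu: "?gu \<in> Mor C (k Y) (Fob G Z)"
      using f g by (auto intro!: G.D.cmp_closed u)
    have cf: "conj X Y ?f \<in> Mor C (k X) (k Y)" using f by (simp add: conj_closed)
    have "Cmp C (k X) (k Y) (Fob G Y) (u Y) (conj X Y ?f) = ?fu"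
      using G.D.cmp_assoc[of "k X" "Fob G Y" "k Y" "Fob G Y" ?fu "v Y" "u Y"] fu
      by (simp add: conj_def u v uv G.D.cmp_ide_left)
    then have "Cmp C (k X) (k Y) (Fob G Z) ?gu (conj X Y ?f)
        = Cmp C (k X) (Fob G Y) (Fob G Z) ?g ?fu"
      using G.D.cmp_assoc[of "k X" "k Y" "Fob G Y" "Fob G Z" "conj X Y ?f" "u Y" ?g] cf g
      by (simp add: u)
    also have "\<dots> = Cmp C (k X) (Fob G X) (Fob G Z) (Cmp C (Fob G X) (Fob G Y) (Fob G Z) ?g ?f) (u X)"
      using G.D.cmp_assoc[of "k X" "Fob G X" "Fob G Y" "Fob G Z" "u X" ?f ?g] f g by (simp add: u)
    finally have "Cmp C (k X) (k Y) (k Z) (conj Y Z ?g) (conj X Y ?f)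
        = conj X Z (Cmp C (Fob G X) (Fob G Y) (Fob G Z) ?g ?f)"
      using G.D.cmp_assoc[of "k X" "k Y" "Fob G Z" "k Z" "conj X Y ?f" ?gu "v Z"] gu cf
      by (simp add: conj_def v)
    then show ?case using 4 by (simp add: G.Fmor_cmp)
  qed
  moreover have "bij_betw (Fmor H X Y) (Mor D X Y) (Mor C (Fob H X) (Fob H Y))"
    if X: "X \<in> Obj D" and Y: "Y \<in> Obj D" for X Y
  proof -
    have "bij_betw (conj X Y) (Mor C (Fob G X) (Fob G Y)) (Mor C (k X) (k Y))"
      using conj_closed[OF X Y] unconj_closed[OF X Y] unconj_conj[OF X Y] conj_unconj[OF X Y]
      by (intro bij_betw_byWitness[where f' = "unconj X Y"]) auto
    then show ?thesis using bij_betw_trans[OF ff[OF X Y]] by (simp add: comp_def)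
  qed
  ultimately show ?thesis using k by (intro isomorphic_categories_if_bij_functor) auto
qed

text \<open>
  The usual Schroeder-Bernstein theorem forgets how the bijection is built. What matters here is that
  every pair of its graph comes from \<open>f\<close> or from \<open>g\<close>.
\<close>

lemma Schroeder_Bernstein_graph:
  assumes f: "inj_on f A" "f ` A \<subseteq> B" and g: "inj_on g B" "g ` B \<subseteq> A"
  obtains h where "bij_betw h B A"
    and "\<And>y. y \<in> B \<Longrightarrow> h y = g y \<or> y = f (h y)"
proof -
  \<comment> \<open>\<open>X\<close> is a fixed point with \<open>A - X = g ` (B - f ` X)\<close>, so \<open>g\<close> and the inverse of \<open>f\<close> fit together.\<close>
  define X where "X = lfp (\<lambda>X. A - g ` (B - f ` X))"
  have X: "X = A - g ` (B - f ` X)"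
    unfolding X_def by (rule lfp_unfold) (blast intro: monoI)
  define h where "h y = (if y \<in> f ` X then inv_into A f y else g y)" for y
  have XA: "X \<subseteq> A" using X by blast
  have hf: "h (f x) = x" if "x \<in> X" for x
    using that XA f(1) by (auto simp: h_def inv_into_f_f)
  have "bij_betw h (f ` X) X"
    using hf by (intro bij_betw_byWitness[where f' = f]) auto
  moreover have "bij_betw h (B - f ` X) (A - X)"
  proof -
    have "bij_betw g (B - f ` X) (g ` (B - f ` X))"
      using g(1) by (intro inj_on_imp_bij_betw) (rule inj_on_subset, auto)
    moreover have "g ` (B - f ` X) = A - X" using X g(2) by blast
    ultimately have "bij_betw g (B - f ` X) (A - X)" by simp
    then show ?thesis by (rule bij_betw_cong[THEN iffD1, rotated]) (auto simp: h_def)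
  qed
  ultimately have "bij_betw h (f ` X \<union> (B - f ` X)) (X \<union> (A - X))"
    by (rule bij_betw_combine) auto
  moreover have "f ` X \<union> (B - f ` X) = B" "X \<union> (A - X) = A" using XA f(2) by auto
  ultimately have "bij_betw h B A" by simp
  moreover have "h y = g y \<or> y = f (h y)" for y
    using hf by (cases "y \<in> f ` X") (auto simp: h_def)
  ultimately show ?thesis using that by blast
qed

text \<open>
  An object \<open>Y\<close> is matched with \<open>\<Psi> Y\<close> or with some \<open>X\<close> such that \<open>Y = \<Phi> X\<close>; in both cases
  the partner is isomorphic to \<open>Fob G Y\<close>.
\<close>

theorem isomorphic_categories_Schroeder_Bernstein:
  assumes G: "cat_functor D C G"
    and ff: "\<And>X Y. \<lbrakk>X \<in> Obj D; Y \<in> Obj D\<rbrakk>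
      \<Longrightarrow> bij_betw (Fmor G X Y) (Mor D X Y) (Mor C (Fob G X) (Fob G Y))"
    and \<Phi>: "inj_on \<Phi> (Obj C)" "\<And>X. X \<in> Obj C \<Longrightarrow> \<Phi> X \<in> Obj D"
      "\<And>X. X \<in> Obj C \<Longrightarrow> isomorphic_objects C X (Fob G (\<Phi> X))"
    and \<Psi>: "inj_on \<Psi> (Obj D)" "\<And>Y. Y \<in> Obj D \<Longrightarrow> \<Psi> Y \<in> Obj C"
      "\<And>Y. Y \<in> Obj D \<Longrightarrow> isomorphic_objects C (\<Psi> Y) (Fob G Y)"
  shows "isomorphic_categories C D"
proof -
  obtain h where h: "bij_betw h (Obj D) (Obj C)"
    "\<And>Y. Y \<in> Obj D \<Longrightarrow> h Y = \<Psi> Y \<or> Y = \<Phi> (h Y)"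
    using Schroeder_Bernstein_graph[of \<Phi> "Obj C" "Obj D" \<Psi>] \<Phi> \<Psi> by blast
  have "isomorphic_objects C (h Y) (Fob G Y)" if Y: "Y \<in> Obj D" for Y
    using h(2)[OF Y] \<Psi>(3)[OF Y] \<Phi>(3)[OF bij_betwE[OF h(1), rule_format, OF Y]] by auto
  then show ?thesis using isomorphic_categories_if_fully_faithful[OF G ff h(1)] by blast
qed

section \<open>Coding finite lists in an infinite set\<close>

lemma ex_inj_lists:
  assumes S: "infinite S"
  obtains c where "c \<in> lists S \<rightarrow> S" "inj_on c (lists S)"
proof -
  obtain p where p: "bij_betw p (S \<times> S) S"
    using card_of_Times_same_infinite[OF S] card_of_ordIso by blast
  obtain \<iota> :: "nat \<Rightarrow> 'a" where \<iota>: "inj \<iota>" "range \<iota> \<subseteq> S"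
    using infinite_countable_subset[OF S] by blast
  \<comment> \<open>Iterated pairing is injective on the lists of a fixed length, so the length is recorded as well.\<close>
  define code where "code xs = foldr (\<lambda>x y. p (x, y)) xs (\<iota> 0)" for xs
  have pS: "p (x, y) \<in> S" if "x \<in> S" "y \<in> S" for x y
    using p that by (auto simp: bij_betw_def)
  have pI: "p (x, y) = p (x', y') \<Longrightarrow> x = x' \<and> y = y'"
    if "x \<in> S" "y \<in> S" "x' \<in> S" "y' \<in> S" for x y x' y'
    using p that by (auto simp: bij_betw_def dest!: inj_onD)
  have code_closed: "code xs \<in> S" if "xs \<in> lists S" for xs
    using that \<iota> by (induction xs) (auto simp: code_def intro!: pS)
  have code_inj: "xs = ys"
    if "length xs = length ys" "xs \<in> lists S" "ys \<in> lists S" "code xs = code ys" for xs ys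
    using that
  proof (induction rule: list_induct2)
    case (Cons x xs y ys)
    then have "p (x, code xs) = p (y, code ys)" by (simp add: code_def)
    with Cons code_closed pI[of x "code xs" y "code ys"] show ?case by simp
  qed simp
  show ?thesis
  proof
    show "(\<lambda>xs. p (\<iota> (length xs), code xs)) \<in> lists S \<rightarrow> S"
      using \<iota> code_closed by (auto intro!: pS)
    show "inj_on (\<lambda>xs. p (\<iota> (length xs), code xs)) (lists S)"
    proof (rule inj_onI)
      fix xs ys
      assume "xs \<in> lists S" "ys \<in> lists S"
        "p (\<iota> (length xs), code xs) = p (\<iota> (length ys), code ys)"
      then have "\<iota> (length xs) = \<iota> (length ys)" "code xs = code ys"
        using \<iota>(2) code_closed pI[of "\<iota> (length xs)" "code xs" "\<iota> (length ys)" "code ys"] by auto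
      then show "xs = ys"
        using \<iota>(1) \<open>xs \<in> _\<close> \<open>ys \<in> _\<close> by (intro code_inj) (auto dest: injD)
    qed
  qed
qed

text \<open>
  A product over a finite index set has no more elements than there are finite lists over the disjoint
  union of its factors, hence no more than the union itself if that is infinite, and then lists of length
  at most one suffice. If the product is finite, one list can enumerate all of it.
\<close>

lemma ex_lists_cover_PiE:
  fixes D :: "'a \<Rightarrow> 'b set"
  assumes E: "finite E" "E \<noteq> {}" and D: "\<And>e. e \<in> E \<Longrightarrow> D e \<noteq> {}"
  shows "\<exists>\<beta>. (\<Union>e\<in>E. \<Union>x\<in>D e. set (\<beta> e x)) = Pi\<^sub>E E D"
proof (cases "finite (Pi\<^sub>E E D)")
  case True
  from finite_list[OF this] obtain ps where ps: "set ps = Pi\<^sub>E E D" ..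
  have "(\<Union>e\<in>E. \<Union>x\<in>D e. set ps) = set ps" using E(2) D by fastforce
  then show ?thesis unfolding ps by (intro exI[of _ "\<lambda>e x. ps"]) (simp add: ps)
next
  case False
  have "infinite (Sigma E D)"
  proof
    assume "finite (Sigma E D)"
    moreover have "D e \<subseteq> snd ` Sigma E D" if "e \<in> E" for e using that by force
    ultimately have "finite (D e)" if "e \<in> E" for e
      using that by (meson finite_imageI finite_subset)
    then show False using False E(1) finite_PiE[of E D] by blast
  qed
  then obtain c where c: "c \<in> lists (Sigma E D) \<rightarrow> Sigma E D" "inj_on c (lists (Sigma E D))"
    by (rule ex_inj_lists)
  obtain es where es: "set es = E" using E(1) finite_list by blast
  define j where "j p = c (map (\<lambda>e. (e, p e)) es)" for p
  have l: "map (\<lambda>e. (e, p e)) es \<in> lists (Sigma E D)" if "p \<in> Pi\<^sub>E E D" for p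
    using that es by auto
  have jS: "j p \<in> Sigma E D" if "p \<in> Pi\<^sub>E E D" for p
    using c(1) l[OF that] by (auto simp: j_def)
  have jI: "inj_on j (Pi\<^sub>E E D)"
  proof (rule inj_onI)
    fix p q assume p: "p \<in> Pi\<^sub>E E D" and q: "q \<in> Pi\<^sub>E E D" and "j p = j q"
    then have "map (\<lambda>e. (e, p e)) es = map (\<lambda>e. (e, q e)) es"
      using inj_onD[OF c(2) _ l l] by (simp add: j_def)
    then have "\<forall>e\<in>E. p e = q e" using es by auto
    with p q show "p = q" by (auto intro: PiE_ext)
  qed
  define \<beta> where "\<beta> e x = (if (e, x) \<in> j ` Pi\<^sub>E E D then [inv_into (Pi\<^sub>E E D) j (e, x)] else [])" for e x
  have "set (\<beta> e x) \<subseteq> Pi\<^sub>E E D" for e x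
    by (cases "(e, x) \<in> j ` Pi\<^sub>E E D") (simp_all add: \<beta>_def inv_into_into)
  then have "(\<Union>e\<in>E. \<Union>x\<in>D e. set (\<beta> e x)) \<subseteq> Pi\<^sub>E E D" by blast
  moreover have "p \<in> (\<Union>e\<in>E. \<Union>x\<in>D e. set (\<beta> e x))" if "p \<in> Pi\<^sub>E E D" for p
  proof -
    obtain e x where ex: "j p = (e, x)" "e \<in> E" "x \<in> D e" using jS[OF \<open>p \<in> _\<close>] by auto
    have "(e, x) \<in> j ` Pi\<^sub>E E D" "inv_into (Pi\<^sub>E E D) j (e, x) = p"
      using that ex(1)[symmetric] jI by (auto simp: inv_into_f_f)
    then have "p \<in> set (\<beta> e x)" by (simp add: \<beta>_def)
    with ex show ?thesis by blast
  qed
  ultimately show ?thesis by (intro exI[of _ \<beta>]) blast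
qed

section \<open>Additive maps and modules over a ring\<close>

lemma additive_zero:
  assumes "abelian_group G" "abelian_group H" and f: "f \<in> carrier G \<rightarrow> carrier H"
    and add: "\<And>x y. \<lbrakk>x \<in> carrier G; y \<in> carrier G\<rbrakk> \<Longrightarrow> f (x \<oplus>\<^bsub>G\<^esub> y) = f x \<oplus>\<^bsub>H\<^esub> f y"
  shows "f \<zero>\<^bsub>G\<^esub> = \<zero>\<^bsub>H\<^esub>"
proof -
  interpret G: abelian_group G by fact
  interpret H: abelian_group H by fact
  have "f \<zero>\<^bsub>G\<^esub> \<oplus>\<^bsub>H\<^esub> f \<zero>\<^bsub>G\<^esub> = f \<zero>\<^bsub>G\<^esub>" using add[of "\<zero>\<^bsub>G\<^esub>" "\<zero>\<^bsub>G\<^esub>"] by simp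
  then show ?thesis using f by (simp add: H.add.l_cancel_one Pi_iff)
qed

text \<open>
  This is how finite sums are pulled out of scalar multiplications, natural transformations, the
  inclusion of a subspace and the map \<open>a \<mapsto> F (f a e)\<close> for a linear functor \<open>F\<close>.
\<close>

lemma additive_finsum:
  assumes "abelian_group G" "abelian_group H" and f: "f \<in> carrier G \<rightarrow> carrier H"
    and add: "\<And>x y. \<lbrakk>x \<in> carrier G; y \<in> carrier G\<rbrakk> \<Longrightarrow> f (x \<oplus>\<^bsub>G\<^esub> y) = f x \<oplus>\<^bsub>H\<^esub> f y"
    and g: "g \<in> S \<rightarrow> carrier G"
  shows "f (\<Oplus>\<^bsub>G\<^esub>s\<in>S. g s) = (\<Oplus>\<^bsub>H\<^esub>s\<in>S. f (g s))"
proof -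
  interpret G: abelian_group G by fact
  interpret H: abelian_group H by fact
  note zero = additive_zero[OF assms(1-2) f add]
  show ?thesis using g
  proof (induction S rule: infinite_finite_induct)
    case (insert s S)
    then have "(\<lambda>s. f (g s)) \<in> insert s S \<rightarrow> carrier H" using f by auto
    with insert show ?case by (simp add: add Pi_iff)
  qed (simp_all add: zero)
qed

lemma (in abelian_monoid) finsum_swap:
  assumes "finite S" "finite T" "\<And>s t. \<lbrakk>s \<in> S; t \<in> T\<rbrakk> \<Longrightarrow> f s t \<in> carrier G"
  shows "(\<Oplus>s\<in>S. \<Oplus>t\<in>T. f s t) = (\<Oplus>t\<in>T. \<Oplus>s\<in>S. f s t)"
  using assms(1,3)
proof (induction S)
  case (insert s S)
  have "(\<Oplus>t\<in>T. \<Oplus>s\<in>insert s S. f s t) = (\<Oplus>t\<in>T. f s t \<oplus> (\<Oplus>s\<in>S. f s t))"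
    using insert by (intro finsum_cong') auto
  with insert show ?case using assms(2) by (simp add: finsum_addf Pi_iff)
qed simp

lemma (in abelian_monoid) finsum_only:
  assumes "finite S" "s \<in> S" "f s \<in> carrier G" "\<And>t. \<lbrakk>t \<in> S; t \<noteq> s\<rbrakk> \<Longrightarrow> f t = \<zero>"
  shows "(\<Oplus>t\<in>S. f t) = f s"
proof -
  have f: "f \<in> S \<rightarrow> carrier G" using assms(3,4) by (metis Pi_I zero_closed)
  have "(\<Oplus>t\<in>S. f t) = (\<Oplus>t\<in>S. if s = t then f t else \<zero>)"
    using assms by (intro finsum_cong') auto
  also have "\<dots> = f s"
    using assms(1-3) f finsum_singleton[of s S f] by simp
  finally show ?thesis .
qed

lemma module_iff_left_module:
  assumes "cring R"
  shows "module R M \<longleftrightarrow> left_module R M"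
proof
  assume "module R M"
  then interpret module R M .
  show "left_module R M"
    by (unfold_locales) (auto simp: smult_l_distr smult_r_distr smult_assoc1)
next
  assume "left_module R M"
  then interpret left_module R M .
  interpret R: cring R by fact
  show "module R M"
    by (rule moduleI[OF assms M.abelian_group_axioms])
      (auto simp: smult_closed smult_l_distr smult_r_distr smult_assoc1 smult_one)
qed

lemma (in left_module) smult_l_null: "x \<in> carrier M \<Longrightarrow> \<zero>\<^bsub>R\<^esub> \<odot>\<^bsub>M\<^esub> x = \<zero>\<^bsub>M\<^esub>"
  by (rule additive_zero[of R M "\<lambda>a. a \<odot>\<^bsub>M\<^esub> x"])
    (auto simp: smult_closed smult_l_distr R.abelian_group_axioms M.abelian_group_axioms)

lemma (in left_module) smult_r_null: "a \<in> carrier R \<Longrightarrow> a \<odot>\<^bsub>M\<^esub> \<zero>\<^bsub>M\<^esub> = \<zero>\<^bsub>M\<^esub>"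
  by (rule additive_zero[of M M "\<lambda>x. a \<odot>\<^bsub>M\<^esub> x"])
    (auto simp: smult_closed smult_r_distr M.abelian_group_axioms)

lemma (in left_module) finsum_smult_l:
  "\<lbrakk>g \<in> S \<rightarrow> carrier R; x \<in> carrier M\<rbrakk>
    \<Longrightarrow> (\<Oplus>\<^bsub>R\<^esub>s\<in>S. g s) \<odot>\<^bsub>M\<^esub> x = (\<Oplus>\<^bsub>M\<^esub>s\<in>S. g s \<odot>\<^bsub>M\<^esub> x)"
  by (rule additive_finsum[of R M "\<lambda>a. a \<odot>\<^bsub>M\<^esub> x"])
    (auto simp: smult_closed smult_l_distr R.abelian_group_axioms M.abelian_group_axioms)

lemma (in left_module) finsum_smult_r:
  "\<lbrakk>g \<in> S \<rightarrow> carrier M; a \<in> carrier R\<rbrakk>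
    \<Longrightarrow> a \<odot>\<^bsub>M\<^esub> (\<Oplus>\<^bsub>M\<^esub>s\<in>S. g s) = (\<Oplus>\<^bsub>M\<^esub>s\<in>S. a \<odot>\<^bsub>M\<^esub> g s)"
  by (rule additive_finsum[of M M "\<lambda>x. a \<odot>\<^bsub>M\<^esub> x"])
    (auto simp: smult_closed smult_r_distr M.abelian_group_axioms)

lemma left_moduleI:
  assumes "ring R" "abelian_group M"
    and "\<And>a x. \<lbrakk>a \<in> carrier R; x \<in> carrier M\<rbrakk> \<Longrightarrow> a \<odot>\<^bsub>M\<^esub> x \<in> carrier M"
    and "\<And>a b x. \<lbrakk>a \<in> carrier R; b \<in> carrier R; x \<in> carrier M\<rbrakk>
      \<Longrightarrow> (a \<oplus>\<^bsub>R\<^esub> b) \<odot>\<^bsub>M\<^esub> x = a \<odot>\<^bsub>M\<^esub> x \<oplus>\<^bsub>M\<^esub> b \<odot>\<^bsub>M\<^esub> x"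
    and "\<And>a x y. \<lbrakk>a \<in> carrier R; x \<in> carrier M; y \<in> carrier M\<rbrakk>
      \<Longrightarrow> a \<odot>\<^bsub>M\<^esub> (x \<oplus>\<^bsub>M\<^esub> y) = a \<odot>\<^bsub>M\<^esub> x \<oplus>\<^bsub>M\<^esub> a \<odot>\<^bsub>M\<^esub> y"
    and "\<And>a b x. \<lbrakk>a \<in> carrier R; b \<in> carrier R; x \<in> carrier M\<rbrakk>
      \<Longrightarrow> (a \<otimes>\<^bsub>R\<^esub> b) \<odot>\<^bsub>M\<^esub> x = a \<odot>\<^bsub>M\<^esub> (b \<odot>\<^bsub>M\<^esub> x)"
    and "\<And>x. x \<in> carrier M \<Longrightarrow> \<one>\<^bsub>R\<^esub> \<odot>\<^bsub>M\<^esub> x = x"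
  shows "left_module R M"
  using assms by (intro left_module.intro left_module_axioms.intro) auto

lemma module_extensional_eqI:
  assumes "module_extensional R M" "module_extensional R N" and c: "carrier M = carrier N"
    and "\<And>x y. \<lbrakk>x \<in> carrier N; y \<in> carrier N\<rbrakk> \<Longrightarrow> x \<oplus>\<^bsub>M\<^esub> y = x \<oplus>\<^bsub>N\<^esub> y"
    and "\<zero>\<^bsub>M\<^esub> = \<zero>\<^bsub>N\<^esub>"
    and "\<And>r x. \<lbrakk>r \<in> carrier R; x \<in> carrier N\<rbrakk> \<Longrightarrow> r \<odot>\<^bsub>M\<^esub> x = r \<odot>\<^bsub>N\<^esub> x"
  shows "M = N"
proof -
  have "add M x y = add N x y" for x y
    using assms by (cases "x \<in> carrier N \<and> y \<in> carrier N") (auto simp: module_extensional_def)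
  moreover have "smult M r x = smult N r x" for r x
    using assms by (cases "r \<in> carrier R \<and> x \<in> carrier N") (auto simp: module_extensional_def)
  ultimately show ?thesis
    using assms by (intro module.equality) (auto simp: module_extensional_def fun_eq_iff)
qed

section \<open>Transport of module structure along an injection\<close>

definition transport ::
    "('r, 'x) ring_scheme \<Rightarrow> ('r, 'v) module \<Rightarrow> ('v \<Rightarrow> 'w) \<Rightarrow> ('r, 'w) module" where
  "transport R M i = (let C = i ` carrier M; j = inv_into (carrier M) i in
    \<lparr>carrier = C, mult = undefined, one = undefined, zero = i \<zero>\<^bsub>M\<^esub>,
     add = (\<lambda>x y. if x \<in> C \<and> y \<in> C then i (j x \<oplus>\<^bsub>M\<^esub> j y) else undefined),
     smult = (\<lambda>r x. if r \<in> carrier R \<and> x \<in> C then i (r \<odot>\<^bsub>M\<^esub> j x) else undefined)\<rparr>)"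

lemma module_extensional_transport: "module_extensional R (transport R M i)"
  by (auto simp: module_extensional_def transport_def Let_def)

lemma carrier_transport [simp]: "carrier (transport R M i) = i ` carrier M"
  by (simp add: transport_def Let_def)

lemma zero_transport [simp]: "\<zero>\<^bsub>transport R M i\<^esub> = i \<zero>\<^bsub>M\<^esub>"
  by (simp add: transport_def Let_def)

lemma add_transport:
  "\<lbrakk>inj_on i (carrier M); x \<in> carrier M; y \<in> carrier M\<rbrakk>
    \<Longrightarrow> i x \<oplus>\<^bsub>transport R M i\<^esub> i y = i (x \<oplus>\<^bsub>M\<^esub> y)"
  by (simp add: transport_def Let_def inv_into_f_f)

lemma smult_transport:
  "\<lbrakk>inj_on i (carrier M); r \<in> carrier R; x \<in> carrier M\<rbrakk>
    \<Longrightarrow> r \<odot>\<^bsub>transport R M i\<^esub> i x = i (r \<odot>\<^bsub>M\<^esub> x)"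
  by (simp add: transport_def Let_def inv_into_f_f)

lemma left_module_transport:
  assumes M: "left_module R M" and inj: "inj_on i (carrier M)"
  shows "left_module R (transport R M i)"
proof -
  interpret left_module R M by fact
  note [simp] = add_transport[OF inj] smult_transport[OF inj]
  have "abelian_group (transport R M i)"
  proof (rule abelian_groupI)
    fix x assume "x \<in> carrier (transport R M i)"
    then obtain y where y: "y \<in> carrier M" "x = i y" by auto
    then show "\<exists>y\<in>carrier (transport R M i). y \<oplus>\<^bsub>transport R M i\<^esub> x = \<zero>\<^bsub>transport R M i\<^esub>"
      by (intro bexI[of _ "i (\<ominus>\<^bsub>M\<^esub> y)"]) (auto simp: M.l_neg)
  qed (auto simp: M.a_ac)
  then show ?thesis
    by (intro left_moduleI R.ring_axioms)
      (auto simp: smult_closed smult_l_distr smult_r_distr smult_assoc1 smult_one)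
qed

lemma transport_eqI:
  assumes N: "module_extensional R N" and M: "left_module R M"
    and i: "bij_betw i (carrier M) (carrier N)"
    and add: "\<And>x y. \<lbrakk>x \<in> carrier M; y \<in> carrier M\<rbrakk> \<Longrightarrow> i (x \<oplus>\<^bsub>M\<^esub> y) = i x \<oplus>\<^bsub>N\<^esub> i y"
    and zero: "i \<zero>\<^bsub>M\<^esub> = \<zero>\<^bsub>N\<^esub>"
    and smult: "\<And>r x. \<lbrakk>r \<in> carrier R; x \<in> carrier M\<rbrakk> \<Longrightarrow> i (r \<odot>\<^bsub>M\<^esub> x) = r \<odot>\<^bsub>N\<^esub> i x"
  shows "transport R M i = N"
proof -
  have inj: "inj_on i (carrier M)" and im: "i ` carrier M = carrier N"
    using i by (auto simp: bij_betw_def)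
  show ?thesis
  proof (rule module_extensional_eqI[OF module_extensional_transport N])
    fix x y r assume "y \<in> carrier N"
    then obtain b where b: "b \<in> carrier M" "y = i b" unfolding im[symmetric] by blast
    then show "r \<odot>\<^bsub>transport R M i\<^esub> y = r \<odot>\<^bsub>N\<^esub> y" if "r \<in> carrier R"
      using that by (simp add: smult_transport[OF inj] smult)
    assume "x \<in> carrier N"
    then obtain a where "a \<in> carrier M" "x = i a" unfolding im[symmetric] by blast
    with b show "x \<oplus>\<^bsub>transport R M i\<^esub> y = x \<oplus>\<^bsub>N\<^esub> y"
      by (simp add: add_transport[OF inj] add)
  qed (simp_all add: im zero)
qed

lemma transport_cong:
  assumes eq: "\<And>x. x \<in> carrier M \<Longrightarrow> i x = j x"
    and M: "left_module R M" and inj: "inj_on j (carrier M)"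
  shows "transport R M i = transport R M j"
proof -
  interpret left_module R M by fact
  show ?thesis
  proof (rule transport_eqI[OF module_extensional_transport M])
    show "bij_betw i (carrier M) (carrier (transport R M j))"
      using inj eq by (auto simp: bij_betw_def inj_on_def)
  qed (simp_all add: eq smult_closed add_transport[OF inj] smult_transport[OF inj])
qed

text \<open>
  A decoding function \<open>r\<close> recovers the original module exactly, as a record. This is what makes the
  assignments between functors and modules injective on objects.
\<close>

lemma transport_transport:
  assumes "module_extensional R M" "left_module R M"
    and r: "\<And>x. x \<in> carrier M \<Longrightarrow> r (i x) = x"
  shows "transport R (transport R M i) r = M"
proof -
  have inj: "inj_on i (carrier M)" using r by (rule inj_on_inverseI)
  interpret left_module R M by fact
  show ?thesis
  proof (rule transport_eqI[OF assms(1) left_module_transport[OF assms(2) inj]])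
    show "bij_betw r (carrier (transport R M i)) (carrier M)"
      by (rule bij_betw_byWitness[where f' = i]) (auto simp: r)
  qed (auto simp: r add_transport[OF inj] smult_transport[OF inj] smult_closed)
qed

lemma linear_maps_inv_into:
  assumes f: "f \<in> linear_maps R V W" "bij_betw f (carrier V) (carrier W)"
    and V: "\<And>x y. \<lbrakk>x \<in> carrier V; y \<in> carrier V\<rbrakk> \<Longrightarrow> x \<oplus>\<^bsub>V\<^esub> y \<in> carrier V"
      "\<And>r x. \<lbrakk>r \<in> carrier R; x \<in> carrier V\<rbrakk> \<Longrightarrow> r \<odot>\<^bsub>V\<^esub> x \<in> carrier V"
  shows "(\<lambda>y\<in>carrier W. inv_into (carrier V) f y) \<in> linear_maps R W V"
proof -
  let ?g = "inv_into (carrier V) f"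
  have inj: "inj_on f (carrier V)" and im: "f ` carrier V = carrier W"
    using f(2) by (auto simp: bij_betw_def)
  have gf: "?g (f x) = x" if "x \<in> carrier V" for x using that inj by simp
  note D = linear_mapsD[OF f(1)]
  show ?thesis
  proof (rule linear_mapsI, goal_cases)
    case (3 x y)
    then obtain a b where ab: "a \<in> carrier V" "b \<in> carrier V" "x = f a" "y = f b"
      using im by (metis imageE)
    have "x \<oplus>\<^bsub>W\<^esub> y = f (a \<oplus>\<^bsub>V\<^esub> b)" using ab D by simp
    then show ?case using ab gf V D(1) by simp
  next
    case (4 r x)
    then obtain a where a: "a \<in> carrier V" "x = f a" using im by (metis imageE)
    have "r \<odot>\<^bsub>W\<^esub> x = f (r \<odot>\<^bsub>V\<^esub> a)" using a 4 D by simp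
    then show ?case using a gf V D(1) 4 by simp
  qed (use im in \<open>auto simp: inv_into_into\<close>)
qed

section \<open>Linear functors on the category of idempotents\<close>

locale idempotent_decomposition = assoc_algebra K A
  for K :: "('k, 'x) ring_scheme" and A :: "('k, 'a) module" +
  fixes E :: "'a set"
  assumes finite_E: "finite E"
    and idempotent: "e \<in> E \<Longrightarrow> idempotent_elem A e"
    and orthogonal: "\<lbrakk>e \<in> E; f \<in> E; e \<noteq> f\<rbrakk> \<Longrightarrow> e \<otimes>\<^bsub>A\<^esub> f = \<zero>\<^bsub>A\<^esub>"
    and sum_E: "(\<Oplus>\<^bsub>A\<^esub>e\<in>E. e) = \<one>\<^bsub>A\<^esub>"
begin

abbreviation C where "C \<equiv> idempotent_category A E"

lemma Obj_C [simp]: "Obj C = E"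
  and Mor_C [simp]: "Mor C = corner A"
  and Ide_C [simp]: "Ide C = (\<lambda>e. e)"
  and Cmp_C [simp]: "Cmp C = (\<lambda>e f g y x. y \<otimes>\<^bsub>A\<^esub> x)"
  and MorSpace_C [simp]: "MorSpace C = (\<lambda>e f. A\<lparr>carrier := corner A e f\<rparr>)"
  by (simp_all add: idempotent_category_def)

lemma field_K: "field K" ..

lemma linear_category_C: "linear_category K C"
  using idempotent by (intro linear_category_idempotent_category assoc_algebra_axioms) blast

lemma E_closed [simp]: "e \<in> E \<Longrightarrow> e \<in> carrier A"
  and E_idem [simp]: "e \<in> E \<Longrightarrow> e \<otimes>\<^bsub>A\<^esub> e = e"
  using idempotent by (auto simp: idempotent_elem_def)

lemma mem_corner: "\<lbrakk>e \<in> E; f \<in> E\<rbrakk>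
  \<Longrightarrow> x \<in> corner A e f \<longleftrightarrow> x \<in> carrier A \<and> f \<otimes>\<^bsub>A\<^esub> x = x \<and> x \<otimes>\<^bsub>A\<^esub> e = x"
  by (rule A.mem_corner_iff[OF idempotent idempotent])

lemma corner_closed: "\<lbrakk>e \<in> E; f \<in> E; x \<in> corner A e f\<rbrakk> \<Longrightarrow> x \<in> carrier A"
  by (simp add: mem_corner)

lemma idem_mem_corner: "e \<in> E \<Longrightarrow> e \<in> corner A e e"
  by (simp add: mem_corner)

lemma mult_mem_corner: "\<lbrakk>e \<in> E; f \<in> E; g \<in> E; a \<in> corner A e f; b \<in> corner A f g\<rbrakk>
  \<Longrightarrow> b \<otimes>\<^bsub>A\<^esub> a \<in> corner A e g"
  using category.cmp_closed[OF linear_category.axioms(2)[OF linear_category_C], of e f g a b] by simp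

lemma add_mem_corner: "\<lbrakk>e \<in> E; f \<in> E; a \<in> corner A e f; b \<in> corner A e f\<rbrakk>
  \<Longrightarrow> a \<oplus>\<^bsub>A\<^esub> b \<in> corner A e f"
  by (simp add: mem_corner A.l_distr A.r_distr)

lemma smult_mem_corner: "\<lbrakk>e \<in> E; f \<in> E; c \<in> carrier K; a \<in> corner A e f\<rbrakk>
  \<Longrightarrow> c \<odot>\<^bsub>A\<^esub> a \<in> corner A e f"
  by (simp add: mem_corner smult_mult_left smult_mult_right)

abbreviation Vec :: "('k, ('k, 'm) module, 'm \<Rightarrow> 'm) linear_category"
  where "Vec \<equiv> Vect K"

abbreviation Reps :: "(('a, 'a, ('k, 'm) module, 'm \<Rightarrow> 'm) cat_functor, 'a \<Rightarrow> 'm \<Rightarrow> 'm) category"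
  where "Reps \<equiv> linear_functor_category K C Vec"

lemma linear_category_Vec: "linear_category K Vec"
  by (rule linear_category_Vect[OF field_K])

lemma category_Reps: "category Reps"
  by (intro category_linear_functor_category linear_category.axioms(2)[OF linear_category_C]
      linear_category.axioms(2)[OF linear_category_Vec])

lemma left_module_iff_Vec: "left_module K V \<longleftrightarrow> module K V"
  using module_iff_left_module K.is_cring by blast

text \<open>
  This replaces the equations between restricted maps in which functoriality and linearity are
  phrased by equations between their values at vectors.
\<close>

lemma RepsI:
  assumes ob: "\<And>e. e \<in> E \<Longrightarrow> left_module K (Fob F e)"
      "\<And>e. e \<in> E \<Longrightarrow> module_extensional K (Fob F e)"
    and mor: "\<And>e f a. \<lbrakk>e \<in> E; f \<in> E; a \<in> corner A e f\<rbrakk>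
      \<Longrightarrow> Fmor F e f a \<in> linear_maps K (Fob F e) (Fob F f)"
    and id: "\<And>e x. \<lbrakk>e \<in> E; x \<in> carrier (Fob F e)\<rbrakk> \<Longrightarrow> Fmor F e e e x = x"
    and comp: "\<And>e f g a b x. \<lbrakk>e \<in> E; f \<in> E; g \<in> E; a \<in> corner A e f; b \<in> corner A f g;
        x \<in> carrier (Fob F e)\<rbrakk>
      \<Longrightarrow> Fmor F e g (b \<otimes>\<^bsub>A\<^esub> a) x = Fmor F f g b (Fmor F e f a x)"
    and add: "\<And>e f a b x. \<lbrakk>e \<in> E; f \<in> E; a \<in> corner A e f; b \<in> corner A e f; x \<in> carrier (Fob F e)\<rbrakk>
      \<Longrightarrow> Fmor F e f (a \<oplus>\<^bsub>A\<^esub> b) x = Fmor F e f a x \<oplus>\<^bsub>Fob F f\<^esub> Fmor F e f b x"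
    and smult: "\<And>e f c a x. \<lbrakk>e \<in> E; f \<in> E; c \<in> carrier K; a \<in> corner A e f; x \<in> carrier (Fob F e)\<rbrakk>
      \<Longrightarrow> Fmor F e f (c \<odot>\<^bsub>A\<^esub> a) x = c \<odot>\<^bsub>Fob F f\<^esub> Fmor F e f a x"
    and ext: "\<And>e. e \<notin> E \<Longrightarrow> Fob F e = undefined"
      "\<And>e f a. \<not> (e \<in> E \<and> f \<in> E \<and> a \<in> corner A e f) \<Longrightarrow> Fmor F e f a = undefined"
  shows "F \<in> Obj Reps"
proof -
  interpret C: linear_category K C by (rule linear_category_C)
  interpret V: linear_category K Vec by (rule linear_category_Vec)
  have eqI: "f = (\<lambda>x\<in>carrier V. g x)"
    if "f \<in> linear_maps K V W" "\<And>x. x \<in> carrier V \<Longrightarrow> f x = g x" for f g and V W :: "('k, 'm) module"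
    using that linear_mapsD(2)[OF that(1)] by (auto simp: fun_eq_iff)
  have "cat_functor C Vec F"
  proof (unfold_locales, goal_cases)
    case (1 X)
    then show ?case using ob by (simp add: Vect_def left_module_iff_Vec)
  next
    case (2 X Y f)
    then show ?case using mor by (simp add: Vect_def)
  next
    case (3 X)
    then show ?case using mor[of X X X] id by (auto simp: Vect_def idem_mem_corner intro!: eqI)
  next
    case (4 X Y Z f g)
    then show ?case using mor[of X Z "g \<otimes>\<^bsub>A\<^esub> f"] comp
      by (auto simp: Vect_def mult_mem_corner compose_def intro!: eqI)
  qed
  moreover have "Fmor F e f \<in> linear_maps K (MorSpace C e f) (MorSpace Vec (Fob F e) (Fob F f))"
    if ef: "e \<in> E" "f \<in> E" for e f
  proof (rule linear_mapsI, goal_cases)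
    case (1 a)
    then show ?case using mor ef by (simp add: Vect_def)
  next
    case (2 a)
    then show ?case using ext(2) by simp
  next
    case (3 a b)
    then show ?case using mor[of e f "a \<oplus>\<^bsub>A\<^esub> b"] add ef
      by (auto simp: Vect_def add_mem_corner intro!: eqI)
  next
    case (4 c a)
    then show ?case using mor[of e f "c \<odot>\<^bsub>A\<^esub> a"] smult ef
      by (auto simp: Vect_def smult_mem_corner intro!: eqI)
  qed
  ultimately have "linear_functor K C Vec F"
    by (intro linear_functor.intro linear_functor_axioms.intro linear_category_C linear_category_Vec)
      auto
  then show ?thesis
    using ext by (auto simp: linear_functor_category_def functor_extensional_def extensional_def)
qed

context
  fixes F :: "('a, 'a, ('k, 'm) module, 'm \<Rightarrow> 'm) cat_functor"
  assumes F: "F \<in> Obj Reps"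
begin

lemma Reps_linear_functor: "linear_functor K C Vec F"
  using F by (simp add: linear_functor_category_def)

lemma Reps_cat_functor: "cat_functor C Vec F"
  using Reps_linear_functor by (rule linear_functor.axioms(1))

lemma Fob_left_module: "e \<in> E \<Longrightarrow> left_module K (Fob F e)"
  and Fob_extensional: "e \<in> E \<Longrightarrow> module_extensional K (Fob F e)"
  using cat_functor.Fob_closed[OF Reps_cat_functor] by (simp_all add: Vect_def left_module_iff_Vec)

lemma Fob_abelian_group: "e \<in> E \<Longrightarrow> abelian_group (Fob F e)"
  using Fob_left_module left_module.axioms(2) by blast

lemma Fmor_linear_maps: "\<lbrakk>e \<in> E; f \<in> E; a \<in> corner A e f\<rbrakk>
    \<Longrightarrow> Fmor F e f a \<in> linear_maps K (Fob F e) (Fob F f)"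
  using cat_functor.Fmor_closed[OF Reps_cat_functor] by (simp add: Vect_def)

lemmas Fmor_apply_closed = linear_mapsD(1)[OF Fmor_linear_maps]
  and Fmor_apply_add = linear_mapsD(3)[OF Fmor_linear_maps]
  and Fmor_apply_smult = linear_mapsD(4)[OF Fmor_linear_maps]

lemma Fmor_apply_ide: "\<lbrakk>e \<in> E; x \<in> carrier (Fob F e)\<rbrakk> \<Longrightarrow> Fmor F e e e x = x"
  using cat_functor.Fmor_ide[OF Reps_cat_functor, of e] by (simp add: Vect_def)

lemma Fmor_apply_mult: "\<lbrakk>e \<in> E; f \<in> E; g \<in> E; a \<in> corner A e f; b \<in> corner A f g;
    x \<in> carrier (Fob F e)\<rbrakk> \<Longrightarrow> Fmor F e g (b \<otimes>\<^bsub>A\<^esub> a) x = Fmor F f g b (Fmor F e f a x)"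
  using cat_functor.Fmor_cmp[OF Reps_cat_functor, of e f g a b] by (simp add: Vect_def compose_def)

lemma Fmor_add_apply: "\<lbrakk>e \<in> E; f \<in> E; a \<in> corner A e f; b \<in> corner A e f; x \<in> carrier (Fob F e)\<rbrakk>
    \<Longrightarrow> Fmor F e f (a \<oplus>\<^bsub>A\<^esub> b) x = Fmor F e f a x \<oplus>\<^bsub>Fob F f\<^esub> Fmor F e f b x"
  using linear_mapsD(3)[OF linear_functor.Fmor_linear[OF Reps_linear_functor, of e f], of a b]
  by (simp add: Vect_def)

lemma Fmor_smult_apply: "\<lbrakk>e \<in> E; f \<in> E; c \<in> carrier K; a \<in> corner A e f; x \<in> carrier (Fob F e)\<rbrakk>
    \<Longrightarrow> Fmor F e f (c \<odot>\<^bsub>A\<^esub> a) x = c \<odot>\<^bsub>Fob F f\<^esub> Fmor F e f a x"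
  using linear_mapsD(4)[OF linear_functor.Fmor_linear[OF Reps_linear_functor, of e f], of c a]
  by (simp add: Vect_def)

lemma Fob_undefined: "e \<notin> E \<Longrightarrow> Fob F e = undefined"
  and Fmor_undefined: "\<not> (e \<in> E \<and> f \<in> E \<and> a \<in> corner A e f) \<Longrightarrow> Fmor F e f a = undefined"
  using F by (auto simp: linear_functor_category_def functor_extensional_def extensional_def)

end

lemma Reps_eqI:
  assumes F: "F \<in> Obj Reps" and G: "G \<in> Obj Reps"
    and ob: "\<And>e. e \<in> E \<Longrightarrow> Fob F e = Fob G e"
    and mor: "\<And>e f a x. \<lbrakk>e \<in> E; f \<in> E; a \<in> corner A e f; x \<in> carrier (Fob G e)\<rbrakk>
      \<Longrightarrow> Fmor F e f a x = Fmor G e f a x"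
  shows "F = G"
proof -
  have "Fob F e = Fob G e" for e
    using ob Fob_undefined[OF F] Fob_undefined[OF G] by (cases "e \<in> E") auto
  moreover have "Fmor F e f a x = Fmor G e f a x" for e f a x
  proof (cases "e \<in> E \<and> f \<in> E \<and> a \<in> corner A e f")
    case True
    then show ?thesis
      using mor linear_mapsD(2)[OF Fmor_linear_maps[OF F], of e f a x]
        linear_mapsD(2)[OF Fmor_linear_maps[OF G], of e f a x] ob
      by (cases "x \<in> carrier (Fob G e)") auto
  qed (use Fmor_undefined[OF F] Fmor_undefined[OF G] in auto)
  ultimately show ?thesis by (intro cat_functor.equality) (auto simp: fun_eq_iff)
qed

lemma Mor_Reps_iff:
  assumes F: "F \<in> Obj Reps" and G: "G \<in> Obj Reps"
  shows "\<eta> \<in> Mor Reps F G \<longleftrightarrow> \<eta> \<in> extensional E \<and>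
    (\<forall>e\<in>E. \<eta> e \<in> linear_maps K (Fob F e) (Fob G e)) \<and>
    (\<forall>e\<in>E. \<forall>f\<in>E. \<forall>a\<in>corner A e f. \<forall>x\<in>carrier (Fob F e).
       \<eta> f (Fmor F e f a x) = Fmor G e f a (\<eta> e x))"
proof -
  have "compose (carrier (Fob F e)) (\<eta> f) (Fmor F e f a) = compose (carrier (Fob F e)) (Fmor G e f a) (\<eta> e)
    \<longleftrightarrow> (\<forall>x\<in>carrier (Fob F e). \<eta> f (Fmor F e f a x) = Fmor G e f a (\<eta> e x))" for e f a
    by (auto simp: compose_def fun_eq_iff)
  then show ?thesis
    by (auto simp: linear_functor_category_def natural_transformations_def Vect_def PiE_iff)
qed

text \<open>
  The inverse of a bijective natural transformation is automatically linear and natural.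
\<close>

lemma isomorphic_objects_RepsI:
  assumes F: "F \<in> Obj Reps" and G: "G \<in> Obj Reps" and \<eta>: "\<eta> \<in> Mor Reps F G"
    and bij: "\<And>e. e \<in> E \<Longrightarrow> bij_betw (\<eta> e) (carrier (Fob F e)) (carrier (Fob G e))"
  shows "isomorphic_objects Reps F G"
proof -
  define \<theta> where "\<theta> = (\<lambda>e\<in>E. \<lambda>y\<in>carrier (Fob G e). inv_into (carrier (Fob F e)) (\<eta> e) y)"
  note \<eta>' = \<eta>[unfolded Mor_Reps_iff[OF F G]]
  have \<theta>\<eta>: "\<theta> e (\<eta> e x) = x" if "e \<in> E" "x \<in> carrier (Fob F e)" for e x
    using that bij[of e] by (auto simp: \<theta>_def bij_betw_def)
  have \<eta>\<theta>: "\<eta> e (\<theta> e y) = y" and \<theta>_closed: "\<theta> e y \<in> carrier (Fob F e)"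
    if "e \<in> E" "y \<in> carrier (Fob G e)" for e y
    using that bij[of e] by (auto simp: \<theta>_def bij_betw_def f_inv_into_f inv_into_into)
  have "\<theta> \<in> Mor Reps G F"
    unfolding Mor_Reps_iff[OF G F]
  proof (intro conjI ballI)
    show "\<theta> \<in> extensional E" by (simp add: \<theta>_def)
  next
    fix e assume e: "e \<in> E"
    interpret left_module K "Fob F e" by (rule Fob_left_module[OF F e])
    have "\<theta> e = (\<lambda>y\<in>carrier (Fob G e). inv_into (carrier (Fob F e)) (\<eta> e) y)"
      using e by (simp add: \<theta>_def)
    also have "\<dots> \<in> linear_maps K (Fob G e) (Fob F e)"
      using \<eta>' e by (intro linear_maps_inv_into bij) (auto simp: smult_closed)
    finally show "\<theta> e \<in> linear_maps K (Fob G e) (Fob F e)" .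
  next
    fix e f a y assume ef: "e \<in> E" "f \<in> E" and a: "a \<in> corner A e f" and y: "y \<in> carrier (Fob G e)"
    have "\<theta> f (Fmor G e f a y) = \<theta> f (\<eta> f (Fmor F e f a (\<theta> e y)))"
      using \<eta>' ef a y by (simp add: \<eta>\<theta> \<theta>_closed)
    also have "\<dots> = Fmor F e f a (\<theta> e y)"
      using ef a y by (intro \<theta>\<eta> Fmor_apply_closed[OF F] \<theta>_closed)
    finally show "\<theta> f (Fmor G e f a y) = Fmor F e f a (\<theta> e y)" .
  qed
  moreover have "Cmp Reps F G F \<theta> \<eta> = Ide Reps F" "Cmp Reps G F G \<eta> \<theta> = Ide Reps G"
    using \<theta>\<eta> \<eta>\<theta> by (auto simp: linear_functor_category_def Vect_def compose_def fun_eq_iff)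
  ultimately show ?thesis using \<eta> unfolding isomorphic_objects_def by blast
qed

text \<open>
  The functor isomorphic to \<open>F\<close> in which each vector \<open>x\<close> of \<open>F e\<close> is called \<open>i e x\<close>.
\<close>

definition rename :: "('a, 'a, ('k, 'm) module, 'm \<Rightarrow> 'm) cat_functor \<Rightarrow> ('a \<Rightarrow> 'm \<Rightarrow> 'm) \<Rightarrow>
    ('a, 'a, ('k, 'm) module, 'm \<Rightarrow> 'm) cat_functor" where
  "rename F i = \<lparr>Fob = (\<lambda>e\<in>E. transport K (Fob F e) (i e)),
     Fmor = (\<lambda>e f a. if e \<in> E \<and> f \<in> E \<and> a \<in> corner A e f
       then \<lambda>y\<in>i e ` carrier (Fob F e). i f (Fmor F e f a (inv_into (carrier (Fob F e)) (i e) y))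
       else undefined)\<rparr>"

lemma Fob_rename [simp]: "e \<in> E \<Longrightarrow> Fob (rename F i) e = transport K (Fob F e) (i e)"
  by (simp add: rename_def)

lemma Fmor_rename:
  "\<lbrakk>e \<in> E; f \<in> E; a \<in> corner A e f; inj_on (i e) (carrier (Fob F e)); x \<in> carrier (Fob F e)\<rbrakk>
    \<Longrightarrow> Fmor (rename F i) e f a (i e x) = i f (Fmor F e f a x)"
  by (simp add: rename_def)

lemma rename_mem_Reps:
  assumes F: "F \<in> Obj Reps" and inj: "\<And>e. e \<in> E \<Longrightarrow> inj_on (i e) (carrier (Fob F e))"
  shows "rename F i \<in> Obj Reps"
proof (rule RepsI)
  note [simp] = Fmor_rename[where i = i, OF _ _ _ inj] add_transport[where i = "i _", OF inj] smult_transport[where i = "i _", OF inj]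
    Fmor_apply_closed[OF F] mult_mem_corner add_mem_corner smult_mem_corner idem_mem_corner
    left_module.smult_closed[OF Fob_left_module[OF F]]
    abelian_monoid.a_closed[OF abelian_group.axioms(1)[OF Fob_abelian_group[OF F]]]
  show "left_module K (Fob (rename F i) e)" if "e \<in> E" for e
    using that left_module_transport[OF Fob_left_module[OF F] inj] by simp
  show "module_extensional K (Fob (rename F i) e)" if "e \<in> E" for e
    using that module_extensional_transport by simp
  show "Fmor (rename F i) e f a \<in> linear_maps K (Fob (rename F i) e) (Fob (rename F i) f)"
    if "e \<in> E" "f \<in> E" "a \<in> corner A e f" for e f a
  proof (rule linear_mapsI, goal_cases)
    case (2 y)
    then show ?case using that by (simp add: rename_def)
  qed (use that in \<open>auto simp: Fmor_apply_add[OF F] Fmor_apply_smult[OF F]\<close>)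
qed (auto simp: Fmor_rename[where i = i, OF _ _ _ inj] add_transport[where i = "i _", OF inj] smult_transport[where i = "i _", OF inj]
    Fmor_apply_closed[OF F] mult_mem_corner add_mem_corner smult_mem_corner idem_mem_corner
    Fmor_apply_ide[OF F] Fmor_apply_mult[OF F] Fmor_add_apply[OF F] Fmor_smult_apply[OF F], auto simp: rename_def)

lemma isomorphic_objects_rename:
  assumes F: "F \<in> Obj Reps" and inj: "\<And>e. e \<in> E \<Longrightarrow> inj_on (i e) (carrier (Fob F e))"
  shows "isomorphic_objects Reps F (rename F i)"
proof (rule isomorphic_objects_RepsI[OF F])
  show R: "rename F i \<in> Obj Reps" by (rule rename_mem_Reps[OF F inj])
  note [simp] = Fmor_rename[where i = i, OF _ _ _ inj] add_transport[where i = "i _", OF inj] smult_transport[where i = "i _", OF inj]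
    Fmor_apply_closed[OF F]
    left_module.smult_closed[OF Fob_left_module[OF F]]
    abelian_monoid.a_closed[OF abelian_group.axioms(1)[OF Fob_abelian_group[OF F]]]
  let ?\<eta> = "\<lambda>e\<in>E. \<lambda>x\<in>carrier (Fob F e). i e x"
  show "?\<eta> \<in> Mor Reps F (rename F i)"
    unfolding Mor_Reps_iff[OF F R]
    by (auto simp: linear_maps_def)
  show "bij_betw (?\<eta> e) (carrier (Fob F e)) (carrier (Fob (rename F i) e))" if "e \<in> E" for e
    using that inj by (auto simp: bij_betw_def inj_on_def)
qed

lemma rename_rename:
  assumes F: "F \<in> Obj Reps" and r: "\<And>e x. \<lbrakk>e \<in> E; x \<in> carrier (Fob F e)\<rbrakk> \<Longrightarrow> r e (i e x) = x"
  shows "rename (rename F i) r = F"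
proof -
  have inj: "inj_on (i e) (carrier (Fob F e))" if "e \<in> E" for e
    using r that by (intro inj_on_inverseI[where g = "r e"]) auto
  have inj': "inj_on (r e) (carrier (Fob (rename F i) e))" if "e \<in> E" for e
    using that r by (auto intro!: inj_onI)
  note F' = rename_mem_Reps[where i = i, OF F inj]
  show ?thesis
  proof (rule Reps_eqI[OF rename_mem_Reps[where i = r, OF F' inj'] F])
    show "Fob (rename (rename F i) r) e = Fob F e" if "e \<in> E" for e
      using that transport_transport[of K "Fob F e" "r e" "i e"] Fob_extensional[OF F] Fob_left_module[OF F]
      by (simp add: r)
    fix e f a x assume "e \<in> E" "f \<in> E" "a \<in> corner A e f" "x \<in> carrier (Fob F e)"
    then show "Fmor (rename (rename F i) r) e f a x = Fmor F e f a x"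
      using Fmor_rename[of e f a r "rename F i" "i e x"] Fmor_rename[of e f a i F x] inj inj'
      by (simp add: r Fmor_apply_closed[OF F])
  qed
qed

section \<open>The functor of Peirce components is fully faithful\<close>

text \<open>
  Since \<open>e\<close> is idempotent, \<open>eM\<close> consists of the vectors that it fixes. The field acts
  through the scalar multiples of the unit of \<open>A\<close>, because \<open>M\<close> itself has no scalars from \<open>K\<close>.
\<close>

definition peirce_space :: "('a, 'm) module \<Rightarrow> 'a \<Rightarrow> ('k, 'm) module" where
  "peirce_space M e = (let S = {x \<in> carrier M. e \<odot>\<^bsub>M\<^esub> x = x} in
    \<lparr>carrier = S, mult = undefined, one = undefined, zero = \<zero>\<^bsub>M\<^esub>,
     add = (\<lambda>x y. if x \<in> S \<and> y \<in> S then x \<oplus>\<^bsub>M\<^esub> y else undefined),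
     smult = (\<lambda>c x. if c \<in> carrier K \<and> x \<in> S then (c \<odot>\<^bsub>A\<^esub> \<one>\<^bsub>A\<^esub>) \<odot>\<^bsub>M\<^esub> x else undefined)\<rparr>)"

definition peirce :: "('a, 'm) module \<Rightarrow> ('a, 'a, ('k, 'm) module, 'm \<Rightarrow> 'm) cat_functor" where
  "peirce M = \<lparr>Fob = (\<lambda>e\<in>E. peirce_space M e),
     Fmor = (\<lambda>e f a. if e \<in> E \<and> f \<in> E \<and> a \<in> corner A e f
       then \<lambda>x\<in>carrier (peirce_space M e). a \<odot>\<^bsub>M\<^esub> x else undefined)\<rparr>"

definition peirce_functor where
  "peirce_functor = \<lparr>Fob = peirce,
     Fmor = (\<lambda>M N \<phi>. \<lambda>e\<in>E. \<lambda>x\<in>carrier (peirce_space M e). \<phi> x)\<rparr>"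

lemma Fob_peirce_functor [simp]: "Fob peirce_functor = peirce"
  and Fmor_peirce_functor [simp]: "Fmor peirce_functor M N \<phi> = (\<lambda>e\<in>E. \<lambda>x\<in>carrier (peirce_space M e). \<phi> x)"
  by (simp_all add: peirce_functor_def)

lemma mem_peirce_space: "x \<in> carrier (peirce_space M e) \<longleftrightarrow> x \<in> carrier M \<and> e \<odot>\<^bsub>M\<^esub> x = x"
  and zero_peirce_space [simp]: "\<zero>\<^bsub>peirce_space M e\<^esub> = \<zero>\<^bsub>M\<^esub>"
  by (simp_all add: peirce_space_def)

lemma add_peirce_space [simp]:
    "\<lbrakk>x \<in> carrier (peirce_space M e); y \<in> carrier (peirce_space M e)\<rbrakk>
      \<Longrightarrow> x \<oplus>\<^bsub>peirce_space M e\<^esub> y = x \<oplus>\<^bsub>M\<^esub> y"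
  and smult_peirce_space [simp]:
    "\<lbrakk>c \<in> carrier K; x \<in> carrier (peirce_space M e)\<rbrakk>
      \<Longrightarrow> c \<odot>\<^bsub>peirce_space M e\<^esub> x = (c \<odot>\<^bsub>A\<^esub> \<one>\<^bsub>A\<^esub>) \<odot>\<^bsub>M\<^esub> x"
  by (simp_all add: peirce_space_def)

lemma Fob_peirce [simp]: "e \<in> E \<Longrightarrow> Fob (peirce M) e = peirce_space M e"
  and Fmor_peirce [simp]: "\<lbrakk>e \<in> E; f \<in> E; a \<in> corner A e f; x \<in> carrier (peirce_space M e)\<rbrakk>
    \<Longrightarrow> Fmor (peirce M) e f a x = a \<odot>\<^bsub>M\<^esub> x"
  by (simp_all add: peirce_def)

lemma scalar_mult: "\<lbrakk>c \<in> carrier K; a \<in> carrier A\<rbrakk> \<Longrightarrow> (c \<odot>\<^bsub>A\<^esub> \<one>\<^bsub>A\<^esub>) \<otimes>\<^bsub>A\<^esub> a = c \<odot>\<^bsub>A\<^esub> a"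
  and scalar_central: "\<lbrakk>c \<in> carrier K; a \<in> carrier A\<rbrakk> \<Longrightarrow> a \<otimes>\<^bsub>A\<^esub> (c \<odot>\<^bsub>A\<^esub> \<one>\<^bsub>A\<^esub>) = c \<odot>\<^bsub>A\<^esub> a"
  by (simp_all add: smult_mult_left smult_mult_right)

context
  fixes M :: "('a, 'm) module"
  assumes M: "left_module A M"
begin

interpretation M: left_module A M by (rule M)

declare M.smult_closed [simp]

lemma scalar_smult: "\<lbrakk>c \<in> carrier K; a \<in> carrier A; x \<in> carrier M\<rbrakk>
    \<Longrightarrow> (c \<odot>\<^bsub>A\<^esub> \<one>\<^bsub>A\<^esub>) \<odot>\<^bsub>M\<^esub> (a \<odot>\<^bsub>M\<^esub> x) = (c \<odot>\<^bsub>A\<^esub> a) \<odot>\<^bsub>M\<^esub> x"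
  and smult_scalar: "\<lbrakk>c \<in> carrier K; a \<in> carrier A; x \<in> carrier M\<rbrakk>
    \<Longrightarrow> a \<odot>\<^bsub>M\<^esub> ((c \<odot>\<^bsub>A\<^esub> \<one>\<^bsub>A\<^esub>) \<odot>\<^bsub>M\<^esub> x) = (c \<odot>\<^bsub>A\<^esub> a) \<odot>\<^bsub>M\<^esub> x"
  by (simp_all add: M.smult_assoc1[symmetric] scalar_mult scalar_central)

lemma corner_smult_mem_peirce_space:
  assumes "e \<in> E" "f \<in> E" "a \<in> corner A e f" "x \<in> carrier M"
  shows "a \<odot>\<^bsub>M\<^esub> x \<in> carrier (peirce_space M f)"
proof -
  have "f \<odot>\<^bsub>M\<^esub> (a \<odot>\<^bsub>M\<^esub> x) = (f \<otimes>\<^bsub>A\<^esub> a) \<odot>\<^bsub>M\<^esub> x"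
    using assms by (simp add: M.smult_assoc1 corner_closed)
  then show ?thesis using assms by (simp add: mem_peirce_space mem_corner)
qed

lemma idem_smult_mem_peirce_space:
  "\<lbrakk>e \<in> E; x \<in> carrier M\<rbrakk> \<Longrightarrow> e \<odot>\<^bsub>M\<^esub> x \<in> carrier (peirce_space M e)"
  by (rule corner_smult_mem_peirce_space[OF _ _ idem_mem_corner])

lemma abelian_group_peirce_space:
  assumes e: "e \<in> E"
  shows "abelian_group (peirce_space M e)"
proof (rule abelian_groupI)
  fix x assume x: "x \<in> carrier (peirce_space M e)"
  have "e \<odot>\<^bsub>M\<^esub> (\<ominus>\<^bsub>M\<^esub> x) \<oplus>\<^bsub>M\<^esub> x = e \<odot>\<^bsub>M\<^esub> (\<ominus>\<^bsub>M\<^esub> x \<oplus>\<^bsub>M\<^esub> x)"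
    using x e by (simp add: mem_peirce_space M.smult_r_distr)
  also have "\<dots> = \<zero>\<^bsub>M\<^esub>" using x e by (simp add: mem_peirce_space M.l_neg M.smult_r_null)
  finally show "\<exists>y\<in>carrier (peirce_space M e). y \<oplus>\<^bsub>peirce_space M e\<^esub> x = \<zero>\<^bsub>peirce_space M e\<^esub>"
    using x e idem_smult_mem_peirce_space[of e "\<ominus>\<^bsub>M\<^esub> x"]
    by (intro bexI[of _ "e \<odot>\<^bsub>M\<^esub> (\<ominus>\<^bsub>M\<^esub> x)"]) (auto simp: mem_peirce_space)
qed (use e in \<open>auto simp: mem_peirce_space peirce_space_def M.smult_r_distr M.smult_r_null M.a_ac\<close>)

lemma scalar_smult_mem_peirce_space:
  assumes "e \<in> E" "c \<in> carrier K" "x \<in> carrier (peirce_space M e)"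
  shows "(c \<odot>\<^bsub>A\<^esub> \<one>\<^bsub>A\<^esub>) \<odot>\<^bsub>M\<^esub> x \<in> carrier (peirce_space M e)"
proof -
  have "(c \<odot>\<^bsub>A\<^esub> \<one>\<^bsub>A\<^esub>) \<odot>\<^bsub>M\<^esub> x = (c \<odot>\<^bsub>A\<^esub> e) \<odot>\<^bsub>M\<^esub> x"
    using assms scalar_smult[of c e x] by (simp add: mem_peirce_space)
  moreover have "c \<odot>\<^bsub>A\<^esub> e \<in> corner A e e"
    using assms by (intro smult_mem_corner idem_mem_corner) auto
  ultimately show ?thesis
    using assms corner_smult_mem_peirce_space[of e e "c \<odot>\<^bsub>A\<^esub> e" x] by (simp add: mem_peirce_space)
qed

lemma peirce_mem_Reps: "peirce M \<in> Obj Reps"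
proof (rule RepsI)
  have M': "x \<in> carrier M" if "x \<in> carrier (peirce_space M e)" for x e
    using that by (simp add: mem_peirce_space)
  show "left_module K (Fob (peirce M) e)" if e: "e \<in> E" for e
  proof -
    have "left_module K (peirce_space M e)"
      using e abelian_monoid.a_closed[OF abelian_group.axioms(1)[OF abelian_group_peirce_space[OF e]]]
      by (intro left_moduleI abelian_group_peirce_space K.ring_axioms)
        (auto simp: scalar_smult_mem_peirce_space smult_l_distr M.smult_l_distr M.smult_r_distr
          M'[of _ e] scalar_smult smult_assoc1 M.smult_one)
    then show ?thesis using e by simp
  qed
  show "module_extensional K (Fob (peirce M) e)" if "e \<in> E" for e
    using that by (auto simp: module_extensional_def peirce_space_def)
  show "Fmor (peirce M) e f a \<in> linear_maps K (Fob (peirce M) e) (Fob (peirce M) f)"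
    if ef: "e \<in> E" "f \<in> E" and a: "a \<in> corner A e f" for e f a
  proof (rule linear_mapsI, goal_cases)
    case (2 x)
    then show ?case using ef a by (simp add: peirce_def)
  next
    case (3 x y)
    then show ?case
      using ef a abelian_monoid.a_closed[OF abelian_group.axioms(1)[OF abelian_group_peirce_space[of e]], of x y]
      by (simp add: corner_smult_mem_peirce_space M'[of _ e] M.smult_r_distr corner_closed)
  next
    case (4 c x)
    then show ?case
      using ef a scalar_smult_mem_peirce_space[of e c x]
      by (simp add: corner_smult_mem_peirce_space M'[of _ e] smult_scalar scalar_smult corner_closed)
  qed (use ef a in \<open>simp add: corner_smult_mem_peirce_space M'[of _ e]\<close>)
  show "Fmor (peirce M) e e e x = x" if "e \<in> E" "x \<in> carrier (Fob (peirce M) e)" for e x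
    using that by (simp add: idem_mem_corner) (simp add: mem_peirce_space)
  show "Fmor (peirce M) e g (b \<otimes>\<^bsub>A\<^esub> a) x = Fmor (peirce M) f g b (Fmor (peirce M) e f a x)"
    if "e \<in> E" "f \<in> E" "g \<in> E" "a \<in> corner A e f" "b \<in> corner A f g" "x \<in> carrier (Fob (peirce M) e)"
    for e f g a b x
    using that corner_smult_mem_peirce_space[of e f a x]
    by (simp add: mult_mem_corner) (simp add: mem_peirce_space M.smult_assoc1 mem_corner)
  show "Fmor (peirce M) e f (a \<oplus>\<^bsub>A\<^esub> b) x
      = Fmor (peirce M) e f a x \<oplus>\<^bsub>Fob (peirce M) f\<^esub> Fmor (peirce M) e f b x"
    if "e \<in> E" "f \<in> E" "a \<in> corner A e f" "b \<in> corner A e f" "x \<in> carrier (Fob (peirce M) e)" for e f a b x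
    using that corner_smult_mem_peirce_space[of e f _ x]
    by (simp add: add_mem_corner) (simp add: mem_peirce_space M.smult_l_distr mem_corner)
  show "Fmor (peirce M) e f (c \<odot>\<^bsub>A\<^esub> a) x = c \<odot>\<^bsub>Fob (peirce M) f\<^esub> Fmor (peirce M) e f a x"
    if "e \<in> E" "f \<in> E" "c \<in> carrier K" "a \<in> corner A e f" "x \<in> carrier (Fob (peirce M) e)" for e f c a x
    using that corner_smult_mem_peirce_space[of e f a x]
    by (simp add: smult_mem_corner) (simp add: mem_peirce_space scalar_smult mem_corner)
qed (auto simp: peirce_def)

lemma sum_peirce_components: "x \<in> carrier M \<Longrightarrow> (\<Oplus>\<^bsub>M\<^esub>e\<in>E. e \<odot>\<^bsub>M\<^esub> x) = x"
  using M.finsum_smult_l[of "\<lambda>e. e" E x] by (simp add: sum_E M.smult_one Pi_iff)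

lemma smult_orthogonal:
  assumes "e \<in> E" "f \<in> E" "f \<noteq> e" "x \<in> carrier (peirce_space M e)"
  shows "f \<odot>\<^bsub>M\<^esub> x = \<zero>\<^bsub>M\<^esub>"
proof -
  have "f \<odot>\<^bsub>M\<^esub> x = (f \<otimes>\<^bsub>A\<^esub> e) \<odot>\<^bsub>M\<^esub> x" using assms by (simp add: M.smult_assoc1 mem_peirce_space)
  then show ?thesis using assms by (simp add: orthogonal M.smult_l_null mem_peirce_space)
qed

text \<open>
  Together with \<open>sum_peirce_components\<close> this says that \<open>M\<close> is the direct sum of its
  components: multiplication by \<open>e\<close> projects a sum of components to the one at \<open>e\<close>.
\<close>

lemma smult_sum_peirce:
  assumes p: "p \<in> (\<Pi>\<^sub>E e\<in>E. carrier (peirce_space M e))" and e: "e \<in> E"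
  shows "e \<odot>\<^bsub>M\<^esub> (\<Oplus>\<^bsub>M\<^esub>f\<in>E. p f) = p e"
proof -
  have p': "p f \<in> carrier (peirce_space M f)" if "f \<in> E" for f using p that by auto
  then have "p \<in> E \<rightarrow> carrier M" by (auto simp: mem_peirce_space)
  then have "e \<odot>\<^bsub>M\<^esub> (\<Oplus>\<^bsub>M\<^esub>f\<in>E. p f) = (\<Oplus>\<^bsub>M\<^esub>f\<in>E. e \<odot>\<^bsub>M\<^esub> p f)"
    using e by (simp add: M.finsum_smult_r)
  also have "\<dots> = e \<odot>\<^bsub>M\<^esub> p e"
  proof (rule M.finsum_only[OF finite_E e])
    show "e \<odot>\<^bsub>M\<^esub> p e \<in> carrier M" using p'[OF e] by (simp add: mem_peirce_space)
    show "e \<odot>\<^bsub>M\<^esub> p f = \<zero>\<^bsub>M\<^esub>" if "f \<in> E" "f \<noteq> e" for f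
      using that e p' by (intro smult_orthogonal[of f e]) auto
  qed
  finally show ?thesis using p'[OF e] by (simp add: mem_peirce_space)
qed

end

lemma peirce_functor_mor_closed:
  fixes M N :: "('a, 'm) module"
  assumes M: "left_module A M" and N: "left_module A N" and \<phi>: "\<phi> \<in> linear_maps A M N"
  shows "Fmor peirce_functor M N \<phi> \<in> Mor Reps (peirce M) (peirce N)"
proof -
  interpret M: left_module A M by (rule M)
  note D = linear_mapsD[OF \<phi>]
  have cl: "\<phi> x \<in> carrier (peirce_space N e)" if "x \<in> carrier (peirce_space M e)" "e \<in> E" for x e
    using that D(1)[of x] D(4)[of e x] by (simp add: mem_peirce_space)
  have M': "x \<in> carrier M" if "x \<in> carrier (peirce_space M e)" for x e
    using that by (simp add: mem_peirce_space)
  note ag = abelian_monoid.a_closed[OF abelian_group.axioms(1)[OF abelian_group_peirce_space[OF M]]]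
  show ?thesis
    unfolding Mor_Reps_iff[OF peirce_mem_Reps[OF M] peirce_mem_Reps[OF N]]
  proof (intro conjI ballI)
    fix e assume e: "e \<in> E"
    show "Fmor peirce_functor M N \<phi> e \<in> linear_maps K (Fob (peirce M) e) (Fob (peirce N) e)"
    proof (rule linear_mapsI, goal_cases)
      case (3 x y)
      then show ?case using e ag[OF e, of x y] cl by (simp add: M' D)
    next
      case (4 c x)
      then show ?case using e scalar_smult_mem_peirce_space[OF M e, of c x] cl by (simp add: M' D)
    qed (use e cl in auto)
  qed (auto simp: corner_smult_mem_peirce_space[OF M] M' D cl corner_closed)
qed

theorem cat_functor_peirce_functor: "cat_functor (LMod A) Reps (peirce_functor :: (('a, 'm) module, _, _, 'a \<Rightarrow> 'm \<Rightarrow> 'm) cat_functor)"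
proof -
  interpret category "LMod A :: (('a, 'm) module, 'm \<Rightarrow> 'm) category" by (rule category_LMod)
  interpret R: category "Reps :: (('a, 'a, ('k, 'm) module, 'm \<Rightarrow> 'm) cat_functor, _) category"
    by (rule category_Reps)
  show ?thesis
  proof (unfold_locales, goal_cases)
    case (1 M)
    then show ?case by (simp add: peirce_mem_Reps LMod_def)
  next
    case (2 M N \<phi>)
    then show ?case unfolding Fob_peirce_functor by (intro peirce_functor_mor_closed) (simp_all add: LMod_def)
  next
    case (3 M)
    then show ?case
      by (auto simp: linear_functor_category_def LMod_def Vect_def mem_peirce_space fun_eq_iff)
  next
    case (4 L M N \<phi> \<psi>)
    then have "\<phi> \<in> linear_maps A L M" by (simp add: LMod_def)
    note D = linear_mapsD[OF this]
    have "\<phi> x \<in> carrier M \<and> e \<odot>\<^bsub>M\<^esub> \<phi> x = \<phi> x"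
      if "e \<in> E" "x \<in> carrier L" "e \<odot>\<^bsub>L\<^esub> x = x" for e x
      using that D(1)[of x] D(4)[of e x] by simp
    then show ?case
      by (auto simp: linear_functor_category_def LMod_def Vect_def mem_peirce_space fun_eq_iff compose_def)
  qed
qed

text \<open>
  A natural family \<open>\<eta>\<close> glues to the map \<open>x \<mapsto> \<Sum>e\<in>E. \<eta> e (e x)\<close>. This map commutes with \<open>a \<in> A\<close> because
  its component at \<open>f\<close> sends \<open>a (e x)\<close> to \<open>(f a e) (\<eta> e (e x))\<close> by naturality with respect to
  \<open>f a e \<in> fAe\<close>, and summing over \<open>e\<close> and \<open>f\<close> gives back the action of \<open>a\<close>.
\<close>

theorem peirce_functor_fully_faithful:
  fixes M N :: "('a, 'm) module"
  assumes M: "left_module A M" and N: "left_module A N"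
  shows "bij_betw (Fmor peirce_functor M N) (linear_maps A M N) (Mor Reps (peirce M) (peirce N))"
proof -
  interpret M: left_module A M by (rule M)
  interpret N: left_module A N by (rule N)
  note [simp] = M.smult_closed N.smult_closed
  define glue where "glue \<eta> = (\<lambda>x\<in>carrier M. \<Oplus>\<^bsub>N\<^esub>e\<in>E. \<eta> e (e \<odot>\<^bsub>M\<^esub> x))" for \<eta> :: "'a \<Rightarrow> 'm \<Rightarrow> 'm"
  have glue_restrict: "glue (Fmor peirce_functor M N \<phi>) = \<phi>" if \<phi>: "\<phi> \<in> linear_maps A M N" for \<phi>
  proof
    fix x
    note D = linear_mapsD[OF \<phi>]
    show "glue (Fmor peirce_functor M N \<phi>) x = \<phi> x"
    proof (cases "x \<in> carrier M")
      case True
      then have "glue (Fmor peirce_functor M N \<phi>) x = (\<Oplus>\<^bsub>N\<^esub>e\<in>E. e \<odot>\<^bsub>N\<^esub> \<phi> x)"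
        unfolding glue_def
        by (auto intro!: N.finsum_cong' simp: D idem_smult_mem_peirce_space[OF M])
      then show ?thesis using True by (simp add: sum_peirce_components[OF N] D)
    qed (simp add: glue_def D)
  qed
  have glue: "glue \<eta> \<in> linear_maps A M N" and restrict_glue: "Fmor peirce_functor M N (glue \<eta>) = \<eta>"
    if "\<eta> \<in> Mor Reps (peirce M) (peirce N)" for \<eta>
  proof -
    note \<eta> = that[unfolded Mor_Reps_iff[OF peirce_mem_Reps[OF M] peirce_mem_Reps[OF N]]]
    have lin: "\<eta> e \<in> linear_maps K (peirce_space M e) (peirce_space N e)" if "e \<in> E" for e
      using \<eta> that by simp
    have nat: "\<eta> f (a \<odot>\<^bsub>M\<^esub> x) = a \<odot>\<^bsub>N\<^esub> \<eta> e x"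
      if "e \<in> E" "f \<in> E" "a \<in> corner A e f" "x \<in> carrier (peirce_space M e)" for e f a x
      using \<eta> that linear_mapsD(1)[OF lin, of e x] by force
    (* Precomposing with e makes each component of the transformation additive on all of M. *)
    define h where "h e x = \<eta> e (e \<odot>\<^bsub>M\<^esub> x)" for e x
    have h_mem: "h e x \<in> carrier (peirce_space N e)" if "e \<in> E" "x \<in> carrier M" for e x
      using that unfolding h_def
      by (intro linear_mapsD(1)[OF lin] idem_smult_mem_peirce_space[OF M])
    have h_closed: "h e x \<in> carrier N" if "e \<in> E" "x \<in> carrier M" for e x
      using h_mem[OF that] by (simp add: mem_peirce_space)
    have h_add: "h e (x \<oplus>\<^bsub>M\<^esub> y) = h e x \<oplus>\<^bsub>N\<^esub> h e y"
      if "e \<in> E" "x \<in> carrier M" "y \<in> carrier M" for e x y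
      using that linear_mapsD(3)[OF lin, of e "e \<odot>\<^bsub>M\<^esub> x" "e \<odot>\<^bsub>M\<^esub> y"] h_mem[unfolded h_def]
      by (simp add: h_def M.smult_r_distr idem_smult_mem_peirce_space[OF M])
    have h_smult: "h f (a \<odot>\<^bsub>M\<^esub> (e \<odot>\<^bsub>M\<^esub> x)) = f \<odot>\<^bsub>N\<^esub> (a \<odot>\<^bsub>N\<^esub> h e x)"
      if "e \<in> E" "f \<in> E" "a \<in> carrier A" "x \<in> carrier M" for e f a x
    proof -
      have "f \<odot>\<^bsub>M\<^esub> (a \<odot>\<^bsub>M\<^esub> (e \<odot>\<^bsub>M\<^esub> x)) = (f \<otimes>\<^bsub>A\<^esub> a \<otimes>\<^bsub>A\<^esub> e) \<odot>\<^bsub>M\<^esub> (e \<odot>\<^bsub>M\<^esub> x)"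
        using that idem_smult_mem_peirce_space[OF M, of e x]
        by (simp add: M.smult_assoc1 mem_peirce_space)
      then have "h f (a \<odot>\<^bsub>M\<^esub> (e \<odot>\<^bsub>M\<^esub> x)) = (f \<otimes>\<^bsub>A\<^esub> a \<otimes>\<^bsub>A\<^esub> e) \<odot>\<^bsub>N\<^esub> h e x"
        using that by (simp add: h_def nat A.cornerI idem_smult_mem_peirce_space[OF M])
      also have "\<dots> = f \<odot>\<^bsub>N\<^esub> (a \<odot>\<^bsub>N\<^esub> h e x)"
        using that h_mem[of e x] by (simp add: N.smult_assoc1 mem_peirce_space)
      finally show ?thesis .
    qed
    have glue_h: "glue \<eta> = (\<lambda>x\<in>carrier M. \<Oplus>\<^bsub>N\<^esub>e\<in>E. h e x)" by (simp add: glue_def h_def)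
    show "glue \<eta> \<in> linear_maps A M N"
      unfolding glue_h
    proof (rule linear_mapsI, goal_cases)
      case (3 x y)
      have "(\<Oplus>\<^bsub>N\<^esub>e\<in>E. h e (x \<oplus>\<^bsub>M\<^esub> y)) = (\<Oplus>\<^bsub>N\<^esub>e\<in>E. h e x \<oplus>\<^bsub>N\<^esub> h e y)"
        using 3 by (intro N.finsum_cong') (auto simp: h_add h_closed)
      then show ?case using 3 by (simp add: N.finsum_addf h_closed Pi_iff)
    next
      case (4 a x)
      have "h f (a \<odot>\<^bsub>M\<^esub> x) = (\<Oplus>\<^bsub>N\<^esub>e\<in>E. f \<odot>\<^bsub>N\<^esub> (a \<odot>\<^bsub>N\<^esub> h e x))" if f: "f \<in> E" for f
      proof -
        have "a \<odot>\<^bsub>M\<^esub> x = (\<Oplus>\<^bsub>M\<^esub>e\<in>E. a \<odot>\<^bsub>M\<^esub> (e \<odot>\<^bsub>M\<^esub> x))"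
          using 4 M.finsum_smult_r[of "\<lambda>e. e \<odot>\<^bsub>M\<^esub> x" E a] sum_peirce_components[OF M, of x]
          by (simp add: Pi_iff)
        then have "h f (a \<odot>\<^bsub>M\<^esub> x) = (\<Oplus>\<^bsub>N\<^esub>e\<in>E. h f (a \<odot>\<^bsub>M\<^esub> (e \<odot>\<^bsub>M\<^esub> x)))"
          using 4 f by (simp, intro additive_finsum M.abelian_group_axioms N.abelian_group_axioms)
            (auto simp: h_closed h_add)
        also have "\<dots> = (\<Oplus>\<^bsub>N\<^esub>e\<in>E. f \<odot>\<^bsub>N\<^esub> (a \<odot>\<^bsub>N\<^esub> h e x))"
          using 4 f by (intro N.finsum_cong') (auto simp: h_smult h_closed)
        finally show ?thesis .
      qed
      then have "(\<Oplus>\<^bsub>N\<^esub>f\<in>E. h f (a \<odot>\<^bsub>M\<^esub> x)) = (\<Oplus>\<^bsub>N\<^esub>f\<in>E. \<Oplus>\<^bsub>N\<^esub>e\<in>E. f \<odot>\<^bsub>N\<^esub> (a \<odot>\<^bsub>N\<^esub> h e x))"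
        using 4 by (intro N.finsum_cong') (auto simp: h_closed intro!: N.finsum_closed)
      also have "\<dots> = (\<Oplus>\<^bsub>N\<^esub>e\<in>E. \<Oplus>\<^bsub>N\<^esub>f\<in>E. f \<odot>\<^bsub>N\<^esub> (a \<odot>\<^bsub>N\<^esub> h e x))"
        using 4 by (intro N.finsum_swap finite_E) (auto simp: h_closed)
      also have "\<dots> = (\<Oplus>\<^bsub>N\<^esub>e\<in>E. a \<odot>\<^bsub>N\<^esub> h e x)"
        using 4 by (intro N.finsum_cong') (auto simp: h_closed sum_peirce_components[OF N])
      also have "\<dots> = a \<odot>\<^bsub>N\<^esub> (\<Oplus>\<^bsub>N\<^esub>e\<in>E. h e x)"
        using 4 by (simp add: N.finsum_smult_r h_closed Pi_iff)
      finally show ?case using 4 by simp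
    qed (auto simp: h_closed intro!: N.finsum_closed)
    show "Fmor peirce_functor M N (glue \<eta>) = \<eta>"
    proof (intro ext)
      fix e x
      show "Fmor peirce_functor M N (glue \<eta>) e x = \<eta> e x"
      proof (cases "e \<in> E \<and> x \<in> carrier (peirce_space M e)")
        case True
        then have ex: "e \<in> E" "x \<in> carrier M" "e \<odot>\<^bsub>M\<^esub> x = x" by (auto simp: mem_peirce_space)
        have "h f x = \<zero>\<^bsub>N\<^esub>" if f: "f \<in> E" "f \<noteq> e" for f
        proof -
          have "f \<odot>\<^bsub>M\<^esub> x = f \<odot>\<^bsub>M\<^esub> \<zero>\<^bsub>M\<^esub>"
            using smult_orthogonal[OF M, of e f x] True f by (simp add: M.smult_r_null)
          then have "h f x = h f \<zero>\<^bsub>M\<^esub>" by (simp add: h_def)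
          also have "\<dots> = \<zero>\<^bsub>N\<^esub>"
            using f by (intro additive_zero[of M N] M.abelian_group_axioms N.abelian_group_axioms)
              (auto simp: h_closed h_add)
          finally show ?thesis .
        qed
        then have "(\<Oplus>\<^bsub>N\<^esub>f\<in>E. h f x) = h e x"
          using ex by (intro N.finsum_only finite_E) (auto simp: h_closed)
        then show ?thesis using True ex by (simp add: glue_h h_def)
      next
        case False
        then show ?thesis
          using \<eta> linear_mapsD(2)[OF lin, of e x] by (auto simp: extensional_def)
      qed
    qed
  qed
  show ?thesis
    using glue glue_restrict restrict_glue peirce_functor_mor_closed[OF M N]
    by (intro bij_betw_byWitness[where f' = glue]) blast+
qed

section \<open>The module assembled from a functor\<close>

text \<open>
  The quasi-inverse of \<open>peirce\<close>: the product of the spaces \<open>F e\<close>, with \<open>a\<close> acting by the matrix with entries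
  \<open>F (f a e)\<close>. Its elements are functions on \<open>E\<close> and not yet elements of \<open>'m\<close>.
\<close>

definition total_space ::
    "('a, 'a, ('k, 'm) module, 'm \<Rightarrow> 'm) cat_functor \<Rightarrow> ('a, 'a \<Rightarrow> 'm) module" where
  "total_space F = (let P = (\<Pi>\<^sub>E e\<in>E. carrier (Fob F e)) in
    \<lparr>carrier = P, mult = undefined, one = undefined, zero = (\<lambda>e\<in>E. \<zero>\<^bsub>Fob F e\<^esub>),
     add = (\<lambda>p q. if p \<in> P \<and> q \<in> P then \<lambda>e\<in>E. p e \<oplus>\<^bsub>Fob F e\<^esub> q e else undefined),
     smult = (\<lambda>a p. if a \<in> carrier A \<and> p \<in> P
       then \<lambda>f\<in>E. \<Oplus>\<^bsub>Fob F f\<^esub>e\<in>E. Fmor F e f (f \<otimes>\<^bsub>A\<^esub> a \<otimes>\<^bsub>A\<^esub> e) (p e) else undefined)\<rparr>)"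

lemma carrier_total_space [simp]: "carrier (total_space F) = (\<Pi>\<^sub>E e\<in>E. carrier (Fob F e))"
  and zero_total_space [simp]: "\<zero>\<^bsub>total_space F\<^esub> = (\<lambda>e\<in>E. \<zero>\<^bsub>Fob F e\<^esub>)"
  by (simp_all add: total_space_def Let_def)

lemma add_total_space:
    "\<lbrakk>p \<in> carrier (total_space F); q \<in> carrier (total_space F)\<rbrakk>
      \<Longrightarrow> p \<oplus>\<^bsub>total_space F\<^esub> q = (\<lambda>e\<in>E. p e \<oplus>\<^bsub>Fob F e\<^esub> q e)"
  and smult_total_space:
    "\<lbrakk>a \<in> carrier A; p \<in> carrier (total_space F)\<rbrakk>
      \<Longrightarrow> a \<odot>\<^bsub>total_space F\<^esub> p
        = (\<lambda>f\<in>E. \<Oplus>\<^bsub>Fob F f\<^esub>e\<in>E. Fmor F e f (f \<otimes>\<^bsub>A\<^esub> a \<otimes>\<^bsub>A\<^esub> e) (p e))"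
  by (simp_all add: total_space_def Let_def)

lemma module_extensional_total_space: "module_extensional A (total_space F)"
  by (auto simp: module_extensional_def total_space_def Let_def)

lemma total_space_component: "\<lbrakk>p \<in> carrier (total_space F); e \<in> E\<rbrakk> \<Longrightarrow> p e \<in> carrier (Fob F e)"
  by auto

text \<open>
  The inclusion of a component, written in terms of the module \<open>T\<close> alone, so that the components of \<open>F\<close> can
  be reconstructed from \<open>total_space F\<close>.
\<close>

definition single :: "('a, 'a \<Rightarrow> 'm) module \<Rightarrow> 'a \<Rightarrow> 'm \<Rightarrow> 'a \<Rightarrow> 'm" where
  "single T e x = (\<zero>\<^bsub>T\<^esub>)(e := x)"

context
  fixes F :: "('a, 'a, ('k, 'm) module, 'm \<Rightarrow> 'm) cat_functor"
  assumes F: "F \<in> Obj Reps"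
begin

text \<open>
  The matrix entry of \<open>a\<close> in position \<open>(f, e)\<close> is written \<open>f \<otimes> a \<otimes> e\<close>, which is defined and additive for
  all \<open>a\<close> in \<open>A\<close>.
\<close>

lemma block_closed: "\<lbrakk>e \<in> E; f \<in> E; a \<in> carrier A; x \<in> carrier (Fob F e)\<rbrakk>
    \<Longrightarrow> Fmor F e f (f \<otimes>\<^bsub>A\<^esub> a \<otimes>\<^bsub>A\<^esub> e) x \<in> carrier (Fob F f)"
  by (rule Fmor_apply_closed[OF F]) (auto intro: A.cornerI)

lemma block_add: "\<lbrakk>e \<in> E; f \<in> E; a \<in> carrier A; b \<in> carrier A; x \<in> carrier (Fob F e)\<rbrakk>
    \<Longrightarrow> Fmor F e f (f \<otimes>\<^bsub>A\<^esub> (a \<oplus>\<^bsub>A\<^esub> b) \<otimes>\<^bsub>A\<^esub> e) x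
      = Fmor F e f (f \<otimes>\<^bsub>A\<^esub> a \<otimes>\<^bsub>A\<^esub> e) x \<oplus>\<^bsub>Fob F f\<^esub> Fmor F e f (f \<otimes>\<^bsub>A\<^esub> b \<otimes>\<^bsub>A\<^esub> e) x"
  by (simp add: A.l_distr A.r_distr Fmor_add_apply[OF F] A.cornerI)

lemma block_comp:
  assumes "e \<in> E" "f \<in> E" "g \<in> E" "a \<in> carrier A" "b \<in> carrier A" "x \<in> carrier (Fob F e)"
  shows "Fmor F f g (g \<otimes>\<^bsub>A\<^esub> a \<otimes>\<^bsub>A\<^esub> f) (Fmor F e f (f \<otimes>\<^bsub>A\<^esub> b \<otimes>\<^bsub>A\<^esub> e) x)
    = Fmor F e g (g \<otimes>\<^bsub>A\<^esub> (a \<otimes>\<^bsub>A\<^esub> f \<otimes>\<^bsub>A\<^esub> b) \<otimes>\<^bsub>A\<^esub> e) x"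
proof -
  have "f \<otimes>\<^bsub>A\<^esub> (f \<otimes>\<^bsub>A\<^esub> (b \<otimes>\<^bsub>A\<^esub> e)) = f \<otimes>\<^bsub>A\<^esub> (b \<otimes>\<^bsub>A\<^esub> e)"
    using assms by (simp add: A.m_assoc[symmetric])
  then have "(g \<otimes>\<^bsub>A\<^esub> a \<otimes>\<^bsub>A\<^esub> f) \<otimes>\<^bsub>A\<^esub> (f \<otimes>\<^bsub>A\<^esub> b \<otimes>\<^bsub>A\<^esub> e) = g \<otimes>\<^bsub>A\<^esub> (a \<otimes>\<^bsub>A\<^esub> f \<otimes>\<^bsub>A\<^esub> b) \<otimes>\<^bsub>A\<^esub> e"
    using assms by (simp add: A.m_assoc)
  then show ?thesis
    using assms Fmor_apply_mult[OF F, of e f g "f \<otimes>\<^bsub>A\<^esub> b \<otimes>\<^bsub>A\<^esub> e" "g \<otimes>\<^bsub>A\<^esub> a \<otimes>\<^bsub>A\<^esub> f" x]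
    by (simp add: A.cornerI)
qed

text \<open>
  The entries of a product are given by matrix multiplication, since \<open>\<Sum>f\<in>E. a f b = a b\<close>.
\<close>

lemma block_sum:
  assumes "e \<in> E" "g \<in> E" "a \<in> carrier A" "b \<in> carrier A" "x \<in> carrier (Fob F e)"
  shows "(\<Oplus>\<^bsub>Fob F g\<^esub>f\<in>E. Fmor F e g (g \<otimes>\<^bsub>A\<^esub> (a \<otimes>\<^bsub>A\<^esub> f \<otimes>\<^bsub>A\<^esub> b) \<otimes>\<^bsub>A\<^esub> e) x)
    = Fmor F e g (g \<otimes>\<^bsub>A\<^esub> (a \<otimes>\<^bsub>A\<^esub> b) \<otimes>\<^bsub>A\<^esub> e) x"
proof -
  have "a \<otimes>\<^bsub>A\<^esub> b = a \<otimes>\<^bsub>A\<^esub> (\<Oplus>\<^bsub>A\<^esub>f\<in>E. f) \<otimes>\<^bsub>A\<^esub> b" using assms by (simp add: sum_E)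
  also have "\<dots> = (\<Oplus>\<^bsub>A\<^esub>f\<in>E. a \<otimes>\<^bsub>A\<^esub> f \<otimes>\<^bsub>A\<^esub> b)"
    using assms by (simp add: A.finsum_ldistr A.finsum_rdistr finite_E Pi_iff)
  finally have ab: "a \<otimes>\<^bsub>A\<^esub> b = (\<Oplus>\<^bsub>A\<^esub>f\<in>E. a \<otimes>\<^bsub>A\<^esub> f \<otimes>\<^bsub>A\<^esub> b)" .
  show ?thesis
    unfolding ab using assms
    by (intro additive_finsum[of A "Fob F g" "\<lambda>a. Fmor F e g (g \<otimes>\<^bsub>A\<^esub> a \<otimes>\<^bsub>A\<^esub> e) x", symmetric]
        A.abelian_group_axioms Fob_abelian_group[OF F])
      (auto simp: block_closed block_add)
qed

lemma Fmor_zero_apply: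
  assumes "e \<in> E" "f \<in> E" "x \<in> carrier (Fob F e)"
  shows "Fmor F e f \<zero>\<^bsub>A\<^esub> x = \<zero>\<^bsub>Fob F f\<^esub>"
  using additive_zero[of A "Fob F f" "\<lambda>a. Fmor F e f (f \<otimes>\<^bsub>A\<^esub> a \<otimes>\<^bsub>A\<^esub> e) x",
      OF A.abelian_group_axioms Fob_abelian_group[OF F]] assms
  by (simp add: block_closed block_add)

lemma zero_mem_Fob: "e \<in> E \<Longrightarrow> \<zero>\<^bsub>Fob F e\<^esub> \<in> carrier (Fob F e)"
  using Fob_abelian_group[OF F] by (simp add: abelian_group_def abelian_monoid.zero_closed)

lemma single_mem: "\<lbrakk>e \<in> E; x \<in> carrier (Fob F e)\<rbrakk> \<Longrightarrow> single (total_space F) e x \<in> carrier (total_space F)"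
  using zero_mem_Fob by (auto simp: single_def PiE_iff extensional_def)

lemma single_apply: "single (total_space F) e x e = x"
  by (simp add: single_def)

text \<open>
  The matrix of an element of \<open>gAe\<close> vanishes outside the position \<open>(g, e)\<close>, by orthogonality.
\<close>

lemma corner_smult_total_space:
  assumes e: "e \<in> E" and g: "g \<in> E" and a: "a \<in> corner A e g" and p: "p \<in> carrier (total_space F)"
  shows "a \<odot>\<^bsub>total_space F\<^esub> p = single (total_space F) g (Fmor F e g a (p e))"
proof
  fix f
  have ac: "a \<in> carrier A" "g \<otimes>\<^bsub>A\<^esub> a = a" "a \<otimes>\<^bsub>A\<^esub> e = a" using a e g by (simp_all add: mem_corner)
  note pc = total_space_component[OF p]
  show "(a \<odot>\<^bsub>total_space F\<^esub> p) f = single (total_space F) g (Fmor F e g a (p e)) f"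
  proof (cases "f \<in> E")
    case f: True
    interpret Ff: abelian_group "Fob F f" by (rule Fob_abelian_group[OF F f])
    have off: "Fmor F e' f (f \<otimes>\<^bsub>A\<^esub> a \<otimes>\<^bsub>A\<^esub> e') (p e') = \<zero>\<^bsub>Fob F f\<^esub>" if "e' \<in> E" "e' \<noteq> e" for e'
    proof -
      have "f \<otimes>\<^bsub>A\<^esub> a \<otimes>\<^bsub>A\<^esub> e' = f \<otimes>\<^bsub>A\<^esub> ((a \<otimes>\<^bsub>A\<^esub> e) \<otimes>\<^bsub>A\<^esub> e')" using that f ac(1,3) by (simp add: A.m_assoc)
      also have "\<dots> = \<zero>\<^bsub>A\<^esub>" using that f e ac(1) by (simp add: A.m_assoc orthogonal)
      finally show ?thesis using that f pc by (simp add: Fmor_zero_apply)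
    qed
    have "(a \<odot>\<^bsub>total_space F\<^esub> p) f = (\<Oplus>\<^bsub>Fob F f\<^esub>e'\<in>E. Fmor F e' f (f \<otimes>\<^bsub>A\<^esub> a \<otimes>\<^bsub>A\<^esub> e') (p e'))"
      using f ac p by (simp add: smult_total_space)
    also have "\<dots> = Fmor F e f (f \<otimes>\<^bsub>A\<^esub> a \<otimes>\<^bsub>A\<^esub> e) (p e)"
      by (rule Ff.finsum_only[OF finite_E e]) (simp_all add: off block_closed e f ac pc)
    also have "\<dots> = Fmor F e f (f \<otimes>\<^bsub>A\<^esub> a) (p e)" using f e ac by (simp add: A.m_assoc)
    also have "\<dots> = single (total_space F) g (Fmor F e g a (p e)) f"
    proof (cases "f = g")
      case True
      then show ?thesis using ac by (simp add: single_def)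
    next
      case False
      have "f \<otimes>\<^bsub>A\<^esub> a = (f \<otimes>\<^bsub>A\<^esub> g) \<otimes>\<^bsub>A\<^esub> a" using f g ac by (simp add: A.m_assoc)
      also have "\<dots> = \<zero>\<^bsub>A\<^esub>" using f g ac(1) False by (simp add: orthogonal)
      finally show ?thesis using False f e pc by (simp add: Fmor_zero_apply single_def)
    qed
    finally show ?thesis .
  qed (use g ac p in \<open>auto simp: smult_total_space single_def\<close>)
qed

lemma abelian_group_total_space: "abelian_group (total_space F)"
proof (rule abelian_groupI)
  note ag = Fob_abelian_group[OF F]
  note am = abelian_group.axioms(1)[OF ag]
  have cl: "x \<oplus>\<^bsub>Fob F e\<^esub> y \<in> carrier (Fob F e)"
    if "e \<in> E" "x \<in> carrier (Fob F e)" "y \<in> carrier (Fob F e)" for e x y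
    using abelian_monoid.a_closed[OF am] that by blast
  show add_closed: "p \<oplus>\<^bsub>total_space F\<^esub> q \<in> carrier (total_space F)"
    if "p \<in> carrier (total_space F)" "q \<in> carrier (total_space F)" for p q
    using that by (simp add: add_total_space) (auto intro!: cl)
  show "\<zero>\<^bsub>total_space F\<^esub> \<in> carrier (total_space F)" using zero_mem_Fob by simp
  show "(p \<oplus>\<^bsub>total_space F\<^esub> q) \<oplus>\<^bsub>total_space F\<^esub> r = p \<oplus>\<^bsub>total_space F\<^esub> (q \<oplus>\<^bsub>total_space F\<^esub> r)"
    if "p \<in> carrier (total_space F)" "q \<in> carrier (total_space F)" "r \<in> carrier (total_space F)" for p q r
    using that add_closed[OF that(1,2)] add_closed[OF that(2,3)]
      total_space_component[OF that(1)] total_space_component[OF that(2)] total_space_component[OF that(3)]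
    by (simp add: add_total_space abelian_monoid.a_assoc[OF am] cong: restrict_cong)
  show "p \<oplus>\<^bsub>total_space F\<^esub> q = q \<oplus>\<^bsub>total_space F\<^esub> p"
    if "p \<in> carrier (total_space F)" "q \<in> carrier (total_space F)" for p q
    using that total_space_component[OF that(1)] total_space_component[OF that(2)]
    by (simp add: add_total_space abelian_monoid.a_comm[OF am] cong: restrict_cong)
  show "\<zero>\<^bsub>total_space F\<^esub> \<oplus>\<^bsub>total_space F\<^esub> p = p" if "p \<in> carrier (total_space F)" for p
  proof
    fix e
    show "(\<zero>\<^bsub>total_space F\<^esub> \<oplus>\<^bsub>total_space F\<^esub> p) e = p e"
      using that zero_mem_Fob total_space_component[OF that, of e] abelian_monoid.l_zero[OF am, of e]
      by (cases "e \<in> E") (auto simp: add_total_space)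
  qed
  show "\<exists>q\<in>carrier (total_space F). q \<oplus>\<^bsub>total_space F\<^esub> p = \<zero>\<^bsub>total_space F\<^esub>"
    if p: "p \<in> carrier (total_space F)" for p
  proof
    show q: "(\<lambda>e\<in>E. \<ominus>\<^bsub>Fob F e\<^esub> p e) \<in> carrier (total_space F)"
      using p abelian_group.a_inv_closed[OF ag] by auto
    show "(\<lambda>e\<in>E. \<ominus>\<^bsub>Fob F e\<^esub> p e) \<oplus>\<^bsub>total_space F\<^esub> p = \<zero>\<^bsub>total_space F\<^esub>"
      using total_space_component[OF p] abelian_group.l_neg[OF ag]
      by (simp add: add_total_space[OF q p] cong: restrict_cong)
  qed
qed

theorem left_module_total_space: "left_module A (total_space F)"
proof (rule left_moduleI[OF A.ring_axioms abelian_group_total_space])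
  note ag = Fob_abelian_group[OF F]
  note am = abelian_group.axioms(1)[OF ag]
  interpret T: abelian_group "total_space F" by (rule abelian_group_total_space)
  note comp = total_space_component
  show smult_closed: "a \<odot>\<^bsub>total_space F\<^esub> p \<in> carrier (total_space F)"
    if "a \<in> carrier A" "p \<in> carrier (total_space F)" for a p
    using that comp[OF that(2)]
    by (simp add: smult_total_space) (auto intro!: abelian_monoid.finsum_closed[OF am] block_closed)
  fix a p assume a: "a \<in> carrier A" and p: "p \<in> carrier (total_space F)"
  show "(a \<oplus>\<^bsub>A\<^esub> b) \<odot>\<^bsub>total_space F\<^esub> p
      = a \<odot>\<^bsub>total_space F\<^esub> p \<oplus>\<^bsub>total_space F\<^esub> b \<odot>\<^bsub>total_space F\<^esub> p" if b: "b \<in> carrier A" for b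
  proof -
    have "(\<Oplus>\<^bsub>Fob F f\<^esub>e\<in>E. Fmor F e f (f \<otimes>\<^bsub>A\<^esub> (a \<oplus>\<^bsub>A\<^esub> b) \<otimes>\<^bsub>A\<^esub> e) (p e))
      = (\<Oplus>\<^bsub>Fob F f\<^esub>e\<in>E. Fmor F e f (f \<otimes>\<^bsub>A\<^esub> a \<otimes>\<^bsub>A\<^esub> e) (p e))
        \<oplus>\<^bsub>Fob F f\<^esub> (\<Oplus>\<^bsub>Fob F f\<^esub>e\<in>E. Fmor F e f (f \<otimes>\<^bsub>A\<^esub> b \<otimes>\<^bsub>A\<^esub> e) (p e))" if f: "f \<in> E" for f
    proof -
      interpret Ff: abelian_group "Fob F f" by (rule ag[OF f])
      have "(\<Oplus>\<^bsub>Fob F f\<^esub>e\<in>E. Fmor F e f (f \<otimes>\<^bsub>A\<^esub> (a \<oplus>\<^bsub>A\<^esub> b) \<otimes>\<^bsub>A\<^esub> e) (p e))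
        = (\<Oplus>\<^bsub>Fob F f\<^esub>e\<in>E. Fmor F e f (f \<otimes>\<^bsub>A\<^esub> a \<otimes>\<^bsub>A\<^esub> e) (p e)
            \<oplus>\<^bsub>Fob F f\<^esub> Fmor F e f (f \<otimes>\<^bsub>A\<^esub> b \<otimes>\<^bsub>A\<^esub> e) (p e))"
        using a b f comp[OF p] by (intro Ff.finsum_cong') (simp_all add: block_add block_closed Pi_iff)
      then show ?thesis using a b f comp[OF p] by (simp add: Ff.finsum_addf block_closed Pi_iff)
    qed
    then show ?thesis
      using a b p unfolding add_total_space[OF smult_closed[OF a p] smult_closed[OF b p]]
      by (simp add: smult_total_space cong: restrict_cong)
  qed
  show "a \<odot>\<^bsub>total_space F\<^esub> (p \<oplus>\<^bsub>total_space F\<^esub> q)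
      = a \<odot>\<^bsub>total_space F\<^esub> p \<oplus>\<^bsub>total_space F\<^esub> a \<odot>\<^bsub>total_space F\<^esub> q" if q: "q \<in> carrier (total_space F)" for q
  proof -
    have "(\<Oplus>\<^bsub>Fob F f\<^esub>e\<in>E. Fmor F e f (f \<otimes>\<^bsub>A\<^esub> a \<otimes>\<^bsub>A\<^esub> e) ((p \<oplus>\<^bsub>total_space F\<^esub> q) e))
      = (\<Oplus>\<^bsub>Fob F f\<^esub>e\<in>E. Fmor F e f (f \<otimes>\<^bsub>A\<^esub> a \<otimes>\<^bsub>A\<^esub> e) (p e))
        \<oplus>\<^bsub>Fob F f\<^esub> (\<Oplus>\<^bsub>Fob F f\<^esub>e\<in>E. Fmor F e f (f \<otimes>\<^bsub>A\<^esub> a \<otimes>\<^bsub>A\<^esub> e) (q e))" if f: "f \<in> E" for f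
    proof -
      interpret Ff: abelian_group "Fob F f" by (rule ag[OF f])
      have "(\<Oplus>\<^bsub>Fob F f\<^esub>e\<in>E. Fmor F e f (f \<otimes>\<^bsub>A\<^esub> a \<otimes>\<^bsub>A\<^esub> e) ((p \<oplus>\<^bsub>total_space F\<^esub> q) e))
        = (\<Oplus>\<^bsub>Fob F f\<^esub>e\<in>E. Fmor F e f (f \<otimes>\<^bsub>A\<^esub> a \<otimes>\<^bsub>A\<^esub> e) (p e)
            \<oplus>\<^bsub>Fob F f\<^esub> Fmor F e f (f \<otimes>\<^bsub>A\<^esub> a \<otimes>\<^bsub>A\<^esub> e) (q e))"
        using a f comp[OF p] comp[OF q]
        by (intro Ff.finsum_cong')
          (simp_all add: add_total_space[OF p q] Fmor_apply_add[OF F] A.cornerI block_closed Pi_iff)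
      then show ?thesis using a f comp[OF p] comp[OF q] by (simp add: Ff.finsum_addf block_closed Pi_iff)
    qed
    then show ?thesis
      unfolding add_total_space[OF smult_closed[OF a p] smult_closed[OF a q]]
        smult_total_space[OF a T.a_closed[OF p q]]
      by (simp add: smult_total_space[OF a p] smult_total_space[OF a q] cong: restrict_cong)
  qed
  show "(b \<otimes>\<^bsub>A\<^esub> a) \<odot>\<^bsub>total_space F\<^esub> p = b \<odot>\<^bsub>total_space F\<^esub> (a \<odot>\<^bsub>total_space F\<^esub> p)"
    if b: "b \<in> carrier A" for b
  proof -
    have "(\<Oplus>\<^bsub>Fob F g\<^esub>f\<in>E. Fmor F f g (g \<otimes>\<^bsub>A\<^esub> b \<otimes>\<^bsub>A\<^esub> f) ((a \<odot>\<^bsub>total_space F\<^esub> p) f))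
      = (\<Oplus>\<^bsub>Fob F g\<^esub>e\<in>E. Fmor F e g (g \<otimes>\<^bsub>A\<^esub> (b \<otimes>\<^bsub>A\<^esub> a) \<otimes>\<^bsub>A\<^esub> e) (p e))" if g: "g \<in> E" for g
    proof -
      interpret Fg: abelian_group "Fob F g" by (rule ag[OF g])
      (* The entry at (g, e) of b a, split as a sum over the intermediate index f. *)
      let ?t = "\<lambda>f e. Fmor F e g (g \<otimes>\<^bsub>A\<^esub> (b \<otimes>\<^bsub>A\<^esub> f \<otimes>\<^bsub>A\<^esub> a) \<otimes>\<^bsub>A\<^esub> e) (p e)"
      have t: "?t f e \<in> carrier (Fob F g)" if "f \<in> E" "e \<in> E" for f e
        using that a b g comp[OF p] by (simp add: block_closed)
      have "Fmor F f g (g \<otimes>\<^bsub>A\<^esub> b \<otimes>\<^bsub>A\<^esub> f) ((a \<odot>\<^bsub>total_space F\<^esub> p) f) = (\<Oplus>\<^bsub>Fob F g\<^esub>e\<in>E. ?t f e)"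
        if f: "f \<in> E" for f
      proof -
        have "Fmor F f g (g \<otimes>\<^bsub>A\<^esub> b \<otimes>\<^bsub>A\<^esub> f) ((a \<odot>\<^bsub>total_space F\<^esub> p) f)
          = (\<Oplus>\<^bsub>Fob F g\<^esub>e\<in>E. Fmor F f g (g \<otimes>\<^bsub>A\<^esub> b \<otimes>\<^bsub>A\<^esub> f) (Fmor F e f (f \<otimes>\<^bsub>A\<^esub> a \<otimes>\<^bsub>A\<^esub> e) (p e)))"
          using a b f g comp[OF p]
          by (simp add: smult_total_space[OF a p], intro additive_finsum[OF ag ag])
            (simp_all add: block_closed Fmor_apply_add[OF F] A.cornerI Pi_iff)
        also have "\<dots> = (\<Oplus>\<^bsub>Fob F g\<^esub>e\<in>E. ?t f e)"
          using a b f g comp[OF p] t by (intro Fg.finsum_cong') (simp_all add: block_comp Pi_iff)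
        finally show ?thesis .
      qed
      then have "(\<Oplus>\<^bsub>Fob F g\<^esub>f\<in>E. Fmor F f g (g \<otimes>\<^bsub>A\<^esub> b \<otimes>\<^bsub>A\<^esub> f) ((a \<odot>\<^bsub>total_space F\<^esub> p) f))
        = (\<Oplus>\<^bsub>Fob F g\<^esub>f\<in>E. \<Oplus>\<^bsub>Fob F g\<^esub>e\<in>E. ?t f e)"
        using t by (intro Fg.finsum_cong') (auto intro!: Fg.finsum_closed)
      also have "\<dots> = (\<Oplus>\<^bsub>Fob F g\<^esub>e\<in>E. \<Oplus>\<^bsub>Fob F g\<^esub>f\<in>E. ?t f e)"
        using t by (intro Fg.finsum_swap finite_E)
      also have "\<dots> = (\<Oplus>\<^bsub>Fob F g\<^esub>e\<in>E. Fmor F e g (g \<otimes>\<^bsub>A\<^esub> (b \<otimes>\<^bsub>A\<^esub> a) \<otimes>\<^bsub>A\<^esub> e) (p e))"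
        using a b g comp[OF p]
        by (intro Fg.finsum_cong') (simp_all add: block_sum block_closed Pi_iff)
      finally show ?thesis .
    qed
    then show ?thesis
      using a b p smult_total_space[OF _ smult_closed[OF a p], of b]
      by (simp add: smult_total_space[OF _ p] cong: restrict_cong)
  qed
next
  fix p assume p: "p \<in> carrier (total_space F)"
  note ag = Fob_abelian_group[OF F] and comp = total_space_component
  show "\<one>\<^bsub>A\<^esub> \<odot>\<^bsub>total_space F\<^esub> p = p"
  proof
    fix f
    show "(\<one>\<^bsub>A\<^esub> \<odot>\<^bsub>total_space F\<^esub> p) f = p f"
    proof (cases "f \<in> E")
      case f: True
      interpret Ff: abelian_group "Fob F f" by (rule ag[OF f])
      have "(\<Oplus>\<^bsub>Fob F f\<^esub>e\<in>E. Fmor F e f (f \<otimes>\<^bsub>A\<^esub> \<one>\<^bsub>A\<^esub> \<otimes>\<^bsub>A\<^esub> e) (p e)) = Fmor F f f (f \<otimes>\<^bsub>A\<^esub> \<one>\<^bsub>A\<^esub> \<otimes>\<^bsub>A\<^esub> f) (p f)"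
      proof (rule Ff.finsum_only[OF finite_E f, where f = "\<lambda>e. Fmor F e f (f \<otimes>\<^bsub>A\<^esub> \<one>\<^bsub>A\<^esub> \<otimes>\<^bsub>A\<^esub> e) (p e)"])
        show "Fmor F f f (f \<otimes>\<^bsub>A\<^esub> \<one>\<^bsub>A\<^esub> \<otimes>\<^bsub>A\<^esub> f) (p f) \<in> carrier (Fob F f)"
          using f comp[OF p f] by (intro block_closed) auto
        show "Fmor F e f (f \<otimes>\<^bsub>A\<^esub> \<one>\<^bsub>A\<^esub> \<otimes>\<^bsub>A\<^esub> e) (p e) = \<zero>\<^bsub>Fob F f\<^esub>" if "e \<in> E" "e \<noteq> f" for e
          using f that comp[OF p, of e] by (simp add: orthogonal Fmor_zero_apply)
      qed
      then show ?thesis using f p comp[OF p] by (simp add: smult_total_space Fmor_apply_ide[OF F])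
    qed (use p in \<open>auto simp: smult_total_space\<close>)
  qed
qed

text \<open>
  The right-hand sides depend on \<open>F\<close> only through \<open>total_space F\<close>. Scalars are recovered from the
  action of \<open>A\<close>: \<open>c\<close> acts on \<open>F e\<close> as \<open>F (c e)\<close>, by linearity of \<open>F\<close>.
\<close>

lemma total_space_determines:
  assumes e: "e \<in> E"
  shows "carrier (Fob F e) = (\<lambda>p. p e) ` carrier (total_space F)"
    and "\<zero>\<^bsub>Fob F e\<^esub> = \<zero>\<^bsub>total_space F\<^esub> e"
    and "\<lbrakk>x \<in> carrier (Fob F e); y \<in> carrier (Fob F e)\<rbrakk> \<Longrightarrow> x \<oplus>\<^bsub>Fob F e\<^esub> y
      = (single (total_space F) e x \<oplus>\<^bsub>total_space F\<^esub> single (total_space F) e y) e"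
    and "\<lbrakk>f \<in> E; a \<in> corner A e f; x \<in> carrier (Fob F e)\<rbrakk> \<Longrightarrow> Fmor F e f a x
      = (a \<odot>\<^bsub>total_space F\<^esub> single (total_space F) e x) f"
    and "\<lbrakk>c \<in> carrier K; x \<in> carrier (Fob F e)\<rbrakk> \<Longrightarrow> c \<odot>\<^bsub>Fob F e\<^esub> x
      = ((c \<odot>\<^bsub>A\<^esub> e) \<odot>\<^bsub>total_space F\<^esub> single (total_space F) e x) e"
proof -
  show "carrier (Fob F e) = (\<lambda>p. p e) ` carrier (total_space F)"
  proof
    show "carrier (Fob F e) \<subseteq> (\<lambda>p. p e) ` carrier (total_space F)"
    proof
      fix x assume "x \<in> carrier (Fob F e)"
      then show "x \<in> (\<lambda>p. p e) ` carrier (total_space F)"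
        using single_mem[OF e] by (intro image_eqI[of _ _ "single (total_space F) e x"]) (simp_all add: single_apply)
    qed
  qed (use e in auto)
  show "\<zero>\<^bsub>Fob F e\<^esub> = \<zero>\<^bsub>total_space F\<^esub> e" using e by simp
  show "x \<oplus>\<^bsub>Fob F e\<^esub> y = (single (total_space F) e x \<oplus>\<^bsub>total_space F\<^esub> single (total_space F) e y) e"
    if "x \<in> carrier (Fob F e)" "y \<in> carrier (Fob F e)"
    using that e by (simp add: add_total_space single_mem del: carrier_total_space) (simp add: single_apply)
  show Fm: "Fmor F e f a x = (a \<odot>\<^bsub>total_space F\<^esub> single (total_space F) e x) f"
    if "f \<in> E" "a \<in> corner A e f" "x \<in> carrier (Fob F e)" for f a x
    using that e single_mem by (simp add: corner_smult_total_space single_apply del: carrier_total_space)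
  show "c \<odot>\<^bsub>Fob F e\<^esub> x = ((c \<odot>\<^bsub>A\<^esub> e) \<odot>\<^bsub>total_space F\<^esub> single (total_space F) e x) e"
    if "c \<in> carrier K" "x \<in> carrier (Fob F e)"
    using that e Fm[of e "c \<odot>\<^bsub>A\<^esub> e" x] Fmor_smult_apply[OF F, of e e c e x]
    by (simp add: smult_mem_corner idem_mem_corner Fmor_apply_ide[OF F])
qed

text \<open>
  The isomorphism is the inclusion of the components; its image is the part fixed by \<open>e\<close> because
  \<open>e\<close> acts on tuples as the projection to the component at \<open>e\<close>.
\<close>

theorem isomorphic_objects_peirce_transport:
  assumes inj: "inj_on i (carrier (total_space F))"
  shows "isomorphic_objects Reps F (peirce (transport A (total_space F) i))"
proof -
  let ?T = "total_space F" and ?N = "transport A (total_space F) i"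
  have N: "left_module A ?N" by (rule left_module_transport[OF left_module_total_space inj])
  interpret T: left_module A ?T by (rule left_module_total_space)
  note act = smult_transport[where i = i, OF inj] and plus = add_transport[where i = i, OF inj]
  note [simp del] = carrier_total_space
  define \<eta> where "\<eta> = (\<lambda>e\<in>E. \<lambda>x\<in>carrier (Fob F e). i (single ?T e x))"
  have mem: "i (single ?T e x) \<in> carrier (peirce_space ?N e)" if "e \<in> E" "x \<in> carrier (Fob F e)" for e x
    using that corner_smult_total_space[of e e e "single ?T e x"]
    by (simp add: mem_peirce_space act single_mem idem_mem_corner single_apply Fmor_apply_ide[OF F])
  have P: "peirce ?N \<in> Obj Reps" by (rule peirce_mem_Reps[OF N])
  show ?thesis
  proof (rule isomorphic_objects_RepsI[OF F P])
    show "\<eta> \<in> Mor Reps F (peirce ?N)"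
      unfolding Mor_Reps_iff[OF F P]
    proof (intro conjI ballI)
      show "\<eta> \<in> extensional E" by (simp add: \<eta>_def)
      fix e assume e: "e \<in> E"
      interpret Fe: left_module K "Fob F e" by (rule Fob_left_module[OF F e])
      show "\<eta> e \<in> linear_maps K (Fob F e) (Fob (peirce ?N) e)"
      proof (rule linear_mapsI, goal_cases)
        case (3 x y)
        have "single ?T e (x \<oplus>\<^bsub>Fob F e\<^esub> y) = single ?T e x \<oplus>\<^bsub>?T\<^esub> single ?T e y"
          unfolding add_total_space[OF single_mem[OF e 3(1)] single_mem[OF e 3(2)]]
          using e zero_mem_Fob Fob_abelian_group[OF F]
          by (auto simp: fun_eq_iff single_def abelian_monoid.l_zero[OF abelian_group.axioms(1)])
        then show ?case using 3 e mem by (simp add: \<eta>_def plus single_mem)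
      next
        case (4 c x)
        let ?s = "single ?T e x"
        have s: "?s \<in> carrier ?T" using 4 e by (simp add: single_mem)
        have es: "e \<odot>\<^bsub>?T\<^esub> ?s = ?s"
          using corner_smult_total_space[of e e e ?s] e s 4 by (simp add: idem_mem_corner single_apply Fmor_apply_ide[OF F])
        have "(c \<odot>\<^bsub>A\<^esub> \<one>\<^bsub>A\<^esub>) \<odot>\<^bsub>?T\<^esub> (e \<odot>\<^bsub>?T\<^esub> ?s) = (c \<odot>\<^bsub>A\<^esub> e) \<odot>\<^bsub>?T\<^esub> ?s"
          using 4 e s by (intro scalar_smult left_module_total_space) auto
        also have "\<dots> = single ?T e (Fmor F e e (c \<odot>\<^bsub>A\<^esub> e) x)"
          using corner_smult_total_space[of e e "c \<odot>\<^bsub>A\<^esub> e" ?s] e s 4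
          by (simp add: idem_mem_corner smult_mem_corner single_apply)
        also have "\<dots> = single ?T e (c \<odot>\<^bsub>Fob F e\<^esub> x)"
          using e 4 by (simp add: Fmor_smult_apply[OF F] idem_mem_corner Fmor_apply_ide[OF F])
        finally have "(c \<odot>\<^bsub>A\<^esub> \<one>\<^bsub>A\<^esub>) \<odot>\<^bsub>?T\<^esub> ?s = single ?T e (c \<odot>\<^bsub>Fob F e\<^esub> x)" by (simp add: es)
        then show ?case using 4 e s mem by (simp add: \<eta>_def act Fe.smult_closed)
      qed (use e mem in \<open>auto simp: \<eta>_def\<close>)
    next
      fix e f a x assume ef: "e \<in> E" "f \<in> E" and a: "a \<in> corner A e f" and x: "x \<in> carrier (Fob F e)"
      then have "single ?T f (Fmor F e f a x) = a \<odot>\<^bsub>?T\<^esub> single ?T e x"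
        using corner_smult_total_space[of e f a "single ?T e x"] by (simp add: single_mem single_apply)
      then show "\<eta> f (Fmor F e f a x) = Fmor (peirce ?N) e f a (\<eta> e x)"
        using ef a x mem by (simp add: \<eta>_def Fmor_apply_closed[OF F] act corner_closed single_mem)
    qed
    show "bij_betw (\<eta> e) (carrier (Fob F e)) (carrier (Fob (peirce ?N) e))" if e: "e \<in> E" for e
    proof (rule bij_betw_imageI)
      show "inj_on (\<eta> e) (carrier (Fob F e))"
      proof (rule inj_onI)
        fix x y assume xy: "x \<in> carrier (Fob F e)" "y \<in> carrier (Fob F e)" "\<eta> e x = \<eta> e y"
        then have "single ?T e x = single ?T e y"
          using e by (intro inj_onD[OF inj]) (auto simp: \<eta>_def single_mem)
        then show "x = y" using single_apply by metis
      qed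
      show "\<eta> e ` carrier (Fob F e) = carrier (Fob (peirce ?N) e)"
      proof
        show "\<eta> e ` carrier (Fob F e) \<subseteq> carrier (Fob (peirce ?N) e)"
          using e mem by (auto simp: \<eta>_def)
        show "carrier (Fob (peirce ?N) e) \<subseteq> \<eta> e ` carrier (Fob F e)"
        proof
          fix y assume "y \<in> carrier (Fob (peirce ?N) e)"
          then obtain p where p: "p \<in> carrier ?T" "y = i p" "e \<odot>\<^bsub>?N\<^esub> y = y"
            using e by (auto simp: mem_peirce_space)
          have "p e \<in> carrier (Fob F e)" using p e total_space_component by blast
          moreover have "y = i (single ?T e (p e))"
            using p e corner_smult_total_space[of e e e p] calculation
            by (simp add: act idem_mem_corner Fmor_apply_ide[OF F])
          ultimately show "y \<in> \<eta> e ` carrier (Fob F e)" using e by (auto simp: \<eta>_def)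
        qed
      qed
    qed
  qed
qed

end

lemma total_space_inject:
  assumes F: "F \<in> Obj Reps" and G: "G \<in> Obj Reps" and eq: "total_space F = total_space G"
  shows "F = G"
proof -
  note dF = total_space_determines[OF F, unfolded eq] and dG = total_space_determines[OF G]
  have car: "carrier (Fob F e) = carrier (Fob G e)" if "e \<in> E" for e
    using dF(1)[OF that] dG(1)[OF that] by simp
  show ?thesis
  proof (rule Reps_eqI[OF F G])
    show "Fob F e = Fob G e" if e: "e \<in> E" for e
      by (rule module_extensional_eqI[OF Fob_extensional[OF F e] Fob_extensional[OF G e] car[OF e]])
        (simp_all add: car[OF e] dF(2-5)[OF e] dG(2-5)[OF e] del: zero_total_space)
    show "Fmor F e f a x = Fmor G e f a x"
      if "e \<in> E" "f \<in> E" "a \<in> corner A e f" "x \<in> carrier (Fob G e)" for e f a x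
      using that car dF(4)[of e f a x] dG(4)[of e f a x] by simp
  qed
qed

lemma finsum_peirce_space:
  assumes M: "left_module A M" and e: "e \<in> E" and g: "g \<in> S \<rightarrow> carrier (peirce_space M e)"
  shows "(\<Oplus>\<^bsub>peirce_space M e\<^esub>s\<in>S. g s) = (\<Oplus>\<^bsub>M\<^esub>s\<in>S. g s)"
  using additive_finsum[OF abelian_group_peirce_space[OF M e] left_module.axioms(2)[OF M], of "\<lambda>x. x" g S] g
  by (simp add: mem_peirce_space Pi_iff peirce_space_def)

text \<open>
  A module is determined, as a record, by its functor of components and the map \<open>s\<close> that sums
  a tuple of components.
\<close>

theorem transport_total_space_peirce:
  assumes M: "left_module A M" and ext: "module_extensional A M"
  defines "s \<equiv> \<lambda>p. \<Oplus>\<^bsub>M\<^esub>e\<in>E. p e"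
  shows "bij_betw s (carrier (total_space (peirce M))) (carrier M)"
    and "transport A (total_space (peirce M)) s = M"
proof -
  interpret M: left_module A M by (rule M)
  note P = peirce_mem_Reps[OF M]
  let ?T = "total_space (peirce M)"
  have comp: "p e \<in> carrier (peirce_space M e)" and comp': "p e \<in> carrier M" "e \<odot>\<^bsub>M\<^esub> p e = p e"
    if "p \<in> carrier ?T" "e \<in> E" for p e
    using total_space_component[OF that] that by (simp_all add: mem_peirce_space)
  have carT: "carrier ?T = (\<Pi>\<^sub>E e\<in>E. carrier (peirce_space M e))" by (auto intro!: PiE_cong)
  have es: "e \<odot>\<^bsub>M\<^esub> s p = p e" if "p \<in> carrier ?T" "e \<in> E" for p e
    using smult_sum_peirce[OF M, of p e] that unfolding carT s_def by simp
  show bij: "bij_betw s (carrier ?T) (carrier M)"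
  proof (rule bij_betw_byWitness[where f' = "\<lambda>x. \<lambda>e\<in>E. e \<odot>\<^bsub>M\<^esub> x"])
    show "\<forall>p\<in>carrier ?T. (\<lambda>e\<in>E. e \<odot>\<^bsub>M\<^esub> s p) = p"
    proof
      fix p assume p: "p \<in> carrier ?T"
      then have "p \<in> extensional E" unfolding carT by (simp add: PiE_def)
      then show "(\<lambda>e\<in>E. e \<odot>\<^bsub>M\<^esub> s p) = p" using es[OF p] by (intro extensionalityI[of _ E]) auto
    qed
    show "\<forall>x\<in>carrier M. s (\<lambda>e\<in>E. e \<odot>\<^bsub>M\<^esub> x) = x"
    proof
      fix x assume x: "x \<in> carrier M"
      have "s (\<lambda>e\<in>E. e \<odot>\<^bsub>M\<^esub> x) = (\<Oplus>\<^bsub>M\<^esub>e\<in>E. e \<odot>\<^bsub>M\<^esub> x)"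
        unfolding s_def using x by (intro M.finsum_cong') (auto simp: M.smult_closed)
      then show "s (\<lambda>e\<in>E. e \<odot>\<^bsub>M\<^esub> x) = x" using sum_peirce_components[OF M x] by simp
    qed
    show "s ` carrier ?T \<subseteq> carrier M"
      using comp' by (auto simp: s_def intro!: M.finsum_closed)
    show "(\<lambda>x. \<lambda>e\<in>E. e \<odot>\<^bsub>M\<^esub> x) ` carrier M \<subseteq> carrier ?T"
      unfolding carT using idem_smult_mem_peirce_space[OF M] by auto
  qed
  show "transport A ?T s = M"
  proof (rule transport_eqI[OF ext left_module_total_space[OF P] bij])
    fix p q assume p: "p \<in> carrier ?T" and q: "q \<in> carrier ?T"
    have "s (p \<oplus>\<^bsub>?T\<^esub> q) = (\<Oplus>\<^bsub>M\<^esub>e\<in>E. p e \<oplus>\<^bsub>M\<^esub> q e)"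
      unfolding s_def using comp[OF p] comp[OF q] comp'[OF p] comp'[OF q]
      by (intro M.finsum_cong') (simp_all add: add_total_space[OF p q] Pi_iff)
    then show "s (p \<oplus>\<^bsub>?T\<^esub> q) = s p \<oplus>\<^bsub>M\<^esub> s q"
      using comp'[OF p] comp'[OF q] by (simp add: s_def M.finsum_addf Pi_iff)
  next
    show "s \<zero>\<^bsub>?T\<^esub> = \<zero>\<^bsub>M\<^esub>"
    proof -
      have "s \<zero>\<^bsub>?T\<^esub> = (\<Oplus>\<^bsub>M\<^esub>e\<in>E. \<zero>\<^bsub>M\<^esub>)" unfolding s_def by (intro M.finsum_cong') auto
      then show ?thesis by simp
    qed
  next
    fix a p assume a: "a \<in> carrier A" and p: "p \<in> carrier ?T"
    have sp: "s p \<in> carrier M" using bij p by (auto simp: bij_betw_def)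
    have "(a \<odot>\<^bsub>?T\<^esub> p) f = f \<odot>\<^bsub>M\<^esub> (a \<odot>\<^bsub>M\<^esub> s p)" if f: "f \<in> E" for f
    proof -
      have block: "Fmor (peirce M) e f (f \<otimes>\<^bsub>A\<^esub> a \<otimes>\<^bsub>A\<^esub> e) (p e) = (f \<otimes>\<^bsub>A\<^esub> a \<otimes>\<^bsub>A\<^esub> e) \<odot>\<^bsub>M\<^esub> p e"
        "(f \<otimes>\<^bsub>A\<^esub> a \<otimes>\<^bsub>A\<^esub> e) \<odot>\<^bsub>M\<^esub> p e \<in> carrier (peirce_space M f)" if "e \<in> E" for e
        using that f a comp[OF p] comp'[OF p]
        by (simp_all add: A.cornerI corner_smult_mem_peirce_space[OF M])
      have "(a \<odot>\<^bsub>?T\<^esub> p) f = (\<Oplus>\<^bsub>peirce_space M f\<^esub>e\<in>E. Fmor (peirce M) e f (f \<otimes>\<^bsub>A\<^esub> a \<otimes>\<^bsub>A\<^esub> e) (p e))"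
        using f by (simp add: smult_total_space[OF a p])
      also have "\<dots> = (\<Oplus>\<^bsub>M\<^esub>e\<in>E. Fmor (peirce M) e f (f \<otimes>\<^bsub>A\<^esub> a \<otimes>\<^bsub>A\<^esub> e) (p e))"
        using f block by (intro finsum_peirce_space[OF M]) auto
      also have "\<dots> = (\<Oplus>\<^bsub>M\<^esub>e\<in>E. (f \<otimes>\<^bsub>A\<^esub> a) \<odot>\<^bsub>M\<^esub> p e)"
        using f a block comp'[OF p]
        by (intro M.finsum_cong') (simp_all add: M.smult_assoc1 M.smult_closed Pi_iff)
      also have "\<dots> = (f \<otimes>\<^bsub>A\<^esub> a) \<odot>\<^bsub>M\<^esub> s p"
        unfolding s_def using f a comp'[OF p] by (simp add: M.finsum_smult_r Pi_iff)
      finally show ?thesis using f a sp by (simp add: M.smult_assoc1)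
    qed
    then have "s (a \<odot>\<^bsub>?T\<^esub> p) = (\<Oplus>\<^bsub>M\<^esub>f\<in>E. f \<odot>\<^bsub>M\<^esub> (a \<odot>\<^bsub>M\<^esub> s p))"
      using a sp by (subst s_def, intro M.finsum_cong') (auto simp: M.smult_closed)
    then show "s (a \<odot>\<^bsub>?T\<^esub> p) = a \<odot>\<^bsub>M\<^esub> s p"
      using a sp by (simp add: sum_peirce_components[OF M] M.smult_closed)
  qed
qed


section \<open>Matching modules and functors\<close>

lemma Mods_iff: "M \<in> Obj (LMod A) \<longleftrightarrow> left_module A M \<and> module_extensional A M"
  by (simp add: LMod_def)

text \<open>
  Tuples are coded by listing their components in a fixed order of \<open>E\<close>. Decoding recovers
  the total space, which determines the functor.
\<close>

lemma functors_inject_into_modules: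
  assumes "infinite (UNIV :: 'm set)"
  obtains \<Phi> :: "('a, 'a, ('k, 'm) module, 'm \<Rightarrow> 'm) cat_functor \<Rightarrow> ('a, 'm) module"
  where "inj_on \<Phi> (Obj Reps)" and "\<And>F. F \<in> Obj Reps \<Longrightarrow> \<Phi> F \<in> Obj (LMod A)"
    and "\<And>F. F \<in> Obj Reps \<Longrightarrow> isomorphic_objects Reps F (peirce (\<Phi> F))"
proof -
  obtain c :: "'m list \<Rightarrow> 'm" where c: "inj c"
    using ex_inj_lists[OF assms] by auto
  obtain es where es: "set es = E" using finite_E finite_list by blast
  define code where "code p = c (map p es)" for p
  have code: "inj_on code (extensional E)"
    using es by (auto intro!: inj_onI extensionalityI[of _ E] simp: code_def inj_eq[OF c])
  define \<Phi> where "\<Phi> F = transport A (total_space F) code" for F :: "('a, 'a, ('k, 'm) module, 'm \<Rightarrow> 'm) cat_functor"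
  have inj: "inj_on code (carrier (total_space F))" for F :: "('a, 'a, ('k, 'm) module, 'm \<Rightarrow> 'm) cat_functor"
    using code by (rule inj_on_subset) (auto simp: PiE_def)
  show ?thesis
  proof
    show "\<Phi> F \<in> Obj (LMod A)" if "F \<in> Obj Reps" for F
      using left_module_transport[OF left_module_total_space[OF that] inj] module_extensional_transport
      by (simp add: Mods_iff \<Phi>_def)
    show "isomorphic_objects Reps F (peirce (\<Phi> F))" if "F \<in> Obj Reps" for F
      unfolding \<Phi>_def by (rule isomorphic_objects_peirce_transport[OF that inj])
    show "inj_on \<Phi> (Obj Reps)"
    proof (rule inj_onI)
      fix F G assume F: "F \<in> Obj Reps" and G: "G \<in> Obj Reps" and eq: "\<Phi> F = \<Phi> G"
      have "transport A (\<Phi> H) (inv_into (extensional E) code) = total_space H" if "H \<in> Obj Reps" for H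
        unfolding \<Phi>_def
        by (rule transport_transport[OF module_extensional_total_space left_module_total_space[OF that]])
          (auto simp: PiE_def intro!: inv_into_f_f code)
      then have "total_space F = total_space G" using F G eq by metis
      then show "F = G" by (rule total_space_inject[OF F G])
    qed
  qed
qed

text \<open>
  The first entry of the list behind a code gives back the vector \<open>x\<close>, hence the functor \<open>peirce M\<close>. The remaining
  entries are values of the summation map \<open>s M\<close> at arguments \<open>\<beta> (peirce M) e x\<close> that are known once
  \<open>peirce M\<close> is known, so they determine \<open>s M\<close> and with it \<open>M\<close>.
\<close>

lemma modules_inject_into_functors:
  assumes "infinite (UNIV :: 'm set)" and E: "E \<noteq> {}"
  obtains \<Psi> :: "('a, 'm) module \<Rightarrow> ('a, 'a, ('k, 'm) module, 'm \<Rightarrow> 'm) cat_functor"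
  where "inj_on \<Psi> (Obj (LMod A))" and "\<And>M. M \<in> Obj (LMod A) \<Longrightarrow> \<Psi> M \<in> Obj Reps"
    and "\<And>M. M \<in> Obj (LMod A) \<Longrightarrow> isomorphic_objects Reps (\<Psi> M) (peirce M)"
proof -
  obtain c :: "'m list \<Rightarrow> 'm" where c: "inj c"
    using ex_inj_lists[OF assms(1)] by auto
  have "\<forall>F :: ('a, 'a, ('k, 'm) module, 'm \<Rightarrow> 'm) cat_functor \<in> Obj Reps. \<exists>\<beta>.
      (\<Union>e\<in>E. \<Union>x\<in>carrier (Fob F e). set (\<beta> e x)) = carrier (total_space F)"
  proof
    fix F :: "('a, 'a, ('k, 'm) module, 'm \<Rightarrow> 'm) cat_functor" assume "F \<in> Obj Reps"
    then show "\<exists>\<beta>. (\<Union>e\<in>E. \<Union>x\<in>carrier (Fob F e). set (\<beta> e x)) = carrier (total_space F)"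
      unfolding carrier_total_space
      by (intro ex_lists_cover_PiE[OF finite_E E]) (use zero_mem_Fob in blast)
  qed
  from bchoice[OF this] obtain \<beta> ::
      "('a, 'a, ('k, 'm) module, 'm \<Rightarrow> 'm) cat_functor \<Rightarrow> 'a \<Rightarrow> 'm \<Rightarrow> ('a \<Rightarrow> 'm) list"
    where \<beta>': "\<forall>F \<in> Obj Reps.
      (\<Union>e\<in>E. \<Union>x\<in>carrier (Fob F e). set (\<beta> F e x)) = carrier (total_space F)" ..
  note \<beta> = \<beta>'[rule_format]
  define s where "s M p = (\<Oplus>\<^bsub>M\<^esub>e\<in>E. p e)" for M :: "('a, 'm) module" and p
  define i where "i M e x = c (x # map (s M) (\<beta> (peirce M) e x))" for M e x
  define \<Psi> where "\<Psi> M = rename (peirce M) (i M)" for M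
  let ?r = "\<lambda>_ y. hd (inv_into UNIV c y)"
  have r: "?r e (i M e x) = x" for M e x using c by (simp add: i_def)
  have inj: "inj_on (i M e) S" for M e S using r by (rule inj_on_inverseI)
  have P: "peirce M \<in> Obj Reps" if "M \<in> Obj (LMod A)" for M :: "('a, 'm) module"
    using that by (simp add: Mods_iff peirce_mem_Reps)
  show ?thesis
  proof
    show "\<Psi> M \<in> Obj Reps" if "M \<in> Obj (LMod A)" for M
      unfolding \<Psi>_def by (intro rename_mem_Reps P that inj)
    show "isomorphic_objects Reps (\<Psi> M) (peirce M)" if "M \<in> Obj (LMod A)" for M
      unfolding \<Psi>_def by (intro isomorphic_objects_sym[OF isomorphic_objects_rename] P that inj)
    show "inj_on \<Psi> (Obj (LMod A))"
    proof (rule inj_onI)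
      fix M N :: "('a, 'm) module" assume M: "M \<in> Obj (LMod A)" and N: "N \<in> Obj (LMod A)" and eq: "\<Psi> M = \<Psi> N"
      have "rename (\<Psi> L) ?r = peirce L" if "L \<in> Obj (LMod A)" for L
        unfolding \<Psi>_def by (intro rename_rename P that r)
      then have MN: "peirce M = peirce N" using M N eq by metis
      have "map (s M) (\<beta> (peirce M) e x) = map (s N) (\<beta> (peirce M) e x)"
        if e: "e \<in> E" and x: "x \<in> carrier (Fob (peirce M) e)" for e x
      proof -
        have "carrier (Fob (\<Psi> L) e) = i L e ` carrier (Fob (peirce L) e)" for L
          using e by (simp add: \<Psi>_def)
        then have "i M e ` carrier (Fob (peirce M) e) = i N e ` carrier (Fob (peirce M) e)"
          using eq MN by metis
        then obtain x' where x': "i M e x = i N e x'" using x by blast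
        then have "x = x'" using r by metis
        with x' show ?thesis using MN c by (simp add: i_def inj_eq)
      qed
      then have "\<forall>p\<in>set (\<beta> (peirce M) e x). s M p = s N p"
        if "e \<in> E" "x \<in> carrier (Fob (peirce M) e)" for e x
        using that by simp
      then have s: "s M p = s N p" if "p \<in> carrier (total_space (peirce M))" for p
        using that unfolding \<beta>[OF P[OF M], symmetric] by blast
      have "M = transport A (total_space (peirce M)) (s M)"
        using transport_total_space_peirce(2)[of M] M by (simp add: Mods_iff s_def[abs_def])
      also have "\<dots> = transport A (total_space (peirce M)) (s N)"
        using transport_total_space_peirce(1)[of N] N MN
        by (intro transport_cong s left_module_total_space P M) (auto simp: Mods_iff s_def[abs_def] bij_betw_def)
      also have "\<dots> = N"
        using transport_total_space_peirce(2)[of N] N MN by (simp add: Mods_iff s_def[abs_def])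
      finally show "M = N" .
    qed
  qed
qed

theorem isomorphic_Reps_LMod:
  assumes inf: "infinite (UNIV :: 'm set)" and E: "E \<noteq> {}"
  shows "isomorphic_categories
    (Reps :: (('a, 'a, ('k, 'm) module, 'm \<Rightarrow> 'm) cat_functor, 'a \<Rightarrow> 'm \<Rightarrow> 'm) category)
    (LMod A :: (('a, 'm) module, 'm \<Rightarrow> 'm) category)"
proof -
  obtain \<Phi> :: "('a, 'a, ('k, 'm) module, 'm \<Rightarrow> 'm) cat_functor \<Rightarrow> ('a, 'm) module" where
    \<Phi>: "inj_on \<Phi> (Obj Reps)" "\<And>F. F \<in> Obj Reps \<Longrightarrow> \<Phi> F \<in> Obj (LMod A)"
      "\<And>F. F \<in> Obj Reps \<Longrightarrow> isomorphic_objects Reps F (peirce (\<Phi> F))"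
    using functors_inject_into_modules[OF inf] by blast
  obtain \<Psi> :: "('a, 'm) module \<Rightarrow> ('a, 'a, ('k, 'm) module, 'm \<Rightarrow> 'm) cat_functor" where
    \<Psi>: "inj_on \<Psi> (Obj (LMod A))" "\<And>M. M \<in> Obj (LMod A) \<Longrightarrow> \<Psi> M \<in> Obj Reps"
      "\<And>M. M \<in> Obj (LMod A) \<Longrightarrow> isomorphic_objects Reps (\<Psi> M) (peirce M)"
    using modules_inject_into_functors[OF inf E] by blast
  have ff: "bij_betw (Fmor peirce_functor M N) (Mor (LMod A) M N) (Mor Reps (Fob peirce_functor M) (Fob peirce_functor N))"
    if "M \<in> Obj (LMod A)" "N \<in> Obj (LMod A)" for M N :: "('a, 'm) module"
    using peirce_functor_fully_faithful[of M N] that by (simp add: LMod_def)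
  show ?thesis
    by (rule isomorphic_categories_Schroeder_Bernstein[OF cat_functor_peirce_functor ff \<Phi>(1,2) _ \<Psi>(1,2)])
      (simp_all add: \<Phi>(3) \<Psi>(3))
qed

end

theorem proposition1p3p2:
  fixes K :: "('k, 'x) ring_scheme" and A :: "('k, 'a) module" and E :: "'a set"
  assumes "field K"
    and "assoc_algebra K A"
    and "\<one>\<^bsub>A\<^esub> \<noteq> \<zero>\<^bsub>A\<^esub>"
    and "artinian A"
    and "finite E"
    and "\<forall>e\<in>E. primitive_idempotent A e"
    and "\<forall>e\<in>E. \<forall>f\<in>E. e \<noteq> f \<longrightarrow> orthogonal_elems A e f"
    and "\<one>\<^bsub>A\<^esub> = (\<Oplus>\<^bsub>A\<^esub>e\<in>E. e)"
    and "infinite (UNIV :: 'm set)"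
  shows "isomorphic_categories
    (linear_functor_category K (idempotent_category A E)
      (Vect K :: ('k, ('k, 'm) module, 'm \<Rightarrow> 'm) linear_category))
    (LMod A :: (('a, 'm) module, 'm \<Rightarrow> 'm) category)"
proof -
  interpret assoc_algebra K A by fact
  interpret idempotent_decomposition K A E
    using assms by unfold_locales (auto simp: primitive_idempotent_def orthogonal_elems_def)
  have "E \<noteq> {}" using assms(3,8) by auto
  then show ?thesis by (rule isomorphic_Reps_LMod[OF assms(9)])
qed

end
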